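(* For $i=1,2$ let $(\mathcal{D}_i,\mathcal{A}_i;\beta_i)$ be an abelian representation. Suppose given two exact $1$-morphisms of abelian representations $$\alpha_1=(\phi_1,\Phi_1;\kappa_1):(\mathcal{D}_1,\mathcal{A}_1;\beta_1)\to(\mathcal{D}_2,\mathcal{A}_2;\beta_2),\qquad \alpha_2=(\phi_2,\Phi_2;\kappa_2^{-1}):(\mathcal{D}_2,\mathcal{A}_2;\beta_2)\to(\mathcal{D}_1,\mathcal{A}_1;\beta_1)$$ together with adjunctions $\phi_1:\mathcal{D}_1\rightleftarrows\mathcal{D}_2:\phi_2$ and $\Phi_1:\mathcal{A}_1\rightleftarrows\mathcal{A}_2:\Phi_2$ such that the pair $(\alpha_1,\alpha_2)$ is adjoint, and let $$\overline{\phi_1}:\mathbf{A}(\beta_1)\rightleftarrows\mathbf{A}(\beta_2):\overline{\phi_2}$$ be the unique adjunction such that the pairs $(\hat{\alpha}_1,\hat{\alpha}_2)$ and $(\tilde{\alpha}_1,\tilde{\alpha}_2)$ are adjoint. Suppose in addition that the adjunction $\phi_1:\mathcal{D}_1\rightleftarrows\mathcal{D}_2:\phi_2$ is an equivalence. Then the adjunction $\overline{\phi_1}:\mathbf{A}(\beta_1)\rightleftarrows\mathbf{A}(\beta_2):\overline{\phi_2}$ is an equivalence as well.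
   Context: Abelian hulls. For an additive category $\mathcal{D}$, let $\mathbf{R}(\mathcal{D})$ be the full subcategory of $\mathrm{Fun}(\mathcal{D}^{op},\mathbf{Ab})$ consisting of finitely presented presheaves (cokernels of morphisms between representable presheaves), $\mathbf{L}(\mathcal{D}):=\mathbf{R}(\mathcal{D}^{op})^{op}$, and $\mathbf{A}(\mathcal{D}):=\mathbf{L}(\mathbf{R}(\mathcal{D}))$. By Freyd, $\mathbf{A}(\mathcal{D})$ is abelian, there is a canonical fully faithful additive embedding $\mathcal{D}\hookrightarrow\mathbf{A}(\mathcal{D})$, every additive functor $\beta:\mathcal{D}\to\mathcal{A}$ to an abelian category extends to an exact functor $\beta^+:\mathbf{A}(\mathcal{D})\to\mathcal{A}$ (unique up to unique natural isomorphism restricting to the identity on $\mathcal{D}$), and natural transformations extend uniquely. Representations. An abelian representation $(\mathcal{D},\mathcal{A};\beta)$ is an additive functor $\beta:\mathcal{D}\to\mathcal{A}$ from an additive to an abelian category. Its universal abelian factorization is the Serre quotient $\mathbf{A}(\beta):=\mathbf{A}(\mathcal{D})/\ker(\beta^+)$, with canonical functor $\pi:\mathcal{D}\to\mathbf{A}(\beta)$ and induced faithful exact functor $\iota:\mathbf{A}(\beta)\to\mathcal{A}$, $\beta=\iota\circ\pi$. A $1$-morphism $(F,G;\kappa):(\mathcal{C}_1,\mathcal{E}_1;R_1)\to(\mathcal{C}_2,\mathcal{E}_2;R_2)$ of representations consists of additive functors $F:\mathcal{C}_1\to\mathcal{C}_2$, $G:\mathcal{E}_1\to\mathcal{E}_2$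 and a natural isomorphism $\kappa:G\circ R_1\xrightarrow{\sim}R_2\circ F$; between abelian representations it is exact if $G$ is exact. Adjoint pairs. An adjunction $F_1:\mathcal{C}_1\rightleftarrows\mathcal{C}_2:F_2$ consists of functors $F_1,F_2$ and natural transformations $\eta:\mathrm{id}_{\mathcal{C}_1}\to F_2\circ F_1$ (unit) and $\epsilon:F_1\circ F_2\to\mathrm{id}_{\mathcal{C}_2}$ (co-unit) satisfying the triangular identities; it is an equivalence if both $\eta$ and $\epsilon$ are invertible (equivalently, $F_1$ and $F_2$ are both fully faithful). Given representations $R_i:\mathcal{C}_i\to\mathcal{E}_i$ ($i=1,2$), adjunctions $F_1:\mathcal{C}_1\rightleftarrows\mathcal{C}_2:F_2$ and $G_1:\mathcal{E}_1\rightleftarrows\mathcal{E}_2:G_2$, and $1$-morphisms $\alpha_1=(F_1,G_1;\kappa_1)$ and $\alpha_2=(F_2,G_2;\kappa_2^{-1})$ (so $\kappa_1:G_1R_1\xrightarrow{\sim}R_2F_1$ and $\kappa_2:R_1F_2\xrightarrow{\sim}G_2R_2$), the pair $(\alpha_1,\alpha_2)$ is called adjoint if the composites $R_1\xrightarrow{R_1(\eta)}R_1F_2F_1\xrightarrow{\kappa_2}G_2R_2F_1$ and $R_1\xrightarrow{\eta}G_2G_1R_1\xrightarrow{\kappa_1}G_2R_2F_1$ agree, and the composites $G_1R_1F_2\xrightarrow{\kappa_1}R_2F_1F_2\xrightarrow{R_2(\epsilon)}R_2$ and $G_1R_1F_2\xrightarrow{\kappa_2}G_1G_2R_2\xrightarrow{\epsilon}R_2$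 agree. Lifts. For an exact $1$-morphism $\alpha=(\phi,\Phi;\kappa):(\mathcal{D},\mathcal{A};\beta)\to(\mathcal{D}',\mathcal{A}';\beta')$ of abelian representations, $\overline{\phi}:\mathbf{A}(\beta)\to\mathbf{A}(\beta')$ denotes the exact functor (unique up to unique natural isomorphism restricting to the identity along $\pi$) with $\pi'\circ\phi=\overline{\phi}\circ\pi$, and $\tilde{\kappa}:\Phi\circ\iota\xrightarrow{\sim}\iota'\circ\overline{\phi}$ denotes the unique natural isomorphism whose restriction along $\pi$ is $\kappa$. Set $\hat{\alpha}:=(\phi,\overline{\phi};\mathrm{id}):(\mathcal{D},\mathbf{A}(\beta);\pi)\to(\mathcal{D}',\mathbf{A}(\beta');\pi')$ and $\tilde{\alpha}:=(\overline{\phi},\Phi;\tilde{\kappa}):(\mathbf{A}(\beta),\mathcal{A};\iota)\to(\mathbf{A}(\beta'),\mathcal{A}';\iota')$. Under the stated hypotheses the adjunction between $\overline{\phi_1}$ and $\overline{\phi_2}$ with the stated adjointness property exists and is unique. *)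

theory Defs
  imports "HOL-Algebra.Group"
begin

section \<open>Categories with addition on morphisms\<close>

text \<open>One record serves for all categories below. The operation \<open>Add\<close> and the zero morphisms
  \<open>Zer\<close> are constrained only from \<open>preadditive_category\<close> on.\<close>

record ('o, 'm) cat =
  Ob :: "'o set"
  Mor :: "'m set"
  Dom :: "'m \<Rightarrow> 'o"
  Cod :: "'m \<Rightarrow> 'o"
  Idn :: "'o \<Rightarrow> 'm"
  Comp :: "'m \<Rightarrow> 'm \<Rightarrow> 'm"  (infixr "\<cdot>\<index>" 70)
  Add :: "'m \<Rightarrow> 'm \<Rightarrow> 'm"
  Zer :: "'o \<Rightarrow> 'o \<Rightarrow> 'm"

definition Hom :: "('o, 'm) cat \<Rightarrow> 'o \<Rightarrow> 'o \<Rightarrow> 'm set" where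
  "Hom C X Y = {f \<in> Mor C. Dom C f = X \<and> Cod C f = Y}"

locale category =
  fixes C :: "('o, 'm) cat" (structure)
  assumes Dom_Ob: "f \<in> Mor C \<Longrightarrow> Dom C f \<in> Ob C"
    and Cod_Ob: "f \<in> Mor C \<Longrightarrow> Cod C f \<in> Ob C"
    and Idn_Hom: "X \<in> Ob C \<Longrightarrow> Idn C X \<in> Hom C X X"
    and Comp_Hom: "\<lbrakk>f \<in> Hom C X Y; g \<in> Hom C Y Z\<rbrakk> \<Longrightarrow> g \<cdot> f \<in> Hom C X Z"
    and Comp_Idn: "f \<in> Hom C X Y \<Longrightarrow> f \<cdot> Idn C X = f"
    and Idn_Comp: "f \<in> Hom C X Y \<Longrightarrow> Idn C Y \<cdot> f = f"
    and Comp_assoc: "\<lbrakk>f \<in> Hom C X Y; g \<in> Hom C Y Z; h \<in> Hom C Z W\<rbrakk>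
      \<Longrightarrow> h \<cdot> (g \<cdot> f) = (h \<cdot> g) \<cdot> f"

definition hom_group :: "('o, 'm) cat \<Rightarrow> 'o \<Rightarrow> 'o \<Rightarrow> 'm monoid" where
  "hom_group C X Y = \<lparr>carrier = Hom C X Y, monoid.mult = Add C, one = Zer C X Y\<rparr>"

locale preadditive_category = category +
  assumes hom_comm_group: "\<lbrakk>X \<in> Ob C; Y \<in> Ob C\<rbrakk> \<Longrightarrow> comm_group (hom_group C X Y)"
    and Comp_Add_right: "\<lbrakk>f \<in> Hom C X Y; g \<in> Hom C X Y; h \<in> Hom C Y Z\<rbrakk>
      \<Longrightarrow> h \<cdot> Add C f g = Add C (h \<cdot> f) (h \<cdot> g)"
    and Comp_Add_left: "\<lbrakk>h \<in> Hom C X Y; f \<in> Hom C Y Z; g \<in> Hom C Y Z\<rbrakk>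
      \<Longrightarrow> Add C f g \<cdot> h = Add C (f \<cdot> h) (g \<cdot> h)"

definition is_zero_object :: "('o, 'm) cat \<Rightarrow> 'o \<Rightarrow> bool" where
  "is_zero_object C Z \<longleftrightarrow> Z \<in> Ob C \<and>
     (\<forall>X \<in> Ob C. (\<exists>!f. f \<in> Hom C X Z) \<and> (\<exists>!f. f \<in> Hom C Z X))"

definition is_biproduct ::
  "('o, 'm) cat \<Rightarrow> 'o \<Rightarrow> 'o \<Rightarrow> 'o \<Rightarrow> 'm \<Rightarrow> 'm \<Rightarrow> 'm \<Rightarrow> 'm \<Rightarrow> bool" where
  "is_biproduct C X Y P i j p q \<longleftrightarrow>
     i \<in> Hom C X P \<and> j \<in> Hom C Y P \<and> p \<in> Hom C P X \<and> q \<in> Hom C P Y \<and>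
     p \<cdot>\<^bsub>C\<^esub> i = Idn C X \<and> q \<cdot>\<^bsub>C\<^esub> j = Idn C Y \<and>
     q \<cdot>\<^bsub>C\<^esub> i = Zer C X Y \<and> p \<cdot>\<^bsub>C\<^esub> j = Zer C Y X \<and>
     Add C (i \<cdot>\<^bsub>C\<^esub> p) (j \<cdot>\<^bsub>C\<^esub> q) = Idn C P"

locale additive_category = preadditive_category +
  assumes zero_object: "\<exists>Z. is_zero_object C Z"
    and biproduct: "\<lbrakk>X \<in> Ob C; Y \<in> Ob C\<rbrakk>
      \<Longrightarrow> \<exists>P \<in> Ob C. \<exists>i j p q. is_biproduct C X Y P i j p q"

definition op_cat :: "('o, 'm) cat \<Rightarrow> ('o, 'm) cat" where
  "op_cat C = \<lparr>Ob = Ob C, Mor = Mor C, Dom = Cod C, Cod = Dom C, Idn = Idn C,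
     Comp = (\<lambda>g f. f \<cdot>\<^bsub>C\<^esub> g), Add = Add C, Zer = (\<lambda>X Y. Zer C Y X)\<rparr>"

definition full_subcat :: "('o, 'm) cat \<Rightarrow> 'o set \<Rightarrow> ('o, 'm) cat" where
  "full_subcat C S =
     C\<lparr>Ob := Ob C \<inter> S, Mor := {f \<in> Mor C. Dom C f \<in> S \<and> Cod C f \<in> S}\<rparr>"

definition is_mono :: "('o, 'm) cat \<Rightarrow> 'm \<Rightarrow> bool" where
  "is_mono C f \<longleftrightarrow> f \<in> Mor C \<and>
     (\<forall>T. \<forall>g \<in> Hom C T (Dom C f). \<forall>h \<in> Hom C T (Dom C f). f \<cdot>\<^bsub>C\<^esub> g = f \<cdot>\<^bsub>C\<^esub> h \<longrightarrow> g = h)"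

definition is_epi :: "('o, 'm) cat \<Rightarrow> 'm \<Rightarrow> bool" where
  "is_epi C f \<longleftrightarrow> f \<in> Mor C \<and>
     (\<forall>T. \<forall>g \<in> Hom C (Cod C f) T. \<forall>h \<in> Hom C (Cod C f) T. g \<cdot>\<^bsub>C\<^esub> f = h \<cdot>\<^bsub>C\<^esub> f \<longrightarrow> g = h)"

definition is_inverse :: "('o, 'm) cat \<Rightarrow> 'm \<Rightarrow> 'm \<Rightarrow> bool" where
  "is_inverse C f g \<longleftrightarrow> f \<in> Mor C \<and> g \<in> Hom C (Cod C f) (Dom C f) \<and>
     g \<cdot>\<^bsub>C\<^esub> f = Idn C (Dom C f) \<and> f \<cdot>\<^bsub>C\<^esub> g = Idn C (Cod C f)"

definition is_iso :: "('o, 'm) cat \<Rightarrow> 'm \<Rightarrow> bool" where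
  "is_iso C f \<longleftrightarrow> (\<exists>g. is_inverse C f g)"

definition inv_mor :: "('o, 'm) cat \<Rightarrow> 'm \<Rightarrow> 'm" where
  "inv_mor C f = (THE g. is_inverse C f g)"

definition is_kernel :: "('o, 'm) cat \<Rightarrow> 'm \<Rightarrow> 'm \<Rightarrow> bool" where
  "is_kernel C f k \<longleftrightarrow> f \<in> Mor C \<and> k \<in> Mor C \<and> Cod C k = Dom C f \<and>
     f \<cdot>\<^bsub>C\<^esub> k = Zer C (Dom C k) (Cod C f) \<and>
     (\<forall>T. \<forall>t \<in> Hom C T (Dom C f). f \<cdot>\<^bsub>C\<^esub> t = Zer C T (Cod C f) \<longrightarrow>
        (\<exists>!u. u \<in> Hom C T (Dom C k) \<and> k \<cdot>\<^bsub>C\<^esub> u = t))"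

definition is_cokernel :: "('o, 'm) cat \<Rightarrow> 'm \<Rightarrow> 'm \<Rightarrow> bool" where
  "is_cokernel C f c \<longleftrightarrow> f \<in> Mor C \<and> c \<in> Mor C \<and> Dom C c = Cod C f \<and>
     c \<cdot>\<^bsub>C\<^esub> f = Zer C (Dom C f) (Cod C c) \<and>
     (\<forall>T. \<forall>t \<in> Hom C (Cod C f) T. t \<cdot>\<^bsub>C\<^esub> f = Zer C (Dom C f) T \<longrightarrow>
        (\<exists>!u. u \<in> Hom C (Cod C c) T \<and> u \<cdot>\<^bsub>C\<^esub> c = t))"

locale abelian_category = additive_category +
  assumes has_kernel: "f \<in> Mor C \<Longrightarrow> \<exists>k. is_kernel C f k"
    and has_cokernel: "f \<in> Mor C \<Longrightarrow> \<exists>c. is_cokernel C f c"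
    and mono_normal: "is_mono C f \<Longrightarrow> \<exists>g. is_kernel C g f"
    and epi_normal: "is_epi C f \<Longrightarrow> \<exists>g. is_cokernel C g f"


section \<open>Functors, natural transformations, adjunctions\<close>

record ('o1, 'm1, 'o2, 'm2) ftor =
  FO :: "'o1 \<Rightarrow> 'o2"
  FM :: "'m1 \<Rightarrow> 'm2"

definition is_functor ::
  "('o1, 'm1) cat \<Rightarrow> ('o2, 'm2) cat \<Rightarrow> ('o1, 'm1, 'o2, 'm2) ftor \<Rightarrow> bool" where
  "is_functor C D F \<longleftrightarrow>
     (\<forall>X \<in> Ob C. FO F X \<in> Ob D) \<and>
     (\<forall>f \<in> Mor C. FM F f \<in> Hom D (FO F (Dom C f)) (FO F (Cod C f))) \<and>
     (\<forall>X \<in> Ob C. FM F (Idn C X) = Idn D (FO F X)) \<and>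
     (\<forall>f \<in> Mor C. \<forall>g \<in> Mor C. Cod C f = Dom C g \<longrightarrow>
        FM F (g \<cdot>\<^bsub>C\<^esub> f) = FM F g \<cdot>\<^bsub>D\<^esub> FM F f)"

definition id_ftor :: "('o, 'm, 'o, 'm) ftor" where
  "id_ftor = \<lparr>FO = id, FM = id\<rparr>"

definition comp_ftor :: "('o2, 'm2, 'o3, 'm3) ftor \<Rightarrow> ('o1, 'm1, 'o2, 'm2) ftor
    \<Rightarrow> ('o1, 'm1, 'o3, 'm3) ftor"  (infixr "\<circ>\<^sub>F" 75) where
  "G \<circ>\<^sub>F F = \<lparr>FO = FO G \<circ> FO F, FM = FM G \<circ> FM F\<rparr>"

text \<open>Equality of functors with source \<open>C\<close>; values outside \<open>C\<close> are irrelevant.\<close>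

definition ftor_eq ::
  "('o1, 'm1) cat \<Rightarrow> ('o1, 'm1, 'o2, 'm2) ftor \<Rightarrow> ('o1, 'm1, 'o2, 'm2) ftor \<Rightarrow> bool" where
  "ftor_eq C F G \<longleftrightarrow> (\<forall>X \<in> Ob C. FO F X = FO G X) \<and> (\<forall>f \<in> Mor C. FM F f = FM G f)"

definition additive_functor ::
  "('o1, 'm1) cat \<Rightarrow> ('o2, 'm2) cat \<Rightarrow> ('o1, 'm1, 'o2, 'm2) ftor \<Rightarrow> bool" where
  "additive_functor C D F \<longleftrightarrow> is_functor C D F \<and>
     (\<forall>f \<in> Mor C. \<forall>g \<in> Mor C. Dom C f = Dom C g \<and> Cod C f = Cod C g \<longrightarrow>
        FM F (Add C f g) = Add D (FM F f) (FM F g))"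

definition exact_functor ::
  "('o1, 'm1) cat \<Rightarrow> ('o2, 'm2) cat \<Rightarrow> ('o1, 'm1, 'o2, 'm2) ftor \<Rightarrow> bool" where
  "exact_functor C D F \<longleftrightarrow> additive_functor C D F \<and>
     (\<forall>f k. is_kernel C f k \<longrightarrow> is_kernel D (FM F f) (FM F k)) \<and>
     (\<forall>f c. is_cokernel C f c \<longrightarrow> is_cokernel D (FM F f) (FM F c))"

definition nat_trans :: "('o1, 'm1) cat \<Rightarrow> ('o2, 'm2) cat \<Rightarrow>
    ('o1, 'm1, 'o2, 'm2) ftor \<Rightarrow> ('o1, 'm1, 'o2, 'm2) ftor \<Rightarrow> ('o1 \<Rightarrow> 'm2) \<Rightarrow> bool" where
  "nat_trans C D F G t \<longleftrightarrow>
     (\<forall>X \<in> Ob C. t X \<in> Hom D (FO F X) (FO G X)) \<and>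
     (\<forall>f \<in> Mor C. t (Cod C f) \<cdot>\<^bsub>D\<^esub> FM F f = FM G f \<cdot>\<^bsub>D\<^esub> t (Dom C f))"

definition nat_iso :: "('o1, 'm1) cat \<Rightarrow> ('o2, 'm2) cat \<Rightarrow>
    ('o1, 'm1, 'o2, 'm2) ftor \<Rightarrow> ('o1, 'm1, 'o2, 'm2) ftor \<Rightarrow> ('o1 \<Rightarrow> 'm2) \<Rightarrow> bool" where
  "nat_iso C D F G t \<longleftrightarrow> nat_trans C D F G t \<and> (\<forall>X \<in> Ob C. is_iso D (t X))"

definition adjunction :: "('o1, 'm1) cat \<Rightarrow> ('o2, 'm2) cat \<Rightarrow>
    ('o1, 'm1, 'o2, 'm2) ftor \<Rightarrow> ('o2, 'm2, 'o1, 'm1) ftor \<Rightarrow>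
    ('o1 \<Rightarrow> 'm1) \<Rightarrow> ('o2 \<Rightarrow> 'm2) \<Rightarrow> bool" where
  "adjunction C1 C2 F1 F2 \<eta> \<epsilon> \<longleftrightarrow>
     is_functor C1 C2 F1 \<and> is_functor C2 C1 F2 \<and>
     nat_trans C1 C1 id_ftor (F2 \<circ>\<^sub>F F1) \<eta> \<and>
     nat_trans C2 C2 (F1 \<circ>\<^sub>F F2) id_ftor \<epsilon> \<and>
     (\<forall>X \<in> Ob C1. \<epsilon> (FO F1 X) \<cdot>\<^bsub>C2\<^esub> FM F1 (\<eta> X) = Idn C2 (FO F1 X)) \<and>
     (\<forall>Y \<in> Ob C2. FM F2 (\<epsilon> Y) \<cdot>\<^bsub>C1\<^esub> \<eta> (FO F2 Y) = Idn C1 (FO F2 Y))"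

definition adjoint_equivalence :: "('o1, 'm1) cat \<Rightarrow> ('o2, 'm2) cat \<Rightarrow>
    ('o1, 'm1, 'o2, 'm2) ftor \<Rightarrow> ('o2, 'm2, 'o1, 'm1) ftor \<Rightarrow>
    ('o1 \<Rightarrow> 'm1) \<Rightarrow> ('o2 \<Rightarrow> 'm2) \<Rightarrow> bool" where
  "adjoint_equivalence C1 C2 F1 F2 \<eta> \<epsilon> \<longleftrightarrow> adjunction C1 C2 F1 F2 \<eta> \<epsilon> \<and>
     (\<forall>X \<in> Ob C1. is_iso C1 (\<eta> X)) \<and> (\<forall>Y \<in> Ob C2. is_iso C2 (\<epsilon> Y))"


section \<open>Presheaves of abelian groups\<close>

text \<open>The category of abelian groups with carrier in a given type. A homomorphism carries its
  source and target, and its map is \<open>undefined\<close> outside the carrier of the source. Groups that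
  differ only in the multiplication outside the carrier are distinct, but isomorphic, objects.\<close>

datatype 'g ab_mor =
  Ab_Mor (ab_src: "'g monoid") (ab_map: "'g \<Rightarrow> 'g") (ab_tgt: "'g monoid")

definition Ab :: "('g monoid, 'g ab_mor) cat" where
  "Ab = \<lparr>Ob = {G. comm_group G},
     Mor = {a. comm_group (ab_src a) \<and> comm_group (ab_tgt a) \<and>
       ab_map a \<in> hom (ab_src a) (ab_tgt a) \<and> ab_map a \<in> extensional (carrier (ab_src a))},
     Dom = ab_src,
     Cod = ab_tgt,
     Idn = (\<lambda>G. Ab_Mor G (\<lambda>x \<in> carrier G. x) G),
     Comp = (\<lambda>b a. Ab_Mor (ab_src a) (\<lambda>x \<in> carrier (ab_src a). ab_map b (ab_map a x)) (ab_tgt b)),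
     Add = (\<lambda>a b. Ab_Mor (ab_src a)
       (\<lambda>x \<in> carrier (ab_src a). ab_map a x \<otimes>\<^bsub>ab_tgt a\<^esub> ab_map b x) (ab_tgt a)),
     Zer = (\<lambda>G H. Ab_Mor G (\<lambda>x \<in> carrier G. \<one>\<^bsub>H\<^esub>) H)\<rparr>"

datatype ('o1, 'm1, 'o2, 'm2) ftor_mor =
  Ftor_Mor (ft_src: "('o1, 'm1, 'o2, 'm2) ftor") (ft_cmp: "'o1 \<Rightarrow> 'm2")
    (ft_tgt: "('o1, 'm1, 'o2, 'm2) ftor")

definition ftor_set ::
  "('o1, 'm1) cat \<Rightarrow> ('o2, 'm2) cat \<Rightarrow> ('o1, 'm1, 'o2, 'm2) ftor set" where
  "ftor_set C E =
     {F. is_functor C E F \<and> FO F \<in> extensional (Ob C) \<and> FM F \<in> extensional (Mor C)}"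

definition fun_cat :: "('o1, 'm1) cat \<Rightarrow> ('o2, 'm2) cat \<Rightarrow>
    (('o1, 'm1, 'o2, 'm2) ftor, ('o1, 'm1, 'o2, 'm2) ftor_mor) cat" where
  "fun_cat C E = \<lparr>Ob = ftor_set C E,
     Mor = {a. ft_src a \<in> ftor_set C E \<and> ft_tgt a \<in> ftor_set C E \<and>
       nat_trans C E (ft_src a) (ft_tgt a) (ft_cmp a) \<and> ft_cmp a \<in> extensional (Ob C)},
     Dom = ft_src,
     Cod = ft_tgt,
     Idn = (\<lambda>F. Ftor_Mor F (\<lambda>X \<in> Ob C. Idn E (FO F X)) F),
     Comp = (\<lambda>b a. Ftor_Mor (ft_src a) (\<lambda>X \<in> Ob C. ft_cmp b X \<cdot>\<^bsub>E\<^esub> ft_cmp a X) (ft_tgt b)),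
     Add = (\<lambda>a b. Ftor_Mor (ft_src a) (\<lambda>X \<in> Ob C. Add E (ft_cmp a X) (ft_cmp b X)) (ft_tgt a)),
     Zer = (\<lambda>F G. Ftor_Mor F (\<lambda>X \<in> Ob C. Zer E (FO F X) (FO G X)) G)\<rparr>"

text \<open>Presheaves take values in abelian groups with carrier in \<open>'m set\<close>, where \<open>'m\<close> is the type
  of morphisms. Up to isomorphism this leaves room for every quotient of a group
  \<open>Hom C A Y\<close>, realised on the cosets, and hence for every finitely presented presheaf.
  A representable presheaf is realised on cosets of the trivial subgroup, i.e. a morphism \<open>f\<close>
  is encoded as \<open>{f}\<close>.\<close>

type_synonym ('o, 'm) psh = "('o, 'm, 'm set monoid, 'm set ab_mor) ftor"
type_synonym ('o, 'm) psh_mor = "('o, 'm, 'm set monoid, 'm set ab_mor) ftor_mor"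

definition PSh :: "('o, 'm) cat \<Rightarrow> (('o, 'm) psh, ('o, 'm) psh_mor) cat" where
  "PSh C = fun_cat (op_cat C) Ab"

definition sing_group :: "('o, 'm) cat \<Rightarrow> 'o \<Rightarrow> 'o \<Rightarrow> 'm set monoid" where
  "sing_group C A X = \<lparr>carrier = (\<lambda>f. {f}) ` Hom C A X,
     monoid.mult = (\<lambda>S T. {Add C (the_elem S) (the_elem T)}), one = {Zer C A X}\<rparr>"

definition representable :: "('o, 'm) cat \<Rightarrow> 'o \<Rightarrow> ('o, 'm) psh" where
  "representable C X = \<lparr>FO = (\<lambda>A \<in> Ob C. sing_group C A X),
     FM = (\<lambda>f \<in> Mor C. Ab_Mor (sing_group C (Cod C f) X)
       (\<lambda>S \<in> carrier (sing_group C (Cod C f) X). {the_elem S \<cdot>\<^bsub>C\<^esub> f})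
       (sing_group C (Dom C f) X))\<rparr>"

definition yoneda :: "('o, 'm) cat \<Rightarrow> ('o, 'm, ('o, 'm) psh, ('o, 'm) psh_mor) ftor" where
  "yoneda C = \<lparr>FO = representable C,
     FM = (\<lambda>h. Ftor_Mor (representable C (Dom C h))
       (\<lambda>A \<in> Ob C. Ab_Mor (sing_group C A (Dom C h))
         (\<lambda>S \<in> carrier (sing_group C A (Dom C h)). {h \<cdot>\<^bsub>C\<^esub> the_elem S})
         (sing_group C A (Cod C h)))
       (representable C (Cod C h)))\<rparr>"

definition fin_presented :: "('o, 'm) cat \<Rightarrow> ('o, 'm) psh \<Rightarrow> bool" where
  "fin_presented C P \<longleftrightarrow> (\<exists>X \<in> Ob C. \<exists>Y \<in> Ob C.
     \<exists>t \<in> Hom (PSh C) (representable C X) (representable C Y).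
     \<exists>c. is_cokernel (PSh C) t c \<and> Cod (PSh C) c = P)"


section \<open>The abelian hull of an additive category\<close>

definition Rcat :: "('o, 'm) cat \<Rightarrow> (('o, 'm) psh, ('o, 'm) psh_mor) cat" where
  "Rcat C = full_subcat (PSh C) {P. fin_presented C P}"

definition Lcat :: "('o, 'm) cat \<Rightarrow> (('o, 'm) psh, ('o, 'm) psh_mor) cat" where
  "Lcat C = op_cat (Rcat (op_cat C))"

type_synonym ('o, 'm) hull_ob = "(('o, 'm) psh, ('o, 'm) psh_mor) psh"
type_synonym ('o, 'm) hull_mor = "(('o, 'm) psh, ('o, 'm) psh_mor) psh_mor"

definition abelian_hull :: "('o, 'm) cat \<Rightarrow> (('o, 'm) hull_ob, ('o, 'm) hull_mor) cat" where
  "abelian_hull C = Lcat (Rcat C)"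

text \<open>The embedding is the composite \<open>C \<rightarrow> Rcat C \<rightarrow> Lcat (Rcat C)\<close>; the second functor is the
  opposite of the Yoneda embedding of the opposite of \<open>Rcat C\<close>, which has the same object and
  morphism maps.\<close>

definition hull_embedding ::
  "('o, 'm) cat \<Rightarrow> ('o, 'm, ('o, 'm) hull_ob, ('o, 'm) hull_mor) ftor" where
  "hull_embedding C = yoneda (op_cat (Rcat C)) \<circ>\<^sub>F yoneda C"


section \<open>Serre quotients\<close>

text \<open>The quotient of \<open>B\<close> by the Serre subcategory on the objects \<open>S\<close> is the localisation of \<open>B\<close>
  at the morphisms with kernel and cokernel in \<open>S\<close>. These admit a calculus of fractions, so a
  morphism \<open>X \<rightarrow> Y\<close> of the quotient is a class of roofs \<open>(s, f)\<close>, where \<open>s : Z \<rightarrow> X\<close> is inverted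
  and \<open>f : Z \<rightarrow> Y\<close>. Two roofs are equivalent if they are dominated by a common one.\<close>

definition serre_weq :: "('o, 'm) cat \<Rightarrow> 'o set \<Rightarrow> 'm set" where
  "serre_weq B S = {f \<in> Mor B.
     (\<exists>k. is_kernel B f k \<and> Dom B k \<in> S) \<and> (\<exists>c. is_cokernel B f c \<and> Cod B c \<in> S)}"

definition roofs :: "('o, 'm) cat \<Rightarrow> 'o set \<Rightarrow> ('m \<times> 'm) set" where
  "roofs B S = {(s, f). s \<in> serre_weq B S \<and> f \<in> Mor B \<and> Dom B s = Dom B f}"

definition roof_rel :: "('o, 'm) cat \<Rightarrow> 'o set \<Rightarrow> (('m \<times> 'm) \<times> ('m \<times> 'm)) set" where
  "roof_rel B S = {((s, f), (t, g)). (s, f) \<in> roofs B S \<and> (t, g) \<in> roofs B S \<and>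
     (\<exists>Z. \<exists>u \<in> Hom B Z (Dom B s). \<exists>v \<in> Hom B Z (Dom B t).
        s \<cdot>\<^bsub>B\<^esub> u = t \<cdot>\<^bsub>B\<^esub> v \<and> s \<cdot>\<^bsub>B\<^esub> u \<in> serre_weq B S \<and> f \<cdot>\<^bsub>B\<^esub> u = g \<cdot>\<^bsub>B\<^esub> v)}"

definition roof_class :: "('o, 'm) cat \<Rightarrow> 'o set \<Rightarrow> 'm \<Rightarrow> 'm \<Rightarrow> ('m \<times> 'm) set" where
  "roof_class B S s f = roof_rel B S `` {(s, f)}"

text \<open>In the composite of the classes \<open>Q\<close> and \<open>P\<close> all choices of representatives
  \<open>(t, g)\<close>, \<open>(s, f)\<close> and of a square \<open>f \<cdot> h = t \<cdot> k\<close> with \<open>h\<close> inverted give the same class;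
  taking the union over all choices avoids choosing one. The same device is used for sums of
  roofs over a common denominator.\<close>

definition serre_quotient :: "('o, 'm) cat \<Rightarrow> 'o set \<Rightarrow> ('o, ('m \<times> 'm) set) cat" where
  "serre_quotient B S = \<lparr>Ob = Ob B,
     Mor = roofs B S // roof_rel B S,
     Dom = (\<lambda>P. Cod B (fst (SOME r. r \<in> P))),
     Cod = (\<lambda>P. Cod B (snd (SOME r. r \<in> P))),
     Idn = (\<lambda>X. roof_class B S (Idn B X) (Idn B X)),
     Comp = (\<lambda>Q P. \<Union> {roof_class B S (s \<cdot>\<^bsub>B\<^esub> h) (g \<cdot>\<^bsub>B\<^esub> k) | s f t g h k.
        (s, f) \<in> P \<and> (t, g) \<in> Q \<and> h \<in> serre_weq B S \<and> k \<in> Mor B \<and> Dom B h = Dom B k \<and>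
        Cod B h = Dom B f \<and> Cod B k = Dom B t \<and> f \<cdot>\<^bsub>B\<^esub> h = t \<cdot>\<^bsub>B\<^esub> k}),
     Add = (\<lambda>P Q. \<Union> {roof_class B S s (Add B f g) | s f g. (s, f) \<in> P \<and> (s, g) \<in> Q}),
     Zer = (\<lambda>X Y. roof_class B S (Idn B X) (Zer B X Y))\<rparr>"

definition quotient_functor :: "('o, 'm) cat \<Rightarrow> 'o set \<Rightarrow> ('o, 'm, 'o, ('m \<times> 'm) set) ftor" where
  "quotient_functor B S = \<lparr>FO = id, FM = (\<lambda>f. roof_class B S (Idn B (Dom B f)) f)\<rparr>"

definition ker_objects ::
  "('o1, 'm1) cat \<Rightarrow> ('o2, 'm2) cat \<Rightarrow> ('o1, 'm1, 'o2, 'm2) ftor \<Rightarrow> 'o1 set" where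
  "ker_objects C D F = {X \<in> Ob C. is_zero_object D (FO F X)}"


section \<open>Representations\<close>

record ('o, 'm, 'p, 'n) rep =
  rsrc :: "('o, 'm) cat"
  rtgt :: "('p, 'n) cat"
  rfun :: "('o, 'm, 'p, 'n) ftor"

definition abelian_rep :: "('o, 'm, 'p, 'n) rep \<Rightarrow> bool" where
  "abelian_rep R \<longleftrightarrow> additive_category (rsrc R) \<and> abelian_category (rtgt R) \<and>
     additive_functor (rsrc R) (rtgt R) (rfun R)"

definition hull_extension ::
  "('o, 'm, 'p, 'n) rep \<Rightarrow> (('o, 'm) hull_ob, ('o, 'm) hull_mor, 'p, 'n) ftor \<Rightarrow> bool" where
  "hull_extension R B \<longleftrightarrow> exact_functor (abelian_hull (rsrc R)) (rtgt R) B \<and>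
     ftor_eq (rsrc R) (B \<circ>\<^sub>F hull_embedding (rsrc R)) (rfun R)"

text \<open>The universal abelian factorization of \<open>R\<close>, formed with a given exact extension \<open>B\<close> of
  \<open>rfun R\<close> to the abelian hull. As \<open>B\<close> is unique only up to isomorphism, it is kept as
  a parameter.\<close>

type_synonym ('o, 'm) fact_mor = "(('o, 'm) hull_mor \<times> ('o, 'm) hull_mor) set"

definition hull_ker ::
  "('o, 'm, 'p, 'n) rep \<Rightarrow> (('o, 'm) hull_ob, ('o, 'm) hull_mor, 'p, 'n) ftor
    \<Rightarrow> ('o, 'm) hull_ob set" where
  "hull_ker R B = ker_objects (abelian_hull (rsrc R)) (rtgt R) B"

definition univ_fact ::
  "('o, 'm, 'p, 'n) rep \<Rightarrow> (('o, 'm) hull_ob, ('o, 'm) hull_mor, 'p, 'n) ftor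
    \<Rightarrow> (('o, 'm) hull_ob, ('o, 'm) fact_mor) cat" where
  "univ_fact R B = serre_quotient (abelian_hull (rsrc R)) (hull_ker R B)"

definition fact_quot ::
  "('o, 'm, 'p, 'n) rep \<Rightarrow> (('o, 'm) hull_ob, ('o, 'm) hull_mor, 'p, 'n) ftor
    \<Rightarrow> (('o, 'm) hull_ob, ('o, 'm) hull_mor, ('o, 'm) hull_ob, ('o, 'm) fact_mor) ftor" where
  "fact_quot R B = quotient_functor (abelian_hull (rsrc R)) (hull_ker R B)"

definition fact_pi ::
  "('o, 'm, 'p, 'n) rep \<Rightarrow> (('o, 'm) hull_ob, ('o, 'm) hull_mor, 'p, 'n) ftor
    \<Rightarrow> ('o, 'm, ('o, 'm) hull_ob, ('o, 'm) fact_mor) ftor" where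
  "fact_pi R B = fact_quot R B \<circ>\<^sub>F hull_embedding (rsrc R)"

text \<open>The functor induced by \<open>B\<close> on the Serre quotient is determined by its composite with the
  quotient functor.\<close>

definition fact_iota ::
  "('o, 'm, 'p, 'n) rep \<Rightarrow> (('o, 'm) hull_ob, ('o, 'm) hull_mor, 'p, 'n) ftor
    \<Rightarrow> (('o, 'm) hull_ob, ('o, 'm) fact_mor, 'p, 'n) ftor \<Rightarrow> bool" where
  "fact_iota R B \<iota> \<longleftrightarrow> exact_functor (univ_fact R B) (rtgt R) \<iota> \<and>
     ftor_eq (abelian_hull (rsrc R)) (\<iota> \<circ>\<^sub>F fact_quot R B) B"

definition pi_rep ::
  "('o, 'm, 'p, 'n) rep \<Rightarrow> (('o, 'm) hull_ob, ('o, 'm) hull_mor, 'p, 'n) ftor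
    \<Rightarrow> ('o, 'm, ('o, 'm) hull_ob, ('o, 'm) fact_mor) rep" where
  "pi_rep R B = \<lparr>rsrc = rsrc R, rtgt = univ_fact R B, rfun = fact_pi R B\<rparr>"

definition iota_rep ::
  "('o, 'm, 'p, 'n) rep \<Rightarrow> (('o, 'm) hull_ob, ('o, 'm) hull_mor, 'p, 'n) ftor
    \<Rightarrow> (('o, 'm) hull_ob, ('o, 'm) fact_mor, 'p, 'n) ftor
    \<Rightarrow> (('o, 'm) hull_ob, ('o, 'm) fact_mor, 'p, 'n) rep" where
  "iota_rep R B \<iota> = \<lparr>rsrc = univ_fact R B, rtgt = rtgt R, rfun = \<iota>\<rparr>"


section \<open>Morphisms of representations\<close>

record ('o1, 'm1, 'p1, 'n1, 'o2, 'm2, 'p2, 'n2) one_mor =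
  mF :: "('o1, 'm1, 'o2, 'm2) ftor"
  mG :: "('p1, 'n1, 'p2, 'n2) ftor"
  m\<kappa> :: "'o1 \<Rightarrow> 'n2"

definition one_morphism :: "('o1, 'm1, 'p1, 'n1) rep \<Rightarrow> ('o2, 'm2, 'p2, 'n2) rep \<Rightarrow>
    ('o1, 'm1, 'p1, 'n1, 'o2, 'm2, 'p2, 'n2) one_mor \<Rightarrow> bool" where
  "one_morphism R1 R2 \<alpha> \<longleftrightarrow>
     additive_functor (rsrc R1) (rsrc R2) (mF \<alpha>) \<and>
     additive_functor (rtgt R1) (rtgt R2) (mG \<alpha>) \<and>
     nat_iso (rsrc R1) (rtgt R2) (mG \<alpha> \<circ>\<^sub>F rfun R1) (rfun R2 \<circ>\<^sub>F mF \<alpha>) (m\<kappa> \<alpha>)"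

definition exact_one_morphism :: "('o1, 'm1, 'p1, 'n1) rep \<Rightarrow> ('o2, 'm2, 'p2, 'n2) rep \<Rightarrow>
    ('o1, 'm1, 'p1, 'n1, 'o2, 'm2, 'p2, 'n2) one_mor \<Rightarrow> bool" where
  "exact_one_morphism R1 R2 \<alpha> \<longleftrightarrow> one_morphism R1 R2 \<alpha> \<and>
     exact_functor (rtgt R1) (rtgt R2) (mG \<alpha>)"

text \<open>The compatibility of an adjunction \<open>(\<eta>, \<epsilon>)\<close> on sources and an adjunction \<open>(\<eta>', \<epsilon>')\<close> on
  targets. The transformation carried by \<open>\<alpha>2\<close> is the inverse of \<open>\<kappa>2 : R1 F2 \<rightarrow> G2 R2\<close>.\<close>

definition adjoint_pair :: "('o1, 'm1, 'p1, 'n1) rep \<Rightarrow> ('o2, 'm2, 'p2, 'n2) rep \<Rightarrow>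
    ('o1, 'm1, 'p1, 'n1, 'o2, 'm2, 'p2, 'n2) one_mor \<Rightarrow>
    ('o2, 'm2, 'p2, 'n2, 'o1, 'm1, 'p1, 'n1) one_mor \<Rightarrow>
    ('o1 \<Rightarrow> 'm1) \<Rightarrow> ('o2 \<Rightarrow> 'm2) \<Rightarrow> ('p1 \<Rightarrow> 'n1) \<Rightarrow> ('p2 \<Rightarrow> 'n2) \<Rightarrow> bool" where
  "adjoint_pair R1 R2 \<alpha>1 \<alpha>2 \<eta> \<epsilon> \<eta>' \<epsilon>' \<longleftrightarrow>
     (let E1 = rtgt R1; E2 = rtgt R2;
          F1 = mF \<alpha>1; F2 = mF \<alpha>2; G1 = mG \<alpha>1; G2 = mG \<alpha>2;
          \<kappa>1 = m\<kappa> \<alpha>1; \<kappa>2 = (\<lambda>Y. inv_mor E1 (m\<kappa> \<alpha>2 Y))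
      in (\<forall>X \<in> Ob (rsrc R1).
            \<kappa>2 (FO F1 X) \<cdot>\<^bsub>E1\<^esub> FM (rfun R1) (\<eta> X) = FM G2 (\<kappa>1 X) \<cdot>\<^bsub>E1\<^esub> \<eta>' (FO (rfun R1) X)) \<and>
         (\<forall>Y \<in> Ob (rsrc R2).
            FM (rfun R2) (\<epsilon> Y) \<cdot>\<^bsub>E2\<^esub> \<kappa>1 (FO F2 Y) = \<epsilon>' (FO (rfun R2) Y) \<cdot>\<^bsub>E2\<^esub> FM G1 (\<kappa>2 Y)))"

definition lift_functor :: "('o1, 'm1, 'p1, 'n1) rep
    \<Rightarrow> (('o1, 'm1) hull_ob, ('o1, 'm1) hull_mor, 'p1, 'n1) ftor
    \<Rightarrow> ('o2, 'm2, 'p2, 'n2) rep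
    \<Rightarrow> (('o2, 'm2) hull_ob, ('o2, 'm2) hull_mor, 'p2, 'n2) ftor
    \<Rightarrow> ('o1, 'm1, 'p1, 'n1, 'o2, 'm2, 'p2, 'n2) one_mor
    \<Rightarrow> (('o1, 'm1) hull_ob, ('o1, 'm1) fact_mor, ('o2, 'm2) hull_ob, ('o2, 'm2) fact_mor) ftor
    \<Rightarrow> bool" where
  "lift_functor R1 B1 R2 B2 \<alpha> \<psi> \<longleftrightarrow> exact_functor (univ_fact R1 B1) (univ_fact R2 B2) \<psi> \<and>
     ftor_eq (rsrc R1) (fact_pi R2 B2 \<circ>\<^sub>F mF \<alpha>) (\<psi> \<circ>\<^sub>F fact_pi R1 B1)"

definition lift_iso :: "('o1, 'm1, 'p1, 'n1) rep
    \<Rightarrow> (('o1, 'm1) hull_ob, ('o1, 'm1) hull_mor, 'p1, 'n1) ftor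
    \<Rightarrow> (('o1, 'm1) hull_ob, ('o1, 'm1) fact_mor, 'p1, 'n1) ftor
    \<Rightarrow> ('o2, 'm2, 'p2, 'n2) rep
    \<Rightarrow> (('o2, 'm2) hull_ob, ('o2, 'm2) fact_mor, 'p2, 'n2) ftor
    \<Rightarrow> ('o1, 'm1, 'p1, 'n1, 'o2, 'm2, 'p2, 'n2) one_mor
    \<Rightarrow> (('o1, 'm1) hull_ob, ('o1, 'm1) fact_mor, ('o2, 'm2) hull_ob, ('o2, 'm2) fact_mor) ftor
    \<Rightarrow> (('o1, 'm1) hull_ob \<Rightarrow> 'n2) \<Rightarrow> bool" where
  "lift_iso R1 B1 \<iota>1 R2 \<iota>2 \<alpha> \<psi> \<kappa>' \<longleftrightarrow>
     nat_iso (univ_fact R1 B1) (rtgt R2) (mG \<alpha> \<circ>\<^sub>F \<iota>1) (\<iota>2 \<circ>\<^sub>F \<psi>) \<kappa>' \<and>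
     (\<forall>X \<in> Ob (rsrc R1). \<kappa>' (FO (fact_pi R1 B1) X) = m\<kappa> \<alpha> X)"

definition hat_mor :: "('o2, 'm2, 'p2, 'n2) rep
    \<Rightarrow> (('o2, 'm2) hull_ob, ('o2, 'm2) hull_mor, 'p2, 'n2) ftor
    \<Rightarrow> ('o1, 'm1, 'p1, 'n1, 'o2, 'm2, 'p2, 'n2) one_mor
    \<Rightarrow> (('o1, 'm1) hull_ob, ('o1, 'm1) fact_mor, ('o2, 'm2) hull_ob, ('o2, 'm2) fact_mor) ftor
    \<Rightarrow> ('o1, 'm1, ('o1, 'm1) hull_ob, ('o1, 'm1) fact_mor,
        'o2, 'm2, ('o2, 'm2) hull_ob, ('o2, 'm2) fact_mor) one_mor" where
  "hat_mor R2 B2 \<alpha> \<psi> = \<lparr>mF = mF \<alpha>, mG = \<psi>,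
     m\<kappa> = (\<lambda>X. Idn (univ_fact R2 B2) (FO (fact_pi R2 B2) (FO (mF \<alpha>) X)))\<rparr>"

definition tilde_mor :: "('o1, 'm1, 'p1, 'n1, 'o2, 'm2, 'p2, 'n2) one_mor
    \<Rightarrow> (('o1, 'm1) hull_ob, ('o1, 'm1) fact_mor, ('o2, 'm2) hull_ob, ('o2, 'm2) fact_mor) ftor
    \<Rightarrow> (('o1, 'm1) hull_ob \<Rightarrow> 'n2)
    \<Rightarrow> (('o1, 'm1) hull_ob, ('o1, 'm1) fact_mor, 'p1, 'n1,
        ('o2, 'm2) hull_ob, ('o2, 'm2) fact_mor, 'p2, 'n2) one_mor" where
  "tilde_mor \<alpha> \<psi> \<kappa>' = \<lparr>mF = \<psi>, mG = mG \<alpha>, m\<kappa> = \<kappa>'\<rparr>"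

end

theory Submission
  imports Defs "HOL-Algebra.Coset"
begin

text \<open>By the compatibility of \<open>\<iota>\<close> with the adjunctions, \<open>\<iota>\<^sub>1\<close> maps \<open>\<eta>'\<close> at \<open>M\<close>, up to
  isomorphisms, to the unit of \<open>(\<Phi>\<^sub>1, \<Phi>\<^sub>2)\<close> at \<open>\<beta>\<^sub>1\<^sup>+ M\<close>. This unit is a transformation between
  exact functors, and it is invertible on the image of \<open>\<D>\<^sub>1\<close>, where it corresponds to
  \<open>\<beta>\<^sub>1 \<eta>\<close>. Every object of the abelian hull is obtained from objects of \<open>\<D>\<^sub>1\<close> by taking
  cokernels and then kernels, so the unit is invertible at all \<open>\<beta>\<^sub>1\<^sup>+ M\<close>. Finally \<open>\<iota>\<^sub>1\<close> reflects
  isomorphisms, by the calculus of fractions in the Serre quotient. The counit is dual.\<close>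

section \<open>Categories and preadditive categories\<close>

text \<open>The Serre subcategory is the kernel of the exact functor \<open>B\<close>, the extension
  \<beta>^+, and this makes the localisation computable in the target: a morphism of the hull is
  inverted exactly when \<open>B\<close> inverts it, and a roof \<open>(s, f)\<close> is determined
  up to equivalence by its ends and the fraction \<open>B f (B s)^-1\<close>. What this requires of
  the hull is kernels, cokernels and biproducts. The obstacle is the hull, a category of presheaves
  on a category of presheaves. Both layers are instances of the locale \<open>fp_completion\<close>,
  the second over the opposite of \<open>Rcat C\<close>. Finitely presented presheaves always have
  cokernels, and they have kernels once the base has them; the opposite of \<open>Rcat C\<close> has
  kernels because \<open>Rcat C\<close> has cokernels. The Yoneda embedding preserves kernels, so
  after passing to opposites the second embedding preserves cokernels: a cokernel taken in
  \<open>Rcat C\<close> is still one in the hull. Exactness here means preservation of kernels and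
  cokernels, so invertibility of a transformation spreads by comparing the kernels, or the
  cokernels, of two morphisms joined by an invertible square.\<close>

lemma HomI: "f \<in> Mor C \<Longrightarrow> Dom C f = X \<Longrightarrow> Cod C f = Y \<Longrightarrow> f \<in> Hom C X Y"
  by (simp add: Hom_def)

lemma HomD:
  assumes "f \<in> Hom C X Y"
  shows "f \<in> Mor C" "Dom C f = X" "Cod C f = Y"
  using assms by (auto simp: Hom_def)

lemma is_functorD:
  assumes "is_functor C D F"
  shows "X \<in> Ob C \<Longrightarrow> FO F X \<in> Ob D"
    and "f \<in> Mor C \<Longrightarrow> FM F f \<in> Mor D"
    and "f \<in> Mor C \<Longrightarrow> Dom D (FM F f) = FO F (Dom C f)"
    and "f \<in> Mor C \<Longrightarrow> Cod D (FM F f) = FO F (Cod C f)"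
    and "X \<in> Ob C \<Longrightarrow> FM F (Idn C X) = Idn D (FO F X)"
    and "\<lbrakk>f \<in> Mor C; g \<in> Mor C; Cod C f = Dom C g\<rbrakk>
      \<Longrightarrow> FM F (g \<cdot>\<^bsub>C\<^esub> f) = FM F g \<cdot>\<^bsub>D\<^esub> FM F f"
  using assms unfolding is_functor_def Hom_def by auto

lemma is_inverse_sym: "is_inverse C f g \<Longrightarrow> is_inverse C g f"
  by (auto simp: is_inverse_def Hom_def)

section \<open>Typing rules, inverses and isomorphisms\<close>

context category
begin

lemma Ob_simps [simp]:
  "f \<in> Mor C \<Longrightarrow> Dom C f \<in> Ob C" "f \<in> Mor C \<Longrightarrow> Cod C f \<in> Ob C"
  by (simp_all add: Dom_Ob Cod_Ob)

text \<open>Typing is restated through \<open>Mor\<close>, \<open>Dom\<close> and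
  \<open>Cod\<close>: the simplifier can discharge such conditions, whereas \<open>Hom\<close>
  premises leave the intermediate objects to be guessed.\<close>

lemma Comp_simps [simp]:
  assumes "f \<in> Mor C" "g \<in> Mor C" "Cod C f = Dom C g"
  shows "g \<cdot> f \<in> Mor C" "Dom C (g \<cdot> f) = Dom C f" "Cod C (g \<cdot> f) = Cod C g"
  using Comp_Hom[OF HomI HomI, OF assms(1) refl assms(3) assms(2) refl refl]
  by (auto simp: Hom_def)

lemma Idn_simps [simp]:
  assumes "X \<in> Ob C"
  shows "Idn C X \<in> Mor C" "Dom C (Idn C X) = X" "Cod C (Idn C X) = X"
  using Idn_Hom[OF assms] by (auto simp: Hom_def)

lemma unit_simps [simp]:
  "f \<in> Mor C \<Longrightarrow> Dom C f = X \<Longrightarrow> f \<cdot> Idn C X = f"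
  "f \<in> Mor C \<Longrightarrow> Cod C f = X \<Longrightarrow> Idn C X \<cdot> f = f"
  using Comp_Idn Idn_Comp by (auto simp: Hom_def)

lemma assoc_simp [simp]:
  assumes "f \<in> Mor C" "g \<in> Mor C" "h \<in> Mor C" "Cod C f = Dom C g" "Cod C g = Dom C h"
  shows "(h \<cdot> g) \<cdot> f = h \<cdot> (g \<cdot> f)"
  using Comp_assoc[OF HomI HomI HomI, OF assms(1) refl refl assms(2) _ refl assms(3) _ refl] assms
  by simp

text \<open>Rewriting in right-associated composites needs the equations between composites in this
  form.\<close>

lemma Comp_eq_extend:
  assumes "g \<cdot> f = h" "g \<in> Mor C" "f \<in> Mor C" "Cod C f = Dom C g" "x \<in> Mor C" "Cod C x = Dom C f"
  shows "g \<cdot> (f \<cdot> x) = h \<cdot> x"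
  using assms assoc_simp[of x f g] by simp

lemma is_inverse_unique:
  assumes "is_inverse C f g" "is_inverse C f h"
  shows "g = h"
proof -
  have m: "f \<in> Mor C" "g \<in> Mor C" "h \<in> Mor C" "Dom C g = Cod C f" "Cod C g = Dom C f"
    "Dom C h = Cod C f" "Cod C h = Dom C f"
    and e: "g \<cdot> f = Idn C (Dom C f)" "f \<cdot> h = Idn C (Cod C f)"
    using assms by (auto simp: is_inverse_def Hom_def)
  have "g = g \<cdot> (f \<cdot> h)" using m e by simp
  also have "\<dots> = (g \<cdot> f) \<cdot> h" using m by simp
  also have "\<dots> = h" using m e by simp
  finally show ?thesis .
qed

lemma inv_mor_eq: "is_inverse C f g \<Longrightarrow> inv_mor C f = g"
  unfolding inv_mor_def using is_inverse_unique by blast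

lemma is_inverse_inv_mor: "is_iso C f \<Longrightarrow> is_inverse C f (inv_mor C f)"
  using inv_mor_eq unfolding is_iso_def by blast

lemma inv_mor_simps:
  assumes "is_iso C f"
  shows "f \<in> Mor C" "inv_mor C f \<in> Mor C" "Dom C (inv_mor C f) = Cod C f"
    "Cod C (inv_mor C f) = Dom C f"
    "inv_mor C f \<cdot> f = Idn C (Dom C f)" "f \<cdot> inv_mor C f = Idn C (Cod C f)"
  using is_inverse_inv_mor[OF assms] by (auto simp: is_inverse_def Hom_def)

lemma is_iso_inv_mor: "is_iso C f \<Longrightarrow> is_iso C (inv_mor C f)"
  by (metis is_inverse_inv_mor is_inverse_sym is_iso_def)

lemma is_isoI:
  assumes "f \<in> Mor C" "g \<in> Mor C" "Dom C g = Cod C f" "Cod C g = Dom C f"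
    "g \<cdot> f = Idn C (Dom C f)" "f \<cdot> g = Idn C (Cod C f)"
  shows "is_iso C f"
  using assms unfolding is_iso_def is_inverse_def Hom_def by blast

lemma inv_mor_cancel:
  assumes "is_iso C f" "x \<in> Mor C"
  shows "Cod C x = Dom C f \<Longrightarrow> inv_mor C f \<cdot> (f \<cdot> x) = x"
    and "Cod C x = Cod C f \<Longrightarrow> f \<cdot> (inv_mor C f \<cdot> x) = x"
  using inv_mor_simps[OF assms(1)] assms(2)
    Comp_eq_extend[OF inv_mor_simps(5)[OF assms(1)], of x]
    Comp_eq_extend[OF inv_mor_simps(6)[OF assms(1)], of x] by simp_all

lemma is_iso_Idn: "X \<in> Ob C \<Longrightarrow> is_iso C (Idn C X)"
  by (rule is_isoI[of _ "Idn C X"]) auto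

lemma is_iso_Comp:
  assumes "is_iso C f" "is_iso C g" "Cod C f = Dom C g"
  shows "is_iso C (g \<cdot> f)"
  by (rule is_isoI[of _ "inv_mor C f \<cdot> inv_mor C g"])
    (use assms inv_mor_simps[OF assms(1)] inv_mor_simps[OF assms(2)] in
      \<open>auto simp: inv_mor_cancel\<close>)

lemma is_iso_cancel_left:
  assumes "is_iso C (g \<cdot> f)" "is_iso C g" "f \<in> Mor C" "Cod C f = Dom C g"
  shows "is_iso C f"
proof -
  have "is_iso C (inv_mor C g \<cdot> (g \<cdot> f))"
    using assms inv_mor_simps[OF assms(2)] by (intro is_iso_Comp[OF _ is_iso_inv_mor]) auto
  then show ?thesis using assms by (simp add: inv_mor_cancel)
qed

lemma is_iso_cancel_right:
  assumes "is_iso C (g \<cdot> f)" "is_iso C f" "g \<in> Mor C" "Cod C f = Dom C g"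
  shows "is_iso C g"
proof -
  have "is_iso C ((g \<cdot> f) \<cdot> inv_mor C f)"
    using assms inv_mor_simps[OF assms(2)] by (intro is_iso_Comp[OF is_iso_inv_mor]) auto
  then show ?thesis using assms inv_mor_simps[OF assms(2)] by simp
qed

end

lemma is_functor_is_iso:
  assumes "is_functor C D F" "is_iso C f" "category C"
  shows "is_iso D (FM F f)"
proof -
  interpret category C by fact
  note F = is_functorD[OF assms(1)] and i = inv_mor_simps[OF assms(2)]
  have "is_inverse D (FM F f) (FM F (inv_mor C f))"
    unfolding is_inverse_def using F(6)[of "inv_mor C f" f] F(6)[of f "inv_mor C f"] i
    by (auto intro!: HomI simp: F)
  then show ?thesis unfolding is_iso_def by blast
qed

section \<open>Opposite categories\<close>

lemma op_cat_simps [simp]: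
  "Ob (op_cat C) = Ob C" "Mor (op_cat C) = Mor C" "Dom (op_cat C) = Cod C"
  "Cod (op_cat C) = Dom C" "Idn (op_cat C) = Idn C" "g \<cdot>\<^bsub>op_cat C\<^esub> f = f \<cdot>\<^bsub>C\<^esub> g"
  "Add (op_cat C) = Add C" "Zer (op_cat C) X Y = Zer C Y X"
  "Hom (op_cat C) X Y = Hom C Y X"
  by (auto simp: op_cat_def Hom_def)

lemma hom_group_op [simp]: "hom_group (op_cat C) X Y = hom_group C Y X"
  by (simp add: hom_group_def)

text \<open>With \<open>op_cat_simps\<close>, a fact about kernels instantiated at
  \<open>op_cat C\<close> becomes by rewriting the dual fact about cokernels in
  \<open>C\<close>.\<close>

lemma is_kernel_op [simp]: "is_kernel (op_cat C) f k \<longleftrightarrow> is_cokernel C f k"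
  by (simp add: is_kernel_def is_cokernel_def)

lemma is_cokernel_op [simp]: "is_cokernel (op_cat C) f k \<longleftrightarrow> is_kernel C f k"
  by (simp add: is_kernel_def is_cokernel_def)

lemma is_inverse_op: "is_inverse (op_cat C) f g \<longleftrightarrow> is_inverse C f g"
  by (auto simp: is_inverse_def)

lemma is_iso_op [simp]: "is_iso (op_cat C) f \<longleftrightarrow> is_iso C f"
  by (simp add: is_iso_def is_inverse_op)

lemma is_biproduct_op: "is_biproduct (op_cat C) X Y P p q i j \<longleftrightarrow> is_biproduct C X Y P i j p q"
  by (auto simp: is_biproduct_def)

lemma is_zero_object_op [simp]: "is_zero_object (op_cat C) Z \<longleftrightarrow> is_zero_object C Z"
  by (auto simp: is_zero_object_def)

lemma (in category) category_op: "category (op_cat C)"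
  by unfold_locales (auto simp: Hom_def)

lemma (in preadditive_category) preadditive_op: "preadditive_category (op_cat C)"
  by (intro preadditive_category.intro preadditive_category_axioms.intro category_op)
    (auto simp: hom_comm_group Comp_Add_right Comp_Add_left)

lemma (in additive_category) additive_op: "additive_category (op_cat C)"
proof -
  interpret op: preadditive_category "op_cat C" by (rule preadditive_op)
  show ?thesis
  proof unfold_locales
    show "\<exists>Z. is_zero_object (op_cat C) Z" using zero_object by simp
    fix X Y assume "X \<in> Ob (op_cat C)" "Y \<in> Ob (op_cat C)"
    then show "\<exists>P\<in>Ob (op_cat C). \<exists>i j p q. is_biproduct (op_cat C) X Y P i j p q"
      using biproduct[of X Y] is_biproduct_op by (metis op_cat_simps(1))
  qed
qed

text \<open>The hom-group is read off from the ends of the argument, so negation depends on the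
  morphism alone and can be used by the simplifier without naming objects.\<close>

definition Neg :: "('o, 'm) cat \<Rightarrow> 'm \<Rightarrow> 'm" where
  "Neg C f = inv\<^bsub>hom_group C (Dom C f) (Cod C f)\<^esub> f"

section \<open>Arithmetic of morphisms, kernels and cokernels\<close>

context preadditive_category
begin

lemma Add_simps [simp]:
  assumes "f \<in> Mor C" "g \<in> Mor C" "Dom C f = Dom C g" "Cod C f = Cod C g"
  shows "Add C f g \<in> Mor C" "Dom C (Add C f g) = Dom C g" "Cod C (Add C f g) = Cod C g"
proof -
  interpret comm_group "hom_group C (Dom C g) (Cod C g)"
    using assms by (intro hom_comm_group) auto
  have "Add C f g \<in> Hom C (Dom C g) (Cod C g)"
    using m_closed[of f g] assms by (simp add: hom_group_def Hom_def)
  then show "Add C f g \<in> Mor C" "Dom C (Add C f g) = Dom C g" "Cod C (Add C f g) = Cod C g"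
    by (auto simp: Hom_def)
qed

lemma Zer_simps [simp]:
  assumes "X \<in> Ob C" "Y \<in> Ob C"
  shows "Zer C X Y \<in> Mor C" "Dom C (Zer C X Y) = X" "Cod C (Zer C X Y) = Y"
proof -
  interpret comm_group "hom_group C X Y" using assms by (intro hom_comm_group) auto
  have "Zer C X Y \<in> Hom C X Y" using one_closed by (simp add: hom_group_def)
  then show "Zer C X Y \<in> Mor C" "Dom C (Zer C X Y) = X" "Cod C (Zer C X Y) = Y"
    by (auto simp: Hom_def)
qed

lemma Neg_simps [simp]:
  assumes "f \<in> Mor C"
  shows "Neg C f \<in> Mor C" "Dom C (Neg C f) = Dom C f" "Cod C (Neg C f) = Cod C f"
    "Add C f (Neg C f) = Zer C (Dom C f) (Cod C f)"
    "Add C (Neg C f) f = Zer C (Dom C f) (Cod C f)"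
proof -
  interpret comm_group "hom_group C (Dom C f) (Cod C f)"
    using assms by (intro hom_comm_group) auto
  have f: "f \<in> carrier (hom_group C (Dom C f) (Cod C f))"
    using assms by (simp add: hom_group_def Hom_def)
  have "Neg C f \<in> Hom C (Dom C f) (Cod C f)"
    using inv_closed[OF f] by (simp add: hom_group_def Neg_def)
  then show "Neg C f \<in> Mor C" "Dom C (Neg C f) = Dom C f" "Cod C (Neg C f) = Cod C f"
    by (auto simp: Hom_def)
  show "Add C f (Neg C f) = Zer C (Dom C f) (Cod C f)"
    "Add C (Neg C f) f = Zer C (Dom C f) (Cod C f)"
    using r_inv[OF f] l_inv[OF f] by (simp_all add: hom_group_def Neg_def)
qed

lemma Add_assoc:
  assumes "f \<in> Hom C X Y" "g \<in> Hom C X Y" "h \<in> Hom C X Y"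
  shows "Add C (Add C f g) h = Add C f (Add C g h)"
proof -
  interpret comm_group "hom_group C X Y" using assms by (intro hom_comm_group) (auto simp: Hom_def)
  show ?thesis using m_assoc[of f g h] assms by (simp add: hom_group_def)
qed

lemma Add_commute:
  assumes "f \<in> Hom C X Y" "g \<in> Hom C X Y"
  shows "Add C f g = Add C g f"
proof -
  interpret comm_group "hom_group C X Y" using assms by (intro hom_comm_group) (auto simp: Hom_def)
  show ?thesis using m_comm[of f g] assms by (simp add: hom_group_def)
qed

lemma Add_Zer [simp]:
  assumes "f \<in> Mor C" "Dom C f = X" "Cod C f = Y"
  shows "Add C f (Zer C X Y) = f" "Add C (Zer C X Y) f = f"
proof -
  interpret comm_group "hom_group C X Y" using assms by (intro hom_comm_group) auto
  show "Add C f (Zer C X Y) = f" "Add C (Zer C X Y) f = f"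
    using r_one[of f] l_one[of f] assms by (auto simp add: hom_group_def Hom_def)
qed

lemma Add_cancel_right:
  assumes "f \<in> Hom C X Y" "g \<in> Hom C X Y" "h \<in> Hom C X Y" "Add C f h = Add C g h"
  shows "f = g"
proof -
  interpret comm_group "hom_group C X Y" using assms by (intro hom_comm_group) (auto simp: Hom_def)
  show ?thesis using right_cancel[of h f g] assms by (simp add: hom_group_def)
qed

lemma Add_Neg_eq_Zer_iff:
  assumes "f \<in> Hom C X Y" "g \<in> Hom C X Y"
  shows "Add C f (Neg C g) = Zer C X Y \<longleftrightarrow> f = g"
proof
  assume "Add C f (Neg C g) = Zer C X Y"
  then have "Add C f (Neg C g) = Add C g (Neg C g)" using HomD[OF assms(2)] by simp
  moreover have "Neg C g \<in> Hom C X Y" using HomD[OF assms(2)] by (simp add: Hom_def)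
  ultimately show "f = g" using Add_cancel_right assms by blast
qed (use HomD[OF assms(2)] in simp)

lemma Comp_Add [simp]:
  "\<lbrakk>f \<in> Mor C; g \<in> Mor C; h \<in> Mor C; Dom C f = Dom C g; Cod C f = Cod C g; Cod C g = Dom C h\<rbrakk>
    \<Longrightarrow> h \<cdot> Add C f g = Add C (h \<cdot> f) (h \<cdot> g)"
  "\<lbrakk>f \<in> Mor C; g \<in> Mor C; h \<in> Mor C; Dom C f = Dom C g; Cod C f = Cod C g; Cod C h = Dom C g\<rbrakk>
    \<Longrightarrow> Add C f g \<cdot> h = Add C (f \<cdot> h) (g \<cdot> h)"
  by (rule Comp_Add_right Comp_Add_left; force simp: Hom_def)+

text \<open>Cancel \<open>f\<close> from \<open>f + f = 0 + f\<close>. By bilinearity every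
  composite with a zero morphism satisfies the hypothesis, which is how \<open>Comp_Zer\<close> is
  obtained.\<close>

lemma Add_self_eq:
  assumes "f \<in> Mor C" "Add C f f = f"
  shows "f = Zer C (Dom C f) (Cod C f)"
  by (rule Add_cancel_right[of _ "Dom C f" "Cod C f" _ f]) (use assms in \<open>auto simp: Hom_def\<close>)

lemma Comp_Zer [simp]:
  assumes "f \<in> Mor C" "X \<in> Ob C"
  shows "Y = Dom C f \<Longrightarrow> f \<cdot> Zer C X Y = Zer C X (Cod C f)"
    and "Y = Cod C f \<Longrightarrow> Zer C Y X \<cdot> f = Zer C (Dom C f) X"
proof -
  have "Add C (f \<cdot> Zer C X (Dom C f)) (f \<cdot> Zer C X (Dom C f))
      = f \<cdot> Add C (Zer C X (Dom C f)) (Zer C X (Dom C f))"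
    using assms by (simp del: Add_Zer)
  then have "Add C (f \<cdot> Zer C X (Dom C f)) (f \<cdot> Zer C X (Dom C f)) = f \<cdot> Zer C X (Dom C f)"
    using assms by simp
  from Add_self_eq[OF _ this] show "Y = Dom C f \<Longrightarrow> f \<cdot> Zer C X Y = Zer C X (Cod C f)"
    using assms by simp
  have "Add C (Zer C (Cod C f) X \<cdot> f) (Zer C (Cod C f) X \<cdot> f)
      = Add C (Zer C (Cod C f) X) (Zer C (Cod C f) X) \<cdot> f"
    using assms by (simp del: Add_Zer)
  then have "Add C (Zer C (Cod C f) X \<cdot> f) (Zer C (Cod C f) X \<cdot> f) = Zer C (Cod C f) X \<cdot> f"
    using assms by simp
  from Add_self_eq[OF _ this] show "Y = Cod C f \<Longrightarrow> Zer C Y X \<cdot> f = Zer C (Dom C f) X"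
    using assms by simp
qed

lemma Neg_eqI:
  assumes "f \<in> Hom C X Y" "g \<in> Hom C X Y" "Add C f g = Zer C X Y"
  shows "f = Neg C g"
  by (rule Add_cancel_right[of _ X Y _ g]) (use assms in \<open>auto simp: Hom_def\<close>)

lemma Comp_Neg [simp]:
  assumes "f \<in> Mor C" "h \<in> Mor C"
  shows "Cod C f = Dom C h \<Longrightarrow> h \<cdot> Neg C f = Neg C (h \<cdot> f)"
    and "Cod C h = Dom C f \<Longrightarrow> Neg C f \<cdot> h = Neg C (f \<cdot> h)"
proof -
  assume a: "Cod C f = Dom C h"
  show "h \<cdot> Neg C f = Neg C (h \<cdot> f)"
    by (rule Neg_eqI[of _ "Dom C f" "Cod C h"])
      (use assms a Comp_Add(1)[of "Neg C f" f h] in \<open>auto simp: Hom_def simp del: Comp_Add\<close>)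
next
  assume a: "Cod C h = Dom C f"
  show "Neg C f \<cdot> h = Neg C (f \<cdot> h)"
    by (rule Neg_eqI[of _ "Dom C h" "Cod C f"])
      (use assms a Comp_Add(2)[of "Neg C f" f h] in \<open>auto simp: Hom_def simp del: Comp_Add\<close>)
qed

lemma is_kernelD:
  assumes "is_kernel C f k"
  shows "f \<in> Mor C" "k \<in> Mor C" "Cod C k = Dom C f" "f \<cdot> k = Zer C (Dom C k) (Cod C f)"
  using assms by (auto simp: is_kernel_def)

text \<open>Both \<open>u\<close> and \<open>v\<close> factor the same morphism
  \<open>k \<cdot> u\<close>, which \<open>f\<close> annihilates, so the uniqueness part of the
  universal property identifies them.\<close>

lemma is_kernel_mono:
  assumes "is_kernel C f k" "u \<in> Hom C T (Dom C k)" "v \<in> Hom C T (Dom C k)" "k \<cdot> u = k \<cdot> v"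
  shows "u = v"
proof -
  note k = is_kernelD[OF assms(1)] and u = HomD[OF assms(2)]
  have T: "T \<in> Ob C" using u by auto
  have "k \<cdot> u \<in> Hom C T (Dom C f)" using k u by (simp add: Hom_def)
  moreover have "f \<cdot> (k \<cdot> u) = Zer C T (Cod C f)"
    using k u T Comp_eq_extend[OF k(4)] by simp
  ultimately have "\<exists>!w. w \<in> Hom C T (Dom C k) \<and> k \<cdot> w = k \<cdot> u"
    using assms(1) unfolding is_kernel_def by blast
  then show ?thesis using assms by metis
qed

lemma is_kernel_factor:
  assumes "is_kernel C f k" "t \<in> Hom C T (Dom C f)" "f \<cdot> t = Zer C T (Cod C f)"
  obtains u where "u \<in> Mor C" "Dom C u = T" "Cod C u = Dom C k" "k \<cdot> u = t"
  using assms unfolding is_kernel_def Hom_def by blast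

text \<open>Two factorizations of one morphism differ by a morphism that \<open>k\<close> kills;
  hence uniqueness only has to be tested against zero.\<close>

lemma is_kernelI:
  assumes "f \<in> Mor C" "k \<in> Mor C" "Cod C k = Dom C f" "f \<cdot> k = Zer C (Dom C k) (Cod C f)"
    and fac: "\<And>t. \<lbrakk>t \<in> Mor C; Cod C t = Dom C f; f \<cdot> t = Zer C (Dom C t) (Cod C f)\<rbrakk>
      \<Longrightarrow> \<exists>u. u \<in> Hom C (Dom C t) (Dom C k) \<and> k \<cdot> u = t"
    and mono: "\<And>u. \<lbrakk>u \<in> Mor C; Cod C u = Dom C k; k \<cdot> u = Zer C (Dom C u) (Cod C k)\<rbrakk>
      \<Longrightarrow> u = Zer C (Dom C u) (Dom C k)"
  shows "is_kernel C f k"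
  unfolding is_kernel_def
proof (intro conjI allI ballI impI)
  fix T t assume t: "t \<in> Hom C T (Dom C f)" "f \<cdot> t = Zer C T (Cod C f)"
  then obtain u where u: "u \<in> Hom C T (Dom C k)" "k \<cdot> u = t"
    using fac[of t] by (auto simp: Hom_def)
  show "\<exists>!u. u \<in> Hom C T (Dom C k) \<and> k \<cdot> u = t"
  proof (rule ex1I[of _ u])
    fix v assume v: "v \<in> Hom C T (Dom C k) \<and> k \<cdot> v = t"
    then have m: "v \<in> Mor C" "u \<in> Mor C" "Dom C v = T" "Dom C u = T" "Cod C u = Dom C k"
      "Cod C v = Dom C k" "k \<cdot> u = t" "k \<cdot> v = t" using u by (auto simp: Hom_def)
    have "Add C v (Neg C u) = Zer C T (Dom C k)"
      using mono[of "Add C v (Neg C u)"] m assms t by (auto simp: Hom_def)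
    then show "v = u" using Add_Neg_eq_Zer_iff[of v T "Dom C k" u] u v by simp
  qed (use u in auto)
qed (use assms in auto)

lemma is_cokernelD:
  assumes "is_cokernel C f c"
  shows "f \<in> Mor C" "c \<in> Mor C" "Dom C c = Cod C f" "c \<cdot> f = Zer C (Dom C f) (Cod C c)"
  using assms by (auto simp: is_cokernel_def)

lemma is_cokernel_epi:
  assumes "is_cokernel C f c" "u \<in> Hom C (Cod C c) T" "v \<in> Hom C (Cod C c) T" "u \<cdot> c = v \<cdot> c"
  shows "u = v"
  using preadditive_category.is_kernel_mono[OF preadditive_op, of f c] assms by simp

lemma is_cokernel_factor:
  assumes "is_cokernel C f c" "t \<in> Hom C (Cod C f) T" "t \<cdot> f = Zer C (Dom C f) T"
  obtains u where "u \<in> Mor C" "Dom C u = Cod C c" "Cod C u = T" "u \<cdot> c = t"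
  using assms unfolding is_cokernel_def Hom_def by blast

lemma is_cokernelI:
  assumes "f \<in> Mor C" "c \<in> Mor C" "Dom C c = Cod C f" "c \<cdot> f = Zer C (Dom C f) (Cod C c)"
    and "\<And>t. \<lbrakk>t \<in> Mor C; Dom C t = Cod C f; t \<cdot> f = Zer C (Dom C f) (Cod C t)\<rbrakk>
      \<Longrightarrow> \<exists>u. u \<in> Hom C (Cod C c) (Cod C t) \<and> u \<cdot> c = t"
    and "\<And>u. \<lbrakk>u \<in> Mor C; Dom C u = Cod C c; u \<cdot> c = Zer C (Dom C c) (Cod C u)\<rbrakk>
      \<Longrightarrow> u = Zer C (Cod C c) (Cod C u)"
  shows "is_cokernel C f c"
  using preadditive_category.is_kernelI[OF preadditive_op, of f c] assms by simp

text \<open>Functoriality of kernels: the inverse square induces a map \<open>d\<close> back, and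
  both composites of \<open>c\<close> and \<open>d\<close> are identities because \<open>k\<close>
  and \<open>k'\<close> are mono. This plays the part of the five lemma.\<close>

lemma is_kernel_iso:
  assumes "is_kernel C f k" "is_kernel C f' k'" "is_iso C a" "is_iso C b"
    "Dom C a = Dom C f" "Cod C a = Dom C f'" "Dom C b = Cod C f" "Cod C b = Cod C f'"
    "b \<cdot> f = f' \<cdot> a" "c \<in> Hom C (Dom C k) (Dom C k')" "k' \<cdot> c = a \<cdot> k"
  shows "is_iso C c"
proof -
  note k = is_kernelD[OF assms(1)] and k' = is_kernelD[OF assms(2)]
    and a = inv_mor_simps[OF assms(3)] and b = inv_mor_simps[OF assms(4)] and c = HomD[OF assms(10)]
  \<comment> \<open>Inverting both vertical sides of the given square yields the square in the other
    direction.\<close>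
  have 1: "f \<cdot> inv_mor C a = inv_mor C b \<cdot> f'"
  proof -
    have "inv_mor C b \<cdot> (b \<cdot> (f \<cdot> inv_mor C a)) = inv_mor C b \<cdot> ((f' \<cdot> a) \<cdot> inv_mor C a)"
      using assms(9) a b assms k k' by (metis assoc_simp)
    then show ?thesis
      using a b assms k k' by (simp add: inv_mor_cancel)
  qed
  have "f \<cdot> (inv_mor C a \<cdot> k') = Zer C (Dom C k') (Cod C f)"
    using Comp_eq_extend[OF 1, of k'] a b k k' assms by simp
  then obtain d where d: "d \<in> Mor C" "Dom C d = Dom C k'" "Cod C d = Dom C k"
    "k \<cdot> d = inv_mor C a \<cdot> k'"
    using is_kernel_factor[OF assms(1), of "inv_mor C a \<cdot> k'"] a k' assms by (auto simp: Hom_def)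
  show ?thesis
  proof (rule is_isoI[of _ d])
    have "k \<cdot> (d \<cdot> c) = k \<cdot> Idn C (Dom C k)"
      using Comp_eq_extend[OF d(4), of c] d c a k k' assms by (simp add: inv_mor_cancel)
    then show "d \<cdot> c = Idn C (Dom C c)"
      using is_kernel_mono[OF assms(1)] d c k by (auto simp: Hom_def)
    have "k' \<cdot> (c \<cdot> d) = k' \<cdot> Idn C (Dom C k')"
      using Comp_eq_extend[OF assms(11), of d] d c a k k' assms by (simp add: inv_mor_cancel)
    then show "c \<cdot> d = Idn C (Cod C c)"
      using is_kernel_mono[OF assms(2)] d c k' by (auto simp: Hom_def)
  qed (use d c in auto)
qed

text \<open>Dual to \<open>is_kernel_iso\<close>, with the letters exchanged: \<open>a\<close>
  compares the codomains, where the cokernel maps start, and \<open>b\<close> compares the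
  domains.\<close>

lemma is_cokernel_iso:
  assumes "is_cokernel C f k" "is_cokernel C f' k'" "is_iso C a" "is_iso C b"
    "Dom C a = Cod C f" "Cod C a = Cod C f'" "Dom C b = Dom C f" "Cod C b = Dom C f'"
    "a \<cdot> f = f' \<cdot> b" "c \<in> Hom C (Cod C k) (Cod C k')" "c \<cdot> k = k' \<cdot> a"
  shows "is_iso C c"
proof -
  note k = is_cokernelD[OF assms(1)] and k' = is_cokernelD[OF assms(2)]
    and a = inv_mor_simps[OF assms(3)] and b = inv_mor_simps[OF assms(4)] and c = HomD[OF assms(10)]
  obtain d where d: "d \<in> Mor C" "Dom C d = Cod C k'" "Cod C d = Cod C k"
    "d \<cdot> k' = k \<cdot> inv_mor C a"
  proof (rule is_cokernel_factor[OF assms(2), of "k \<cdot> inv_mor C a"])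
    have 1: "inv_mor C a \<cdot> f' = f \<cdot> inv_mor C b"
    proof -
      have "inv_mor C a \<cdot> ((f' \<cdot> b) \<cdot> inv_mor C b) = inv_mor C a \<cdot> ((a \<cdot> f) \<cdot> inv_mor C b)"
        using assms(9) by simp
      then show ?thesis using a b assms(3-8) k k' by (simp add: inv_mor_cancel)
    qed
    show "(k \<cdot> inv_mor C a) \<cdot> f' = Zer C (Dom C f') (Cod C k)"
      using 1 Comp_eq_extend[OF k(4), of "inv_mor C b"] a b k k' assms by simp
  qed (use a k k' assms in \<open>auto simp: Hom_def\<close>)
  show ?thesis
  proof (rule is_isoI[of _ d])
    have "(d \<cdot> c) \<cdot> k = Idn C (Cod C k) \<cdot> k"
      using Comp_eq_extend[OF d(4), of a] d c a k k' assms by simp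
    then show "d \<cdot> c = Idn C (Dom C c)"
      using is_cokernel_epi[OF assms(1)] d c k by (auto simp: Hom_def)
    have "(c \<cdot> d) \<cdot> k' = Idn C (Cod C k') \<cdot> k'"
      using Comp_eq_extend[OF assms(11), of "inv_mor C a"] d c a k k' assms by simp
    then show "c \<cdot> d = Idn C (Cod C c)"
      using is_cokernel_epi[OF assms(2)] d c k' by (auto simp: Hom_def)
  qed (use d c in auto)
qed

end

section \<open>Exact functors and isomorphisms\<close>

context preadditive_category
begin

lemma Neg_Zer [simp]:
  assumes "X \<in> Ob C" "Y \<in> Ob C"
  shows "Neg C (Zer C X Y) = Zer C X Y"
  by (rule Neg_eqI[symmetric, of _ X Y]) (use assms in \<open>auto simp: Hom_def\<close>)

lemma is_zero_object_morphism:
  assumes "is_zero_object C Z" "f \<in> Mor C"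
  shows "Cod C f = Z \<Longrightarrow> f = Zer C (Dom C f) Z" and "Dom C f = Z \<Longrightarrow> f = Zer C Z (Cod C f)"
proof -
  assume "Cod C f = Z"
  then have "f \<in> Hom C (Dom C f) Z" "Zer C (Dom C f) Z \<in> Hom C (Dom C f) Z" "Dom C f \<in> Ob C"
    using assms by (auto simp: Hom_def is_zero_object_def)
  then show "f = Zer C (Dom C f) Z" using assms(1) unfolding is_zero_object_def by blast
next
  assume "Dom C f = Z"
  then have "f \<in> Hom C Z (Cod C f)" "Zer C Z (Cod C f) \<in> Hom C Z (Cod C f)" "Cod C f \<in> Ob C"
    using assms by (auto simp: Hom_def is_zero_object_def)
  then show "f = Zer C Z (Cod C f)" using assms(1) unfolding is_zero_object_def by blast
qed

text \<open>Composing with the identity, which is zero, shows that every morphism into or out of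
  \<open>X\<close> is zero.\<close>

lemma is_zero_objectI:
  assumes X: "X \<in> Ob C" and i: "Idn C X = Zer C X X"
  shows "is_zero_object C X"
proof -
  have z: "u = Zer C X T" if "u \<in> Hom C X T" for u T
  proof -
    note u = HomD[OF that]
    have "u = u \<cdot> Idn C X" using u by simp
    also have "\<dots> = Zer C X T" using u X unfolding i by simp
    finally show ?thesis .
  qed
  have z': "u = Zer C T X" if "u \<in> Hom C T X" for u T
  proof -
    note u = HomD[OF that]
    have "u = Idn C X \<cdot> u" using u by simp
    also have "\<dots> = Zer C T X" using u X unfolding i by simp
    finally show ?thesis .
  qed
  show ?thesis unfolding is_zero_object_def
  proof (intro conjI ballI ex1I)
    fix T assume "T \<in> Ob C"
    then show "Zer C T X \<in> Hom C T X" "Zer C X T \<in> Hom C X T"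
      using X by (auto simp: Hom_def)
  qed (use z z' X in auto)
qed

text \<open>The difference of two morphisms equalised by \<open>f\<close> factors through the
  kernel, a zero object.\<close>

lemma is_mono_if_kernel_zero:
  assumes "is_kernel C f k" "is_zero_object C (Dom C k)"
  shows "is_mono C f"
  unfolding is_mono_def
proof (intro conjI allI ballI impI)
  note k = is_kernelD[OF assms(1)]
  fix T g h assume a: "g \<in> Hom C T (Dom C f)" "h \<in> Hom C T (Dom C f)" "f \<cdot> g = f \<cdot> h"
  note gh = HomD[OF a(1)] HomD[OF a(2)]
  have T: "T \<in> Ob C" using gh by auto
  have "f \<cdot> Add C g (Neg C h) = Zer C T (Cod C f)"
    using gh k a(3) by simp
  then obtain u where u: "u \<in> Mor C" "Dom C u = T" "Cod C u = Dom C k" "k \<cdot> u = Add C g (Neg C h)"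
    using is_kernel_factor[OF assms(1), of "Add C g (Neg C h)"] gh by (auto simp: Hom_def)
  have "u = Zer C T (Dom C k)" using is_zero_object_morphism(1)[OF assms(2), of u] u by simp
  then have "Add C g (Neg C h) = Zer C T (Dom C f)" using u k T by simp
  then show "g = h" using Add_Neg_eq_Zer_iff[of g T "Dom C f" h] a by simp
qed (use is_kernelD[OF assms(1)] in simp)

lemma is_epi_if_cokernel_zero:
  assumes "is_cokernel C f c" "is_zero_object C (Cod C c)"
  shows "is_epi C f"
  using preadditive_category.is_mono_if_kernel_zero[OF preadditive_op, of f c] assms
  by (simp add: is_mono_def is_epi_def)

text \<open>Cancelling \<open>f\<close> from \<open>f \<cdot> k = 0\<close> gives
  \<open>k = 0\<close>; since \<open>k\<close> is also mono, all morphisms into its domain coincide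
  with zero, the identity included.\<close>

lemma is_zero_object_kernel_iso:
  assumes "is_iso C f" "is_kernel C f k"
  shows "is_zero_object C (Dom C k)"
proof -
  note k = is_kernelD[OF assms(2)] and f = inv_mor_simps[OF assms(1)]
  have "k = inv_mor C f \<cdot> (f \<cdot> k)" using inv_mor_cancel(1)[OF assms(1), of k] k by simp
  also have "\<dots> = Zer C (Dom C k) (Dom C f)" unfolding k(4) using f k by simp
  finally have k0: "k = Zer C (Dom C k) (Dom C f)" .
  have z: "u = Zer C T (Dom C k)" if "u \<in> Hom C T (Dom C k)" for u T
  proof (rule is_kernel_mono[OF assms(2) that])
    note HomD[OF that]
    then have T: "T \<in> Ob C" by auto
    show "Zer C T (Dom C k) \<in> Hom C T (Dom C k)" using T k by (auto simp: Hom_def)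
    have "k \<cdot> u = Zer C (Dom C k) (Dom C f) \<cdot> u" using k0 by simp
    also have "\<dots> = k \<cdot> Zer C T (Dom C k)" using T k f HomD[OF that] by simp
    finally show "k \<cdot> u = k \<cdot> Zer C T (Dom C k)" .
  qed
  have i: "Idn C (Dom C k) = Zer C (Dom C k) (Dom C k)" using z[OF Idn_Hom] k by simp
  show ?thesis using is_zero_objectI[OF _ i] k by simp
qed

lemma is_zero_object_cokernel_iso:
  assumes "is_iso C f" "is_cokernel C f c"
  shows "is_zero_object C (Cod C c)"
  using preadditive_category.is_zero_object_kernel_iso[OF preadditive_op, of f c] assms by simp

end

text \<open>A mono \<open>f\<close> is the kernel of some \<open>g\<close>, and \<open>f\<close>
  being epi forces \<open>g = 0\<close>. The identity then factors through \<open>f\<close>, and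
  this right inverse is two-sided because \<open>f\<close> is mono.\<close>

lemma (in abelian_category) mono_epi_is_iso:
  assumes "is_mono C f" "is_epi C f"
  shows "is_iso C f"
proof -
  have f: "f \<in> Mor C" using assms by (simp add: is_mono_def)
  obtain g where g: "is_kernel C g f" using mono_normal[OF assms(1)] by blast
  note k = is_kernelD[OF g]
  have "g \<cdot> f = Zer C (Cod C f) (Cod C g) \<cdot> f" using k f by simp
  moreover have "g \<in> Hom C (Cod C f) (Cod C g)"
    "Zer C (Cod C f) (Cod C g) \<in> Hom C (Cod C f) (Cod C g)" using k by (auto simp: Hom_def)
  ultimately have g0: "g = Zer C (Cod C f) (Cod C g)" using assms(2) unfolding is_epi_def by blast
  have "g \<cdot> Idn C (Cod C f) = Zer C (Cod C f) (Cod C g)" using k g0 by simp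
  then obtain u where u: "u \<in> Mor C" "Dom C u = Cod C f" "Cod C u = Dom C f"
    "f \<cdot> u = Idn C (Cod C f)"
    using is_kernel_factor[OF g, of "Idn C (Cod C f)"] k f by (auto simp: Hom_def)
  have "f \<cdot> (u \<cdot> f) = f \<cdot> Idn C (Dom C f)"
    using Comp_eq_extend[OF u(4), of f] u f by simp
  then have "u \<cdot> f = Idn C (Dom C f)"
    using is_kernel_mono[OF g] u f by (auto simp: Hom_def)
  then show ?thesis using u f by (intro is_isoI[of _ u]) auto
qed

text \<open>The structure of the hull on which the calculus of fractions rests; normality of monos
  and epis is drawn from the abelian target of the exact functor instead.\<close>

locale preabelian_category = additive_category +
  assumes has_kernel: "f \<in> Mor C \<Longrightarrow> \<exists>k. is_kernel C f k"
    and has_cokernel: "f \<in> Mor C \<Longrightarrow> \<exists>c. is_cokernel C f c"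

lemma additive_functorD:
  assumes "additive_functor C D F"
  shows "is_functor C D F"
    and "\<lbrakk>f \<in> Mor C; g \<in> Mor C; Dom C f = Dom C g; Cod C f = Cod C g\<rbrakk>
      \<Longrightarrow> FM F (Add C f g) = Add D (FM F f) (FM F g)"
  using assms unfolding additive_functor_def by auto

locale additive_functor_between =
  C: preadditive_category C + D: preadditive_category D
  for C :: "('o1, 'm1) cat" (structure) and D :: "('o2, 'm2) cat"
    and F :: "('o1, 'm1, 'o2, 'm2) ftor" +
  assumes additive: "additive_functor C D F"
begin

lemmas is_functor = additive_functorD(1)[OF additive]

lemmas functor_simps [simp] = is_functorD[OF is_functor]

lemmas functor_Add [simp] = additive_functorD(2)[OF additive]

text \<open>The simplifier expands the image of every composite, so equations between composites
  have to be available in this expanded form.\<close>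

lemma functor_Comp_eq: "\<lbrakk>g \<cdot> f = h; f \<in> Mor C; g \<in> Mor C; Cod C f = Dom C g\<rbrakk>
  \<Longrightarrow> FM F g \<cdot>\<^bsub>D\<^esub> FM F f = FM F h"
  using functor_simps(6) by metis

lemma functor_Zer [simp]:
  assumes "X \<in> Ob C" "Y \<in> Ob C"
  shows "FM F (Zer C X Y) = Zer D (FO F X) (FO F Y)"
proof -
  have "Add D (FM F (Zer C X Y)) (FM F (Zer C X Y)) = FM F (Add C (Zer C X Y) (Zer C X Y))"
    using assms by (simp del: C.Add_Zer)
  then show ?thesis using D.Add_self_eq[of "FM F (Zer C X Y)"] assms by simp
qed

lemma functor_Neg [simp]:
  assumes "f \<in> Mor C"
  shows "FM F (Neg C f) = Neg D (FM F f)"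
  by (rule D.Neg_eqI[of _ "FO F (Dom C f)" "FO F (Cod C f)"])
    (use assms functor_Add[of "Neg C f" f] in \<open>auto simp: Hom_def simp del: functor_Add\<close>)

end

section \<open>The Serre quotient by the kernel of an exact functor\<close>

locale exact_to_abelian =
  H: preabelian_category H + A: abelian_category A
  for H :: "('o, 'm) cat" (structure) and A :: "('p, 'n) cat"
    and B :: "('o, 'm, 'p, 'n) ftor" +
  assumes exact: "exact_functor H A B"
begin

sublocale additive_functor_between H A B
  by unfold_locales (use exact in \<open>auto simp: exact_functor_def\<close>)

lemma functor_kernel: "is_kernel H f k \<Longrightarrow> is_kernel A (FM B f) (FM B k)"
  and functor_cokernel: "is_cokernel H f c \<Longrightarrow> is_cokernel A (FM B f) (FM B c)"
  using exact by (auto simp: exact_functor_def)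

abbreviation "S \<equiv> ker_objects H A B"

text \<open>\<open>B\<close> carries the kernel and cokernel of \<open>f\<close> to those of
  \<open>B f\<close>. They vanish there exactly when \<open>B f\<close> is mono and epi, that is,
  invertible in the abelian category \<open>A\<close>. From here on, membership in the class of
  inverted morphisms is decided in \<open>A\<close>.\<close>

lemma serre_weq_iff: "f \<in> serre_weq H S \<longleftrightarrow> f \<in> Mor H \<and> is_iso A (FM B f)"
proof (cases "f \<in> Mor H")
  case True
  obtain k c where k: "is_kernel H f k" and c: "is_cokernel H f c"
    using H.has_kernel H.has_cokernel True by blast
  note k' = H.is_kernelD[OF k] and c' = H.is_cokernelD[OF c]
  show ?thesis
  proof
    assume "f \<in> serre_weq H S"
    then obtain k c where k: "is_kernel H f k" "is_zero_object A (FO B (Dom H k))"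
      and c: "is_cokernel H f c" "is_zero_object A (FO B (Cod H c))"
      by (auto simp: serre_weq_def ker_objects_def)
    have "is_mono A (FM B f)" "is_epi A (FM B f)"
      using A.is_mono_if_kernel_zero[OF functor_kernel[OF k(1)]] k H.is_kernelD[OF k(1)]
        A.is_epi_if_cokernel_zero[OF functor_cokernel[OF c(1)]] c H.is_cokernelD[OF c(1)] by simp_all
    then show "f \<in> Mor H \<and> is_iso A (FM B f)" using A.mono_epi_is_iso True by blast
  next
    assume "f \<in> Mor H \<and> is_iso A (FM B f)"
    then have "is_zero_object A (FO B (Dom H k))" "is_zero_object A (FO B (Cod H c))"
      using A.is_zero_object_kernel_iso[OF _ functor_kernel[OF k]]
        A.is_zero_object_cokernel_iso[OF _ functor_cokernel[OF c]] k' c' by simp_all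
    then show "f \<in> serre_weq H S"
      using k c k' c' True by (auto simp: serre_weq_def ker_objects_def)
  qed
qed (simp add: serre_weq_def)

text \<open>The kernel of \<open>s p - t q\<close> on a biproduct with projections \<open>p\<close>, \<open>q\<close> is a pullback, and it
  is preserved by \<open>B\<close>.\<close>

lemma ore:
  assumes st: "s \<in> Mor H" "t \<in> Mor H" "Cod H s = Cod H t" and t: "is_iso A (FM B t)"
  obtains u v where "u \<in> Mor H" "v \<in> Mor H" "Dom H u = Dom H v" "Cod H u = Dom H s"
    "Cod H v = Dom H t" "s \<cdot> u = t \<cdot> v" "is_iso A (FM B u)"
proof -
  obtain P i j p q where P: "is_biproduct H (Dom H s) (Dom H t) P i j p q"
    using H.biproduct[of "Dom H s" "Dom H t"] st by auto
  have m: "i \<in> Mor H" "j \<in> Mor H" "p \<in> Mor H" "q \<in> Mor H" "Dom H i = Dom H s" "Cod H i = P"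
    "Dom H j = Dom H t" "Cod H j = P" "Dom H p = P" "Cod H p = Dom H s" "Dom H q = P"
    "Cod H q = Dom H t" and
    e: "p \<cdot> i = Idn H (Dom H s)" "q \<cdot> j = Idn H (Dom H t)"
    "q \<cdot> i = Zer H (Dom H s) (Dom H t)" "p \<cdot> j = Zer H (Dom H t) (Dom H s)"
    "Add H (i \<cdot> p) (j \<cdot> q) = Idn H P"
    using P by (auto simp: is_biproduct_def Hom_def)
  have PO: "P \<in> Ob H" using m by auto
  define f where "f = Add H (s \<cdot> p) (Neg H (t \<cdot> q))"
  have f: "f \<in> Mor H" "Dom H f = P" "Cod H f = Cod H t" using m st by (simp_all add: f_def)
  obtain k where k: "is_kernel H f k" using H.has_kernel f by blast
  note k' = H.is_kernelD[OF k]
  have "Add H (s \<cdot> (p \<cdot> k)) (Neg H (t \<cdot> (q \<cdot> k))) = Zer H (Dom H k) (Cod H t)"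
    using k'(4) k' m st f unfolding f_def by simp
  then have sq: "s \<cdot> (p \<cdot> k) = t \<cdot> (q \<cdot> k)"
    using H.Add_Neg_eq_Zer_iff[of "s \<cdot> (p \<cdot> k)" "Dom H k" "Cod H t" "t \<cdot> (q \<cdot> k)"] k' m st f
    by (simp add: Hom_def)
  note ti = A.inv_mor_simps[OF t]
  \<comment> \<open>\<open>r\<close> completes the square in \<open>A\<close>, and \<open>n\<close>
    is its graph inside the image of the biproduct. \<open>B f\<close> kills \<open>n\<close>, so
    \<open>n\<close> lifts through \<open>B k\<close> to a map \<open>w\<close>, the inverse sought
    for \<open>B (p \<cdot> k)\<close>.\<close>
  define r where "r = inv_mor A (FM B t) \<cdot>\<^bsub>A\<^esub> FM B s"
  have r: "r \<in> Mor A" "Dom A r = FO B (Dom H s)" "Cod A r = FO B (Dom H t)"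
    "FM B t \<cdot>\<^bsub>A\<^esub> r = FM B s"
    using ti st t by (auto simp: r_def A.inv_mor_cancel)
  define n where "n = Add A (FM B i) (FM B j \<cdot>\<^bsub>A\<^esub> r)"
  have n: "n \<in> Mor A" "Dom A n = FO B (Dom H s)" "Cod A n = FO B P"
    using m r by (simp_all add: n_def)
  have fi: "f \<cdot> i = s" "f \<cdot> j = Neg H t"
    using m st e by (simp_all add: f_def)
  have "FM B f \<cdot>\<^bsub>A\<^esub> n = Zer A (FO B (Dom H s)) (Cod A (FM B f))"
    unfolding n_def using m st f r A.Comp_eq_extend[OF functor_Comp_eq[OF fi(2)], of r]
    by (simp add: functor_Comp_eq[OF fi(1)])
  then obtain w where w: "w \<in> Mor A" "Dom A w = FO B (Dom H s)" "Cod A w = FO B (Dom H k)"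
    "FM B k \<cdot>\<^bsub>A\<^esub> w = n"
    using A.is_kernel_factor[OF functor_kernel[OF k], of n "FO B (Dom H s)"] n f k'
    by (auto simp: Hom_def)
  let ?u = "FM B p \<cdot>\<^bsub>A\<^esub> FM B k"
  have "?u \<cdot>\<^bsub>A\<^esub> w = FM B p \<cdot>\<^bsub>A\<^esub> n" using w m k' f by simp
  also have "\<dots> = Idn A (FO B (Dom H s))"
    unfolding n_def using m st f r A.Comp_eq_extend[OF functor_Comp_eq[OF e(4)], of r]
    by (simp add: functor_Comp_eq[OF e(1)])
  finally have uw: "?u \<cdot>\<^bsub>A\<^esub> w = Idn A (FO B (Dom H s))" .
  have "FM B t \<cdot>\<^bsub>A\<^esub> (r \<cdot>\<^bsub>A\<^esub> ?u) = FM B (s \<cdot> (p \<cdot> k))"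
    using A.Comp_eq_extend[OF r(4), of ?u] r m k' f st by simp
  also have "\<dots> = FM B t \<cdot>\<^bsub>A\<^esub> (FM B q \<cdot>\<^bsub>A\<^esub> FM B k)" unfolding sq using m k' f st by simp
  finally have "inv_mor A (FM B t) \<cdot>\<^bsub>A\<^esub> (FM B t \<cdot>\<^bsub>A\<^esub> (r \<cdot>\<^bsub>A\<^esub> ?u))
      = inv_mor A (FM B t) \<cdot>\<^bsub>A\<^esub> (FM B t \<cdot>\<^bsub>A\<^esub> (FM B q \<cdot>\<^bsub>A\<^esub> FM B k))" by simp
  then have ru: "r \<cdot>\<^bsub>A\<^esub> ?u = FM B q \<cdot>\<^bsub>A\<^esub> FM B k"
    using t r m k' f st by (simp add: A.inv_mor_cancel)
  \<comment> \<open>The second composite is compared after \<open>B k\<close>, which is mono;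
    \<open>ru\<close> and the biproduct identity \<open>i p + j q = 1\<close> reassemble
    \<open>B k\<close>.\<close>
  have "FM B k \<cdot>\<^bsub>A\<^esub> (w \<cdot>\<^bsub>A\<^esub> ?u) = n \<cdot>\<^bsub>A\<^esub> ?u"
    using A.Comp_eq_extend[OF w(4), of ?u] w m k' f by simp
  also have "\<dots> = Add A (FM B i \<cdot>\<^bsub>A\<^esub> ?u) (FM B j \<cdot>\<^bsub>A\<^esub> (r \<cdot>\<^bsub>A\<^esub> ?u))"
    unfolding n_def using m k' f r by simp
  also have "\<dots> = FM B (Add H (i \<cdot> p) (j \<cdot> q)) \<cdot>\<^bsub>A\<^esub> FM B k"
    unfolding ru using m k' f by simp
  also have "\<dots> = FM B k \<cdot>\<^bsub>A\<^esub> Idn A (FO B (Dom H k))" unfolding e using k' f PO by simp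
  finally have wu: "w \<cdot>\<^bsub>A\<^esub> ?u = Idn A (FO B (Dom H k))"
    using A.is_kernel_mono[OF functor_kernel[OF k], of "w \<cdot>\<^bsub>A\<^esub> ?u" "FO B (Dom H k)"] w m k' f
    by (simp add: Hom_def)
  have "is_iso A (FM B (p \<cdot> k))"
    by (rule A.is_isoI[of _ w]) (use w m k' f uw wu in auto)
  then show thesis using that[of "p \<cdot> k" "q \<cdot> k"] sq m k' f by simp
qed

text \<open>The fraction \<open>f / s\<close> evaluated in \<open>A\<close>: the value that a
  functor induced by \<open>B\<close> on the quotient must take on the class of the roof.\<close>

definition roof_val :: "'m \<Rightarrow> 'm \<Rightarrow> 'n" where
  "roof_val s f = FM B f \<cdot>\<^bsub>A\<^esub> inv_mor A (FM B s)"

text \<open>When nonempty, this is a full equivalence class of roofs, by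
  \<open>roof_rel_iff\<close>. Naming a class by its ends and its value avoids choosing a
  representative.\<close>

definition roofs_over :: "'o \<Rightarrow> 'o \<Rightarrow> 'n \<Rightarrow> ('m \<times> 'm) set" where
  "roofs_over X Y a = {(s, f) \<in> roofs H S. Cod H s = X \<and> Cod H f = Y \<and> roof_val s f = a}"

lemma roofs_iff:
  "(s, f) \<in> roofs H S \<longleftrightarrow> s \<in> Mor H \<and> f \<in> Mor H \<and> Dom H s = Dom H f \<and> is_iso A (FM B s)"
  by (auto simp: roofs_def serre_weq_iff)

lemma roof_val_simps:
  assumes "(s, f) \<in> roofs H S"
  shows "roof_val s f \<in> Mor A" "Dom A (roof_val s f) = FO B (Cod H s)"
    "Cod A (roof_val s f) = FO B (Cod H f)" "roof_val s f \<cdot>\<^bsub>A\<^esub> FM B s = FM B f"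
  using assms A.inv_mor_simps[of "FM B s"] by (auto simp: roofs_iff roof_val_def)

text \<open>Values are computed from the equation \<open>a \<cdot> B s = B f\<close>, which
  determines \<open>a\<close> because \<open>B s\<close> is invertible; no inverse has to be
  handled.\<close>

lemma roof_val_eqI:
  assumes "(s, f) \<in> roofs H S" "a \<in> Mor A" "Dom A a = FO B (Cod H s)" "a \<cdot>\<^bsub>A\<^esub> FM B s = FM B f"
  shows "roof_val s f = a"
proof -
  have "s \<in> Mor H" "is_iso A (FM B s)" using assms by (auto simp: roofs_iff)
  then have "(a \<cdot>\<^bsub>A\<^esub> FM B s) \<cdot>\<^bsub>A\<^esub> inv_mor A (FM B s) = a"
    using A.inv_mor_simps[of "FM B s"] assms(2,3) by simp
  then show ?thesis by (simp add: roof_val_def assms(4))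
qed

lemma roof_val_extend:
  assumes "(s, f) \<in> roofs H S" "u \<in> Mor H" "Cod H u = Dom H s" "is_iso A (FM B u)"
  shows "(s \<cdot> u, f \<cdot> u) \<in> roofs H S" "roof_val (s \<cdot> u) (f \<cdot> u) = roof_val s f"
proof -
  have m: "s \<in> Mor H" "f \<in> Mor H" "Dom H s = Dom H f" "is_iso A (FM B s)"
    using assms by (auto simp: roofs_iff)
  show r: "(s \<cdot> u, f \<cdot> u) \<in> roofs H S"
    using m assms A.is_iso_Comp[of "FM B u" "FM B s"] by (simp add: roofs_iff)
  show "roof_val (s \<cdot> u) (f \<cdot> u) = roof_val s f"
    by (rule roof_val_eqI[OF r])
      (use m assms roof_val_simps[OF assms(1)]
        A.Comp_eq_extend[OF roof_val_simps(4)[OF assms(1)], of "FM B u"] in auto)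
qed

text \<open>Passing to a dominating roof does not change the value. Conversely, roofs with the same
  ends and value acquire a common denominator by \<open>ore\<close>; their numerators then agree
  after \<open>B\<close>, and restricting to the kernel of their difference makes them agree in
  \<open>H\<close>.\<close>

lemma roof_rel_iff:
  "((s, f), (t, g)) \<in> roof_rel H S \<longleftrightarrow> (s, f) \<in> roofs H S \<and> (t, g) \<in> roofs H S \<and>
    Cod H s = Cod H t \<and> Cod H f = Cod H g \<and> roof_val s f = roof_val t g"
  (is "?L \<longleftrightarrow> ?R")
proof
  assume ?L
  then obtain Z u v where r: "(s, f) \<in> roofs H S" "(t, g) \<in> roofs H S"
    and h: "u \<in> Hom H Z (Dom H s)" "v \<in> Hom H Z (Dom H t)"
    and e: "s \<cdot> u = t \<cdot> v" "s \<cdot> u \<in> serre_weq H S" "f \<cdot> u = g \<cdot> v"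
    unfolding roof_rel_def by blast
  have m: "s \<in> Mor H" "f \<in> Mor H" "Dom H s = Dom H f" "is_iso A (FM B s)"
    "t \<in> Mor H" "g \<in> Mor H" "Dom H t = Dom H g" "is_iso A (FM B t)"
    using r by (auto simp: roofs_iff)
  note h = HomD[OF h(1)] HomD[OF h(2)]
  have su: "is_iso A (FM B s \<cdot>\<^bsub>A\<^esub> FM B u)" using e(2) h m by (simp add: serre_weq_iff)
  then have tv: "is_iso A (FM B t \<cdot>\<^bsub>A\<^esub> FM B v)"
    using h m functor_simps(6)[of u s] functor_simps(6)[of v t] e(1) by simp
  \<comment> \<open>Domination only asks for the common denominator to be inverted; cancelling
    \<open>B s\<close> and \<open>B t\<close> shows that \<open>u\<close> and \<open>v\<close> are
    inverted as well.\<close>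
  have u: "is_iso A (FM B u)" and v: "is_iso A (FM B v)"
    using A.is_iso_cancel_left[OF su] A.is_iso_cancel_left[OF tv] h m by auto
  have c: "Cod H (s \<cdot> u) = Cod H s" "Cod H (t \<cdot> v) = Cod H t" "Cod H (f \<cdot> u) = Cod H f"
    "Cod H (g \<cdot> v) = Cod H g" using h m by simp_all
  have "roof_val (s \<cdot> u) (f \<cdot> u) = roof_val s f" "roof_val (t \<cdot> v) (g \<cdot> v) = roof_val t g"
    using roof_val_extend(2)[OF r(1) _ _ u] roof_val_extend(2)[OF r(2) _ _ v] h by simp_all
  then show ?R using r c e(1,3) by metis
next
  assume R: ?R
  then have m: "s \<in> Mor H" "f \<in> Mor H" "Dom H s = Dom H f" "is_iso A (FM B s)"
    "t \<in> Mor H" "g \<in> Mor H" "Dom H t = Dom H g" "is_iso A (FM B t)"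
    by (auto simp: roofs_iff)
  obtain u v where uv: "u \<in> Mor H" "v \<in> Mor H" "Dom H u = Dom H v" "Cod H u = Dom H s"
    "Cod H v = Dom H t" "s \<cdot> u = t \<cdot> v" "is_iso A (FM B u)"
    using ore[of s t] m R by auto
  have "FM B (f \<cdot> u) = roof_val s f \<cdot>\<^bsub>A\<^esub> FM B (s \<cdot> u)"
    using A.Comp_eq_extend[OF roof_val_simps(4)[of s f], of "FM B u"] roof_val_simps[of s f] R m uv(1-5)
    by simp
  also have "\<dots> = roof_val t g \<cdot>\<^bsub>A\<^esub> FM B (t \<cdot> v)" using R uv(6) by simp
  also have "\<dots> = FM B (g \<cdot> v)"
    using A.Comp_eq_extend[OF roof_val_simps(4)[of t g], of "FM B v"] roof_val_simps[of t g] R m uv(1-5)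
    by simp
  finally have fg: "FM B (f \<cdot> u) = FM B (g \<cdot> v)" .
  \<comment> \<open>\<open>B\<close> sends this difference to zero, although the difference itself
    need not vanish.\<close>
  let ?d = "Add H (f \<cdot> u) (Neg H (g \<cdot> v))"
  have d: "?d \<in> Mor H" "Dom H ?d = Dom H u" "Cod H ?d = Cod H f" using R m uv by simp_all
  obtain k where k: "is_kernel H ?d k" using H.has_kernel d by blast
  note k' = H.is_kernelD[OF k]
  have "FM B ?d = Add A (FM B (f \<cdot> u)) (Neg A (FM B (g \<cdot> v)))"
    using R m uv by (simp del: functor_simps(6))
  then have d0: "FM B ?d = Zer A (FO B (Dom H u)) (FO B (Cod H f))"
    unfolding fg using R m uv by (simp del: functor_simps(6))
  \<comment> \<open>Since \<open>B d\<close> is zero, the identity is another kernel of it;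
    comparing it with the kernel \<open>B k\<close> makes \<open>B k\<close> invertible.\<close>
  have kiso: "is_iso A (FM B k)"
  proof (rule A.is_kernel_iso[where f = "FM B ?d" and f' = "FM B ?d"])
    show "is_kernel A (FM B ?d) (FM B k)" by (rule functor_kernel[OF k])
    show "is_kernel A (FM B ?d) (Idn A (FO B (Dom H u)))"
      unfolding d0 by (rule A.is_kernelI) (use m uv in \<open>auto simp: Hom_def\<close>)
    show "is_iso A (Idn A (FO B (Dom H u)))" "is_iso A (Idn A (FO B (Cod H f)))"
      using m uv by (auto intro!: A.is_iso_Idn)
  qed (use k' d m uv in \<open>auto simp: Hom_def d0\<close>)
  have "Add H (f \<cdot> (u \<cdot> k)) (Neg H (g \<cdot> (v \<cdot> k))) = Zer H (Dom H k) (Cod H f)"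
    using k'(4) k' d m uv R by simp
  then have "f \<cdot> (u \<cdot> k) = g \<cdot> (v \<cdot> k)"
    using H.Add_Neg_eq_Zer_iff[of "f \<cdot> (u \<cdot> k)" "Dom H k" "Cod H f" "g \<cdot> (v \<cdot> k)"] k' d m uv R
    by (simp add: Hom_def)
  moreover have "s \<cdot> (u \<cdot> k) = t \<cdot> (v \<cdot> k)"
    using H.Comp_eq_extend[OF uv(6), of k] k' d m uv by simp
  moreover have "s \<cdot> (u \<cdot> k) \<in> serre_weq H S"
    using A.is_iso_Comp[OF A.is_iso_Comp[OF kiso uv(7)] m(4)] k' d m uv(1-5)
    by (simp add: serre_weq_iff)
  moreover have "u \<cdot> k \<in> Hom H (Dom H k) (Dom H s)" "v \<cdot> k \<in> Hom H (Dom H k) (Dom H t)"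
    using k' d m uv by (simp_all add: Hom_def)
  ultimately show ?L unfolding roof_rel_def using R by blast
qed

lemma roof_class_eq:
  "(s, f) \<in> roofs H S \<Longrightarrow> roof_class H S s f = roofs_over (Cod H s) (Cod H f) (roof_val s f)"
  by (auto simp: roof_class_def roofs_over_def roof_rel_iff)

abbreviation "Q \<equiv> serre_quotient H S"

lemma Q_Mor: "P \<in> Mor Q \<longleftrightarrow>
    (\<exists>s f. (s, f) \<in> roofs H S \<and> P = roofs_over (Cod H s) (Cod H f) (roof_val s f))"
proof -
  have "P \<in> Mor Q \<longleftrightarrow> (\<exists>s f. (s, f) \<in> roofs H S \<and> P = roof_class H S s f)"
    by (auto simp: serre_quotient_def quotient_def roof_class_def)
  then show ?thesis using roof_class_eq by metis
qed

text \<open>The ends in the quotient are read off from an arbitrary representative. All members of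
  \<open>roofs_over X Y a\<close> have the same ends, so any one member makes the choice
  harmless.\<close>

lemma Q_Dom_Cod:
  assumes "(s, f) \<in> roofs_over X Y a"
  shows "Dom Q (roofs_over X Y a) = X" "Cod Q (roofs_over X Y a) = Y"
proof -
  have "(SOME r. r \<in> roofs_over X Y a) \<in> roofs_over X Y a" using assms by (rule someI)
  then show "Dom Q (roofs_over X Y a) = X" "Cod Q (roofs_over X Y a) = Y"
    by (auto simp: serre_quotient_def roofs_over_def)
qed

text \<open>Composition is a union over all representatives and all squares. Each choice contributes
  the class with value \<open>b \<cdot> a\<close>, and \<open>ore\<close> supplies at least one
  choice, so the union is this single class.\<close>

lemma Q_Comp:
  assumes P: "(s, f) \<in> roofs_over X Y a" and R: "(t, g) \<in> roofs_over Y Z b"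
  shows "roofs_over Y Z b \<cdot>\<^bsub>Q\<^esub> roofs_over X Y a = roofs_over X Z (b \<cdot>\<^bsub>A\<^esub> a)"
proof -
  have step: "(s \<cdot> h, g \<cdot> k) \<in> roofs_over X Z (b \<cdot>\<^bsub>A\<^esub> a)"
    if "(s, f) \<in> roofs_over X Y a" "(t, g) \<in> roofs_over Y Z b" "h \<in> Mor H" "is_iso A (FM B h)"
      "k \<in> Mor H" "Dom H h = Dom H k" "Cod H h = Dom H f" "Cod H k = Dom H t" "f \<cdot> h = t \<cdot> k"
    for s f t g h k
  proof -
    have m: "s \<in> Mor H" "f \<in> Mor H" "Dom H s = Dom H f" "is_iso A (FM B s)" "Cod H s = X"
      "t \<in> Mor H" "g \<in> Mor H" "Dom H t = Dom H g" "is_iso A (FM B t)" "Cod H f = Y" "Cod H t = Y"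
      "Cod H g = Z" and r: "(s, f) \<in> roofs H S" "(t, g) \<in> roofs H S"
      and v: "roof_val s f = a" "roof_val t g = b"
      using that by (auto simp: roofs_over_def roofs_iff)
    note v' = roof_val_simps[OF r(1), unfolded v] roof_val_simps[OF r(2), unfolded v]
    have r': "(s \<cdot> h, g \<cdot> k) \<in> roofs H S"
      using m that A.is_iso_Comp[of "FM B h" "FM B s"] by (simp add: roofs_iff)
    have "roof_val (s \<cdot> h) (g \<cdot> k) = b \<cdot>\<^bsub>A\<^esub> a"
    proof (rule roof_val_eqI[OF r'])
      have "(b \<cdot>\<^bsub>A\<^esub> a) \<cdot>\<^bsub>A\<^esub> FM B (s \<cdot> h) = b \<cdot>\<^bsub>A\<^esub> FM B (f \<cdot> h)"
        using A.Comp_eq_extend[OF v'(4), of "FM B h"] m that(3-8) v' by simp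
      also have "\<dots> = FM B (g \<cdot> k)"
        unfolding that(9) using A.Comp_eq_extend[OF v'(8), of "FM B k"] m that v' by simp
      finally show "(b \<cdot>\<^bsub>A\<^esub> a) \<cdot>\<^bsub>A\<^esub> FM B (s \<cdot> h) = FM B (g \<cdot> k)" .
    qed (use v' m that in auto)
    then show ?thesis using r' m that by (simp add: roofs_over_def)
  qed
  have sub: "roof_class H S (s \<cdot> h) (g \<cdot> k) = roofs_over X Z (b \<cdot>\<^bsub>A\<^esub> a)"
    if "(s, f) \<in> roofs_over X Y a" "(t, g) \<in> roofs_over Y Z b" "h \<in> Mor H" "is_iso A (FM B h)"
      "k \<in> Mor H" "Dom H h = Dom H k" "Cod H h = Dom H f" "Cod H k = Dom H t" "f \<cdot> h = t \<cdot> k"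
    for s f t g h k
    using step[OF that] roof_class_eq[of "s \<cdot> h" "g \<cdot> k"] by (auto simp: roofs_over_def)
  have "f \<in> Mor H" "t \<in> Mor H" "Cod H f = Cod H t" "is_iso A (FM B t)"
    using P R by (auto simp: roofs_over_def roofs_iff)
  then obtain h k where hk: "h \<in> Mor H" "k \<in> Mor H" "Dom H h = Dom H k" "Cod H h = Dom H f"
    "Cod H k = Dom H t" "f \<cdot> h = t \<cdot> k" "is_iso A (FM B h)"
    using ore[of f t] by metis
  have "\<Union> {roof_class H S (s \<cdot> h) (g \<cdot> k) | s f t g h k.
      (s, f) \<in> roofs_over X Y a \<and> (t, g) \<in> roofs_over Y Z b \<and> h \<in> serre_weq H S \<and> k \<in> Mor H \<and>
      Dom H h = Dom H k \<and> Cod H h = Dom H f \<and> Cod H k = Dom H t \<and> f \<cdot> h = t \<cdot> k}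
    = roofs_over X Z (b \<cdot>\<^bsub>A\<^esub> a)" (is "\<Union> ?U = ?K")
  proof -
    have "U = ?K" if "U \<in> ?U" for U using that sub by (auto simp: serre_weq_iff)
    moreover have "roof_class H S (s \<cdot> h) (g \<cdot> k) \<in> ?U"
      unfolding mem_Collect_eq serre_weq_iff using P R hk by blast
    ultimately show ?thesis by blast
  qed
  then show ?thesis by (simp add: serre_quotient_def)
qed

lemma roofs_overI: "(s, f) \<in> roofs H S \<Longrightarrow> (s, f) \<in> roofs_over (Cod H s) (Cod H f) (roof_val s f)"
  by (simp add: roofs_over_def)

lemma Idn_roof:
  assumes "f \<in> Mor H"
  shows "(Idn H (Dom H f), f) \<in> roofs H S" "roof_val (Idn H (Dom H f)) f = FM B f"
proof -
  show r: "(Idn H (Dom H f), f) \<in> roofs H S" using assms by (simp add: roofs_iff A.is_iso_Idn)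
  show "roof_val (Idn H (Dom H f)) f = FM B f"
    by (rule roof_val_eqI[OF r]) (use assms in auto)
qed

lemma quotient_functor_FM:
  "f \<in> Mor H \<Longrightarrow> FM (quotient_functor H S) f = roofs_over (Dom H f) (Cod H f) (FM B f)"
  using roof_class_eq[OF Idn_roof(1)] Idn_roof(2) by (simp add: quotient_functor_def)

lemma Q_Idn: "X \<in> Ob H \<Longrightarrow> Idn Q X = roofs_over X X (Idn A (FO B X))"
  using roof_class_eq[OF Idn_roof(1)[of "Idn H X"]] Idn_roof(2)[of "Idn H X"]
  by (simp add: serre_quotient_def)

text \<open>A roof \<open>(s, g)\<close> with invertible image has \<open>g\<close> inverted, and then \<open>(g, s)\<close> is an inverse.\<close>

lemma induced_functor_reflects_iso:
  assumes \<iota>: "is_functor Q A \<iota>" "ftor_eq H (\<iota> \<circ>\<^sub>F quotient_functor H S) B"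
    and P: "P \<in> Mor Q" "is_iso A (FM \<iota> P)"
  shows "is_iso Q P"
proof -
  obtain s g where r: "(s, g) \<in> roofs H S" and Peq: "P = roofs_over (Cod H s) (Cod H g) (roof_val s g)"
    using P Q_Mor by blast
  have m: "s \<in> Mor H" "g \<in> Mor H" "Dom H s = Dom H g" "is_iso A (FM B s)"
    using r by (auto simp: roofs_iff)
  let ?s = "FM (quotient_functor H S) s" and ?g = "FM (quotient_functor H S) g"
  note \<iota>Q = \<iota>(2)[unfolded ftor_eq_def comp_ftor_def, simplified]
  have s_in: "(Idn H (Dom H s), s) \<in> roofs_over (Dom H s) (Cod H s) (FM B s)"
    using roofs_overI[OF Idn_roof(1)[OF m(1)]] Idn_roof(2)[OF m(1)] m by simp
  have P_in: "(s, g) \<in> roofs_over (Cod H s) (Cod H g) (roof_val s g)" by (rule roofs_overI[OF r])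
  \<comment> \<open>The value of \<iota> on \<open>P\<close> is accessible only through the quotient
    functor. In the quotient \<open>P\<close> times its denominator is its numerator; applying
    \<iota> expresses \<open>B g\<close> as the composite of the isomorphisms \<iota>
    \<open>P\<close> and \<open>B s\<close>.\<close>
  have "P \<cdot>\<^bsub>Q\<^esub> ?s = ?g"
    unfolding Peq quotient_functor_FM[OF m(1)] quotient_functor_FM[OF m(2)] Q_Comp[OF s_in P_in]
    using roof_val_simps(4)[OF r] m by simp
  moreover have "?s \<in> Mor Q" "Cod Q ?s = Dom Q P"
  proof -
    show "?s \<in> Mor Q"
      using Q_Mor Idn_roof[OF m(1)] m unfolding quotient_functor_FM[OF m(1)]
      by (metis H.Idn_simps(3) H.Ob_simps(1))
    show "Cod Q ?s = Dom Q P"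
      unfolding Peq quotient_functor_FM[OF m(1)] Q_Dom_Cod[OF s_in] Q_Dom_Cod[OF P_in] by simp
  qed
  ultimately have "FM \<iota> ?g = FM \<iota> P \<cdot>\<^bsub>A\<^esub> FM \<iota> ?s"
    using is_functorD(6)[OF \<iota>(1), of ?s P] P by simp
  then have "FM B g = FM \<iota> P \<cdot>\<^bsub>A\<^esub> FM B s" using \<iota>Q m by simp
  moreover have "Dom A (FM \<iota> P) = FO \<iota> (Cod H s)"
    using is_functorD(3)[OF \<iota>(1) P(1)] unfolding Peq Q_Dom_Cod[OF P_in] by simp
  moreover have "FO \<iota> (Cod H s) = FO B (Cod H s)" using \<iota>Q m by (simp add: quotient_functor_def)
  ultimately have giso: "is_iso A (FM B g)"
    using A.is_iso_Comp[OF m(4) P(2)] m by simp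
  then have r': "(g, s) \<in> roofs H S" using m by (simp add: roofs_iff)
  note v = roof_val_simps[OF r] and v' = roof_val_simps[OF r']
  have inv: "roof_val g s \<cdot>\<^bsub>A\<^esub> roof_val s g = Idn A (FO B (Cod H s))"
    "roof_val s g \<cdot>\<^bsub>A\<^esub> roof_val g s = Idn A (FO B (Cod H g))"
    using m giso A.inv_mor_simps[OF m(4)] A.inv_mor_simps[OF giso]
    by (simp_all add: roof_val_def A.inv_mor_cancel)
  have P'_in: "(g, s) \<in> roofs_over (Cod H g) (Cod H s) (roof_val g s)" by (rule roofs_overI[OF r'])
  have "is_inverse Q P (roofs_over (Cod H g) (Cod H s) (roof_val g s))"
    unfolding is_inverse_def Peq Q_Dom_Cod[OF P_in] Q_Comp[OF P_in P'_in] Q_Comp[OF P'_in P_in] inv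
    using Q_Mor r r' m by (auto simp: Hom_def Q_Dom_Cod[OF P'_in] Q_Idn)
  then show ?thesis unfolding is_iso_def by blast
qed

end

section \<open>Categories generated by cokernels of projective objects\<close>

lemma (in preadditive_category) is_cokernel_cancel:
  assumes "is_cokernel C f c" "u \<in> Mor C" "v \<in> Mor C" "Dom C u = Cod C c" "Dom C v = Cod C c"
    "Cod C u = Cod C v" "u \<cdot> c = v \<cdot> c"
  shows "u = v"
  using is_cokernel_epi[OF assms(1), of u "Cod C v" v] assms by (simp add: Hom_def)

lemma is_biproductD:
  assumes "is_biproduct C X Y P i j p q"
  shows "i \<in> Mor C" "j \<in> Mor C" "p \<in> Mor C" "q \<in> Mor C" "Dom C i = X" "Cod C i = P"
    "Dom C j = Y" "Cod C j = P" "Dom C p = P" "Cod C p = X" "Dom C q = P" "Cod C q = Y"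
    "p \<cdot>\<^bsub>C\<^esub> i = Idn C X" "q \<cdot>\<^bsub>C\<^esub> j = Idn C Y"
    "q \<cdot>\<^bsub>C\<^esub> i = Zer C X Y" "p \<cdot>\<^bsub>C\<^esub> j = Zer C Y X"
    "Add C (i \<cdot>\<^bsub>C\<^esub> p) (j \<cdot>\<^bsub>C\<^esub> q) = Idn C P"
  using assms by (auto simp: is_biproduct_def Hom_def)

text \<open>As in \<open>ore\<close>, the kernel of \<open>s p - t q\<close> on a biproduct, with
  \<open>n\<close> the pair \<open>(a, b)\<close>. Only the factorization of \<open>a\<close>
  through \<open>u\<close> is recorded, since the applications ask whether a morphism factors
  through \<open>u\<close>.\<close>

lemma (in additive_category) weak_pullback:
  assumes ker: "\<And>f. f \<in> Mor C \<Longrightarrow> \<exists>k. is_kernel C f k"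
    and st: "s \<in> Mor C" "t \<in> Mor C" "Cod C s = Cod C t"
  obtains u v where "u \<in> Mor C" "v \<in> Mor C" "Dom C u = Dom C v" "Cod C u = Dom C s"
    "Cod C v = Dom C t" "s \<cdot> u = t \<cdot> v"
    "\<forall>a \<in> Mor C. \<forall>b \<in> Mor C. Dom C a = Dom C b \<and> Cod C a = Dom C s \<and> Cod C b = Dom C t \<and>
      s \<cdot> a = t \<cdot> b \<longrightarrow> (\<exists>w \<in> Mor C. Dom C w = Dom C a \<and> Cod C w = Dom C u \<and> u \<cdot> w = a)"
proof -
  obtain P i j p q where P: "is_biproduct C (Dom C s) (Dom C t) P i j p q"
    using biproduct[of "Dom C s" "Dom C t"] st by auto
  note m = is_biproductD(1-12)[OF P] and e = is_biproductD(13-17)[OF P]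
  define f where "f = Add C (s \<cdot> p) (Neg C (t \<cdot> q))"
  have f: "f \<in> Mor C" "Dom C f = P" "Cod C f = Cod C t" using m st by (simp_all add: f_def)
  obtain k where k: "is_kernel C f k" using ker f by blast
  note k' = is_kernelD[OF k]
  have "Add C (s \<cdot> (p \<cdot> k)) (Neg C (t \<cdot> (q \<cdot> k))) = Zer C (Dom C k) (Cod C t)"
    using k'(4) k' m st f unfolding f_def by simp
  then have sq: "s \<cdot> (p \<cdot> k) = t \<cdot> (q \<cdot> k)"
    using Add_Neg_eq_Zer_iff[of "s \<cdot> (p \<cdot> k)" "Dom C k" "Cod C t" "t \<cdot> (q \<cdot> k)"] k' m st f
    by (simp add: Hom_def)
  show thesis
  proof (rule that[of "p \<cdot> k" "q \<cdot> k"]; (intro ballI impI; elim conjE)?)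
    fix a b assume ab: "a \<in> Mor C" "b \<in> Mor C" "Dom C a = Dom C b" "Cod C a = Dom C s"
      "Cod C b = Dom C t" and eq: "s \<cdot> a = t \<cdot> b"
    define n where "n = Add C (i \<cdot> a) (j \<cdot> b)"
    have n: "n \<in> Mor C" "Dom C n = Dom C a" "Cod C n = P" using ab m by (simp_all add: n_def)
    have pn: "p \<cdot> n = a"
      unfolding n_def using Comp_eq_extend[OF e(1), of a] Comp_eq_extend[OF e(4), of b] ab m st by simp
    have qn: "q \<cdot> n = b"
      unfolding n_def using Comp_eq_extend[OF e(3), of a] Comp_eq_extend[OF e(2), of b] ab m st by simp
    have "f \<cdot> n = Add C (s \<cdot> (p \<cdot> n)) (Neg C (t \<cdot> (q \<cdot> n)))"
      unfolding f_def using n m st by simp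
    also have "\<dots> = Zer C (Dom C a) (Cod C f)" unfolding pn qn eq using ab st f by simp
    finally obtain w where w: "w \<in> Mor C" "Dom C w = Dom C a" "Cod C w = Dom C k" "k \<cdot> w = n"
      using is_kernel_factor[OF k, of n "Dom C a"] n f by (auto simp: Hom_def)
    then show "\<exists>w \<in> Mor C. Dom C w = Dom C a \<and> Cod C w = Dom C (p \<cdot> k) \<and> (p \<cdot> k) \<cdot> w = a"
      using pn k' m f by (auto intro!: bexI[of _ w])
  qed (use sq k' m f in auto)
qed

text \<open>The properties of the Yoneda embedding \<open>C \<rightarrow> Rcat C\<close> that are needed. The axioms
  \<open>ex_lift\<close> and \<open>ex_factor\<close> express that the objects \<open>y X\<close> are projective.\<close>

locale fp_completion =
  C: additive_category C + R: preadditive_category R + additive_functor_between C R y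
  for C :: "('o, 'm) cat" (structure) and R :: "('p, 'n) cat"
    and y :: "('o, 'm, 'p, 'n) ftor" +
  assumes full: "\<lbrakk>X \<in> Ob C; Y \<in> Ob C; t \<in> Hom R (FO y X) (FO y Y)\<rbrakk>
      \<Longrightarrow> \<exists>f \<in> Hom C X Y. FM y f = t"
    and faithful: "\<lbrakk>f \<in> Hom C X Y; g \<in> Hom C X Y; FM y f = FM y g\<rbrakk> \<Longrightarrow> f = g"
    and ex_presentation: "P \<in> Ob R \<Longrightarrow> \<exists>f \<in> Mor C. \<exists>c. is_cokernel R (FM y f) c \<and> Cod R c = P"
    and ex_cokernel: "f \<in> Mor C \<Longrightarrow> \<exists>c. is_cokernel R (FM y f) c"
    and ex_lift: "\<lbrakk>f \<in> Mor C; is_cokernel R (FM y f) c; X \<in> Ob C; t \<in> Hom R (FO y X) (Cod R c)\<rbrakk>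
      \<Longrightarrow> \<exists>g \<in> Hom C X (Cod C f). c \<cdot>\<^bsub>R\<^esub> FM y g = t"
    and ex_factor: "\<lbrakk>f \<in> Mor C; is_cokernel R (FM y f) c; g \<in> Mor C; Cod C g = Cod C f;
        c \<cdot>\<^bsub>R\<^esub> FM y g = Zer R (FO y (Dom C g)) (Cod R c)\<rbrakk>
      \<Longrightarrow> \<exists>h \<in> Hom C (Dom C g) (Dom C f). f \<cdot> h = g"
begin

lemma presentation:
  assumes "P \<in> Ob R"
  obtains f c where "f \<in> Mor C" "is_cokernel R (FM y f) c" "c \<in> Mor R" "Dom R c = FO y (Cod C f)"
    "Cod R c = P" "c \<cdot>\<^bsub>R\<^esub> FM y f = Zer R (FO y (Dom C f)) P"
proof -
  obtain f c where "f \<in> Mor C" "is_cokernel R (FM y f) c" "Cod R c = P"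
    using ex_presentation[OF assms] by blast
  then show thesis using that[of f c] R.is_cokernelD[of "FM y f" c] by simp
qed

lemma lift:
  assumes "f \<in> Mor C" "is_cokernel R (FM y f) c" "X \<in> Ob C" "g \<in> Mor R" "Dom R g = FO y X"
    "Cod R g = Cod R c"
  obtains g0 where "g0 \<in> Mor C" "Dom C g0 = X" "Cod C g0 = Cod C f" "c \<cdot>\<^bsub>R\<^esub> FM y g0 = g"
  using ex_lift[OF assms(1-3), of g] assms by (auto simp: Hom_def)

lemma factor:
  assumes "f \<in> Mor C" "is_cokernel R (FM y f) c" "g \<in> Mor C" "Cod C g = Cod C f"
    "c \<cdot>\<^bsub>R\<^esub> FM y g = Zer R (FO y (Dom C g)) (Cod R c)"
  obtains h where "h \<in> Mor C" "Dom C h = Dom C g" "Cod C h = Dom C f" "f \<cdot> h = g"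
  using ex_factor[OF assms] by (auto simp: Hom_def)

lemma eq_ZerI:
  assumes "f \<in> Mor C" "FM y f = Zer R (FO y (Dom C f)) (FO y (Cod C f))"
  shows "f = Zer C (Dom C f) (Cod C f)"
  using faithful[of f "Dom C f" "Cod C f" "Zer C (Dom C f) (Cod C f)"] assms by (simp add: Hom_def)

lemma induced:
  assumes "is_cokernel R f c" "t \<in> Mor R" "Dom R t = Cod R f" "t \<cdot>\<^bsub>R\<^esub> f = Zer R (Dom R f) (Cod R t)"
  obtains u where "u \<in> Mor R" "Dom R u = Cod R c" "Cod R u = Cod R t" "u \<cdot>\<^bsub>R\<^esub> c = t"
  using R.is_cokernel_factor[OF assms(1), of t "Cod R t"] assms by (auto simp: Hom_def)

text \<open>Presentations add: \<open>h\<close> is the direct sum of \<open>f\<close> and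
  \<open>g\<close>, and its cokernel is the biproduct. The four structure maps are induced from
  those of \<open>W\<close>, and the biproduct equations are checked after the epis
  \<open>c\<close>, \<open>d\<close> and \<open>e\<close>.\<close>

lemma has_biproduct:
  assumes "P \<in> Ob R" "Q \<in> Ob R"
  shows "\<exists>E\<in>Ob R. \<exists>i j p q. is_biproduct R P Q E i j p q"
proof -
  obtain f c where f: "f \<in> Mor C" "is_cokernel R (FM y f) c" "c \<in> Mor R" "Dom R c = FO y (Cod C f)"
    "Cod R c = P" "c \<cdot>\<^bsub>R\<^esub> FM y f = Zer R (FO y (Dom C f)) P" by (rule presentation[OF assms(1)])
  obtain g d where g: "g \<in> Mor C" "is_cokernel R (FM y g) d" "d \<in> Mor R" "Dom R d = FO y (Cod C g)"
    "Cod R d = Q" "d \<cdot>\<^bsub>R\<^esub> FM y g = Zer R (FO y (Dom C g)) Q" by (rule presentation[OF assms(2)])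
  obtain W i j p q where W: "is_biproduct C (Cod C f) (Cod C g) W i j p q"
    using C.biproduct[of "Cod C f" "Cod C g"] f g by auto
  obtain V i' j' p' q' where V: "is_biproduct C (Dom C f) (Dom C g) V i' j' p' q'"
    using C.biproduct[of "Dom C f" "Dom C g"] f g by auto
  note w = is_biproductD(1-12)[OF W] and v = is_biproductD(1-12)[OF V]
    and we = is_biproductD(13-17)[OF W] and ve = is_biproductD(13-17)[OF V]
  define h where "h = Add C (i \<cdot> (f \<cdot> p')) (j \<cdot> (g \<cdot> q'))"
  have h: "h \<in> Mor C" "Dom C h = V" "Cod C h = W" using w v f g by (simp_all add: h_def)
  have hi: "h \<cdot> i' = i \<cdot> f" "h \<cdot> j' = j \<cdot> g" using w v f g ve by (simp_all add: h_def)
  have ph: "p \<cdot> h = f \<cdot> p'" "q \<cdot> h = g \<cdot> q'"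
    unfolding h_def using w v f g C.Comp_eq_extend[OF we(1), of "f \<cdot> p'"]
      C.Comp_eq_extend[OF we(2), of "g \<cdot> q'"] C.Comp_eq_extend[OF we(3), of "f \<cdot> p'"]
      C.Comp_eq_extend[OF we(4), of "g \<cdot> q'"] by simp_all
  obtain e where e: "is_cokernel R (FM y h) e" using ex_cokernel h by blast
  note e' = R.is_cokernelD[OF e]
  have E: "Cod R e \<in> Ob R" "W \<in> Ob C" using e' w by auto
  obtain I where I: "I \<in> Mor R" "Dom R I = P" "Cod R I = Cod R e" "I \<cdot>\<^bsub>R\<^esub> c = e \<cdot>\<^bsub>R\<^esub> FM y i"
  proof (rule induced[OF f(2), of "e \<cdot>\<^bsub>R\<^esub> FM y i"])
    have "(e \<cdot>\<^bsub>R\<^esub> FM y i) \<cdot>\<^bsub>R\<^esub> FM y f = (e \<cdot>\<^bsub>R\<^esub> FM y h) \<cdot>\<^bsub>R\<^esub> FM y i'"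
      using functor_Comp_eq[OF hi(1)] w v f h e'(1-3) by simp
    also have "\<dots> = Zer R (FO y (Dom C f)) (Cod R e)" unfolding e'(4) using w v f h e' by simp
    finally show "(e \<cdot>\<^bsub>R\<^esub> FM y i) \<cdot>\<^bsub>R\<^esub> FM y f = Zer R (Dom R (FM y f)) (Cod R (e \<cdot>\<^bsub>R\<^esub> FM y i))"
      using f w h e' by simp
  qed (use f w h e' in auto)
  obtain J where J: "J \<in> Mor R" "Dom R J = Q" "Cod R J = Cod R e" "J \<cdot>\<^bsub>R\<^esub> d = e \<cdot>\<^bsub>R\<^esub> FM y j"
  proof (rule induced[OF g(2), of "e \<cdot>\<^bsub>R\<^esub> FM y j"])
    have "(e \<cdot>\<^bsub>R\<^esub> FM y j) \<cdot>\<^bsub>R\<^esub> FM y g = (e \<cdot>\<^bsub>R\<^esub> FM y h) \<cdot>\<^bsub>R\<^esub> FM y j'"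
      using functor_Comp_eq[OF hi(2)] w v g h e'(1-3) by simp
    also have "\<dots> = Zer R (FO y (Dom C g)) (Cod R e)" unfolding e'(4) using w v g h e' by simp
    finally show "(e \<cdot>\<^bsub>R\<^esub> FM y j) \<cdot>\<^bsub>R\<^esub> FM y g = Zer R (Dom R (FM y g)) (Cod R (e \<cdot>\<^bsub>R\<^esub> FM y j))"
      using g w h e' by simp
  qed (use g w h e' in auto)
  obtain A where A: "A \<in> Mor R" "Dom R A = Cod R e" "Cod R A = P" "A \<cdot>\<^bsub>R\<^esub> e = c \<cdot>\<^bsub>R\<^esub> FM y p"
  proof (rule induced[OF e, of "c \<cdot>\<^bsub>R\<^esub> FM y p"])
    have "(c \<cdot>\<^bsub>R\<^esub> FM y p) \<cdot>\<^bsub>R\<^esub> FM y h = (c \<cdot>\<^bsub>R\<^esub> FM y f) \<cdot>\<^bsub>R\<^esub> FM y p'"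
      using functor_Comp_eq[OF ph(1)] w v f(1,3-5) h by simp
    also have "\<dots> = Zer R (FO y V) P" unfolding f(6) using w v f(1,3-5) assms by simp
    finally show "(c \<cdot>\<^bsub>R\<^esub> FM y p) \<cdot>\<^bsub>R\<^esub> FM y h = Zer R (Dom R (FM y h)) (Cod R (c \<cdot>\<^bsub>R\<^esub> FM y p))"
      using f w h by simp
  qed (use f w h in auto)
  obtain B where B: "B \<in> Mor R" "Dom R B = Cod R e" "Cod R B = Q" "B \<cdot>\<^bsub>R\<^esub> e = d \<cdot>\<^bsub>R\<^esub> FM y q"
  proof (rule induced[OF e, of "d \<cdot>\<^bsub>R\<^esub> FM y q"])
    have "(d \<cdot>\<^bsub>R\<^esub> FM y q) \<cdot>\<^bsub>R\<^esub> FM y h = (d \<cdot>\<^bsub>R\<^esub> FM y g) \<cdot>\<^bsub>R\<^esub> FM y q'"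
      using functor_Comp_eq[OF ph(2)] w v g(1,3-5) h by simp
    also have "\<dots> = Zer R (FO y V) Q" unfolding g(6) using w v g(1,3-5) assms by simp
    finally show "(d \<cdot>\<^bsub>R\<^esub> FM y q) \<cdot>\<^bsub>R\<^esub> FM y h = Zer R (Dom R (FM y h)) (Cod R (d \<cdot>\<^bsub>R\<^esub> FM y q))"
      using g w h by simp
  qed (use g w h in auto)
  have mor: "FM y i \<in> Mor R" "FM y j \<in> Mor R" "FM y p \<in> Mor R" "FM y q \<in> Mor R"
    "Cod R (FM y i) = Dom R e" "Cod R (FM y j) = Dom R e"
    "Dom R (FM y i) = Dom R c" "Dom R (FM y j) = Dom R d"
    "Cod R (FM y p) = Dom R c" "Cod R (FM y q) = Dom R d"
    "Dom R (FM y p) = Dom R e" "Dom R (FM y q) = Dom R e" "e \<in> Mor R"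
    using w e' h f g by simp_all
  note AI = R.Comp_eq_extend[OF A(4) A(1)] and BI = R.Comp_eq_extend[OF B(4) B(1)]
    and IA = R.Comp_eq_extend[OF I(4) I(1)] and JB = R.Comp_eq_extend[OF J(4) J(1)]
  have "A \<cdot>\<^bsub>R\<^esub> I = Idn R P"
  proof (rule R.is_cokernel_cancel[OF f(2)])
    have "A \<cdot>\<^bsub>R\<^esub> (e \<cdot>\<^bsub>R\<^esub> FM y i) = Idn R P \<cdot>\<^bsub>R\<^esub> c"
      using AI[of "FM y i"] functor_Comp_eq[OF we(1)] mor w f g A by simp
    then show "(A \<cdot>\<^bsub>R\<^esub> I) \<cdot>\<^bsub>R\<^esub> c = Idn R P \<cdot>\<^bsub>R\<^esub> c" using A I f by simp
  qed (use A I f assms in auto)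
  moreover have "B \<cdot>\<^bsub>R\<^esub> J = Idn R Q"
  proof (rule R.is_cokernel_cancel[OF g(2)])
    have "B \<cdot>\<^bsub>R\<^esub> (e \<cdot>\<^bsub>R\<^esub> FM y j) = Idn R Q \<cdot>\<^bsub>R\<^esub> d"
      using BI[of "FM y j"] functor_Comp_eq[OF we(2)] mor w f g B by simp
    then show "(B \<cdot>\<^bsub>R\<^esub> J) \<cdot>\<^bsub>R\<^esub> d = Idn R Q \<cdot>\<^bsub>R\<^esub> d" using B J g by simp
  qed (use B J g assms in auto)
  moreover have "B \<cdot>\<^bsub>R\<^esub> I = Zer R P Q"
  proof (rule R.is_cokernel_cancel[OF f(2)])
    have "B \<cdot>\<^bsub>R\<^esub> (e \<cdot>\<^bsub>R\<^esub> FM y i) = Zer R P Q \<cdot>\<^bsub>R\<^esub> c"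
      using BI[of "FM y i"] functor_Comp_eq[OF we(3)] mor w f g B assms by simp
    then show "(B \<cdot>\<^bsub>R\<^esub> I) \<cdot>\<^bsub>R\<^esub> c = Zer R P Q \<cdot>\<^bsub>R\<^esub> c" using B I f by simp
  qed (use B I f assms in auto)
  moreover have "A \<cdot>\<^bsub>R\<^esub> J = Zer R Q P"
  proof (rule R.is_cokernel_cancel[OF g(2)])
    have "A \<cdot>\<^bsub>R\<^esub> (e \<cdot>\<^bsub>R\<^esub> FM y j) = Zer R Q P \<cdot>\<^bsub>R\<^esub> d"
      using AI[of "FM y j"] functor_Comp_eq[OF we(4)] mor w f g A assms by simp
    then show "(A \<cdot>\<^bsub>R\<^esub> J) \<cdot>\<^bsub>R\<^esub> d = Zer R Q P \<cdot>\<^bsub>R\<^esub> d" using A J g by simp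
  qed (use A J g assms in auto)
  moreover have "Add R (I \<cdot>\<^bsub>R\<^esub> A) (J \<cdot>\<^bsub>R\<^esub> B) = Idn R (Cod R e)"
  proof (rule R.is_cokernel_cancel[OF e])
    have "Add R (I \<cdot>\<^bsub>R\<^esub> A) (J \<cdot>\<^bsub>R\<^esub> B) \<cdot>\<^bsub>R\<^esub> e = Add R (I \<cdot>\<^bsub>R\<^esub> (c \<cdot>\<^bsub>R\<^esub> FM y p)) (J \<cdot>\<^bsub>R\<^esub> (d \<cdot>\<^bsub>R\<^esub> FM y q))"
      using A B I J mor by simp
    also have "\<dots> = e \<cdot>\<^bsub>R\<^esub> FM y (Add C (i \<cdot> p) (j \<cdot> q))"
      using IA[of "FM y p"] JB[of "FM y q"] I J f g mor w by simp
    also have "\<dots> = Idn R (Cod R e) \<cdot>\<^bsub>R\<^esub> e" unfolding we(5) using E e' h mor by simp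
    finally show "Add R (I \<cdot>\<^bsub>R\<^esub> A) (J \<cdot>\<^bsub>R\<^esub> B) \<cdot>\<^bsub>R\<^esub> e = Idn R (Cod R e) \<cdot>\<^bsub>R\<^esub> e" .
  qed (use A B I J E in auto)
  ultimately have "is_biproduct R P Q (Cod R e) I J A B"
    unfolding is_biproduct_def using A B I J by (simp add: Hom_def)
  then show ?thesis using E by blast
qed

text \<open>Being a zero object is the equation \<open>Idn = Zer\<close>, which an additive functor
  preserves; so the image of a zero object of \<open>C\<close> is one of \<open>R\<close>.\<close>

lemma additive_category_R: "additive_category R"
proof unfold_locales
  obtain Z where Z: "is_zero_object C Z" using C.zero_object by blast
  then have "Z \<in> Ob C" by (simp add: is_zero_object_def)
  then have "Idn C Z = Zer C Z Z" using C.is_zero_object_morphism(1)[OF Z, of "Idn C Z"] by simp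
  then have "Idn R (FO y Z) = Zer R (FO y Z) (FO y Z)"
    using functor_simps(5) functor_Zer \<open>Z \<in> Ob C\<close> by metis
  then show "\<exists>Z. is_zero_object R Z" using R.is_zero_objectI \<open>Z \<in> Ob C\<close> functor_simps(1) by blast
qed (rule has_biproduct)

text \<open>Projectivity lifts \<phi> to a morphism \<open>s\<close> between the generators of the
  presentations. The cokernel has the generators of \<open>Cod R \<phi>\<close>, and as relations
  those of \<open>g\<close> together with the image of \<open>s\<close>: it is presented by
  \<open>h\<close> on \<open>Cod C f\<close> plus \<open>Dom C g\<close>.\<close>

lemma has_cokernel:
  assumes \<phi>: "\<phi> \<in> Mor R"
  shows "\<exists>e. is_cokernel R \<phi> e"
proof -
  obtain f c where f: "f \<in> Mor C" "is_cokernel R (FM y f) c" "c \<in> Mor R" "Dom R c = FO y (Cod C f)"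
    "Cod R c = Dom R \<phi>" "c \<cdot>\<^bsub>R\<^esub> FM y f = Zer R (FO y (Dom C f)) (Dom R \<phi>)"
    using presentation[of "Dom R \<phi>"] \<phi> by auto
  obtain g d where g: "g \<in> Mor C" "is_cokernel R (FM y g) d" "d \<in> Mor R" "Dom R d = FO y (Cod C g)"
    "Cod R d = Cod R \<phi>" "d \<cdot>\<^bsub>R\<^esub> FM y g = Zer R (FO y (Dom C g)) (Cod R \<phi>)"
    using presentation[of "Cod R \<phi>"] \<phi> by auto
  obtain s where s: "s \<in> Mor C" "Dom C s = Cod C f" "Cod C s = Cod C g"
    "d \<cdot>\<^bsub>R\<^esub> FM y s = \<phi> \<cdot>\<^bsub>R\<^esub> c"
    by (rule lift[OF g(1,2), of "Cod C f" "\<phi> \<cdot>\<^bsub>R\<^esub> c"]) (use \<phi> f g in auto)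
  obtain W i j p q where W: "is_biproduct C (Cod C f) (Dom C g) W i j p q"
    using C.biproduct[of "Cod C f" "Dom C g"] f g by auto
  note w = is_biproductD(1-12)[OF W] and we = is_biproductD(13-17)[OF W]
  have "W \<in> Ob C" using w(1,6) by auto
  define h where "h = Add C (s \<cdot> p) (g \<cdot> q)"
  have h: "h \<in> Mor C" "Dom C h = W" "Cod C h = Cod C g" using w s g by (simp_all add: h_def)
  have hi: "h \<cdot> i = s" "h \<cdot> j = g" using w s g f(1) we by (simp_all add: h_def)
  obtain e where e: "is_cokernel R (FM y h) e" using ex_cokernel h by blast
  note e' = R.is_cokernelD[OF e]
  have ei: "e \<cdot>\<^bsub>R\<^esub> FM y s = Zer R (FO y (Cod C f)) (Cod R e)"
    "e \<cdot>\<^bsub>R\<^esub> FM y g = Zer R (FO y (Dom C g)) (Cod R e)"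
    using R.Comp_eq_extend[OF e'(4), of "FM y i"] R.Comp_eq_extend[OF e'(4), of "FM y j"]
      functor_Comp_eq[OF hi(1)] functor_Comp_eq[OF hi(2)] w h e' by simp_all
  obtain u where u: "u \<in> Mor R" "Dom R u = Cod R \<phi>" "Cod R u = Cod R e" "u \<cdot>\<^bsub>R\<^esub> d = e"
    by (rule induced[OF g(2), of e]) (use ei g h e' in auto)
  note ud = R.Comp_eq_extend[OF u(4) u(1)]
  have "is_cokernel R \<phi> u"
  proof (rule R.is_cokernelI)
    show "u \<cdot>\<^bsub>R\<^esub> \<phi> = Zer R (Dom R \<phi>) (Cod R u)"
    proof (rule R.is_cokernel_cancel[OF f(2)])
      have "u \<cdot>\<^bsub>R\<^esub> (\<phi> \<cdot>\<^bsub>R\<^esub> c) = u \<cdot>\<^bsub>R\<^esub> (d \<cdot>\<^bsub>R\<^esub> FM y s)" using s by simp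
      also have "\<dots> = Zer R (Dom R c) (Cod R e)" using ud[of "FM y s"] ei s g u f by simp
      finally show "(u \<cdot>\<^bsub>R\<^esub> \<phi>) \<cdot>\<^bsub>R\<^esub> c = Zer R (Dom R \<phi>) (Cod R u) \<cdot>\<^bsub>R\<^esub> c"
        using f u e' \<phi> by simp
    qed (use f u \<phi> e' in auto)
  next
    fix t assume t: "t \<in> Mor R" "Dom R t = Cod R \<phi>" "t \<cdot>\<^bsub>R\<^esub> \<phi> = Zer R (Dom R \<phi>) (Cod R t)"
    have 1: "(t \<cdot>\<^bsub>R\<^esub> d) \<cdot>\<^bsub>R\<^esub> FM y s = Zer R (FO y (Cod C f)) (Cod R t)"
    proof -
      have "(t \<cdot>\<^bsub>R\<^esub> d) \<cdot>\<^bsub>R\<^esub> FM y s = t \<cdot>\<^bsub>R\<^esub> (\<phi> \<cdot>\<^bsub>R\<^esub> c)" using s(4) s(1-3) t g by simp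
      then show ?thesis using R.Comp_eq_extend[OF t(3), of c] t \<phi> f by simp
    qed
    have 2: "(t \<cdot>\<^bsub>R\<^esub> d) \<cdot>\<^bsub>R\<^esub> FM y g = Zer R (FO y (Dom C g)) (Cod R t)"
      using t g by simp
    have "(t \<cdot>\<^bsub>R\<^esub> d) \<cdot>\<^bsub>R\<^esub> FM y h = Zer R (FO y W) (Cod R t)"
    proof -
      have "(t \<cdot>\<^bsub>R\<^esub> d) \<cdot>\<^bsub>R\<^esub> FM y h = Add R (((t \<cdot>\<^bsub>R\<^esub> d) \<cdot>\<^bsub>R\<^esub> FM y s) \<cdot>\<^bsub>R\<^esub> FM y p)
          (((t \<cdot>\<^bsub>R\<^esub> d) \<cdot>\<^bsub>R\<^esub> FM y g) \<cdot>\<^bsub>R\<^esub> FM y q)"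
        using t(1,2) g(1-5) s(1-3) w by (simp add: h_def)
      also have "\<dots> = Zer R (FO y W) (Cod R t)" unfolding 1 2 using w t g f \<open>W \<in> Ob C\<close> by simp
      finally show ?thesis .
    qed
    then obtain v where v: "v \<in> Mor R" "Dom R v = Cod R e" "Cod R v = Cod R t"
      "v \<cdot>\<^bsub>R\<^esub> e = t \<cdot>\<^bsub>R\<^esub> d"
      using induced[OF e, of "t \<cdot>\<^bsub>R\<^esub> d"] t g h by auto
    have "v \<cdot>\<^bsub>R\<^esub> u = t"
      by (rule R.is_cokernel_cancel[OF g(2)]) (use v u t g in auto)
    then show "\<exists>v. v \<in> Hom R (Cod R u) (Cod R t) \<and> v \<cdot>\<^bsub>R\<^esub> u = t"
      using v u by (auto simp: Hom_def)
  next
    fix v assume v: "v \<in> Mor R" "Dom R v = Cod R u" "v \<cdot>\<^bsub>R\<^esub> u = Zer R (Dom R u) (Cod R v)"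
    have "v \<cdot>\<^bsub>R\<^esub> e = Zer R (Cod R u) (Cod R v) \<cdot>\<^bsub>R\<^esub> e"
      using R.Comp_eq_extend[OF v(3), of d] v u g e' h by simp
    then show "v = Zer R (Cod R u) (Cod R v)"
      by (rule R.is_cokernel_cancel[OF e, rotated -1]) (use v u e' in auto)
  qed (use u \<phi> in auto)
  then show ?thesis by blast
qed

text \<open>Test morphisms start at an arbitrary object of \<open>R\<close>; presenting that object
  translates them into morphisms of \<open>C\<close>, where the kernel property is
  available.\<close>

lemma preserves_kernel:
  assumes k: "is_kernel C f k"
  shows "is_kernel R (FM y f) (FM y k)"
proof (rule R.is_kernelI)
  note k' = C.is_kernelD[OF k]
  show "FM y f \<in> Mor R" "FM y k \<in> Mor R" "Cod R (FM y k) = Dom R (FM y f)" using k' by auto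
  show "FM y f \<cdot>\<^bsub>R\<^esub> FM y k = Zer R (Dom R (FM y k)) (Cod R (FM y f))"
    using functor_Comp_eq[OF k'(4)] k' by simp
next
  note k' = C.is_kernelD[OF k]
  fix t assume t: "t \<in> Mor R" "Cod R t = Dom R (FM y f)" "FM y f \<cdot>\<^bsub>R\<^esub> t = Zer R (Dom R t) (Cod R (FM y f))"
  obtain h d where h: "h \<in> Mor C" "is_cokernel R (FM y h) d" "d \<in> Mor R" "Dom R d = FO y (Cod C h)"
    "Cod R d = Dom R t" "d \<cdot>\<^bsub>R\<^esub> FM y h = Zer R (FO y (Dom C h)) (Dom R t)"
    using presentation[of "Dom R t"] t by auto
  \<comment> \<open>By full faithfulness, a morphism from the object presented by \<open>h\<close>
    to \<open>FO y (Dom C f)\<close> amounts to a morphism \<open>s\<close> of \<open>C\<close> with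
    \<open>s \<cdot> h = 0\<close>.\<close>
  obtain s where s: "s \<in> Mor C" "Dom C s = Cod C h" "Cod C s = Dom C f" "FM y s = t \<cdot>\<^bsub>R\<^esub> d"
    using full[of "Cod C h" "Dom C f" "t \<cdot>\<^bsub>R\<^esub> d"] t h k' by (auto simp: Hom_def)
  have "FM y (f \<cdot> s) = Zer R (FO y (Dom C s)) (FO y (Cod C f))"
    using R.Comp_eq_extend[OF t(3), of d] s k' t h by simp
  then have "f \<cdot> s = Zer C (Cod C h) (Cod C f)" using eq_ZerI[of "f \<cdot> s"] s k' by simp
  then obtain w where w: "w \<in> Mor C" "Dom C w = Cod C h" "Cod C w = Dom C k" "k \<cdot> w = s"
    using C.is_kernel_factor[OF k, of s "Cod C h"] s by (auto simp: Hom_def)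
  have "FM y (s \<cdot> h) = Zer R (FO y (Dom C h)) (FO y (Dom C f))"
    using h t k' s by simp
  then have sh: "s \<cdot> h = Zer C (Dom C h) (Dom C f)" using eq_ZerI[of "s \<cdot> h"] s h by simp
  have "k \<cdot> (w \<cdot> h) = k \<cdot> Zer C (Dom C h) (Dom C k)"
    using C.Comp_eq_extend[OF w(4), of h] sh w k' h by simp
  then have "w \<cdot> h = Zer C (Dom C h) (Dom C k)"
    using C.is_kernel_mono[OF k, of "w \<cdot> h" "Dom C h"] w h k' by (simp add: Hom_def)
  then have "FM y w \<cdot>\<^bsub>R\<^esub> FM y h = Zer R (FO y (Dom C h)) (FO y (Dom C k))"
    using functor_Comp_eq[of w h "Zer C (Dom C h) (Dom C k)"] w h k' by simp
  then obtain u where u: "u \<in> Mor R" "Dom R u = Dom R t" "Cod R u = FO y (Dom C k)"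
    "u \<cdot>\<^bsub>R\<^esub> d = FM y w"
    using induced[OF h(2), of "FM y w"] h w by auto
  have "FM y k \<cdot>\<^bsub>R\<^esub> u = t"
    by (rule R.is_cokernel_cancel[OF h(2)])
      (use u k' t h s(1-3) functor_Comp_eq[OF w(4)] s(4) w(1-3) in auto)
  then show "\<exists>u. u \<in> Hom R (Dom R t) (Dom R (FM y k)) \<and> FM y k \<cdot>\<^bsub>R\<^esub> u = t"
    using u k' by (auto simp: Hom_def)
next
  note k' = C.is_kernelD[OF k]
  fix u assume u: "u \<in> Mor R" "Cod R u = Dom R (FM y k)" "FM y k \<cdot>\<^bsub>R\<^esub> u = Zer R (Dom R u) (Cod R (FM y k))"
  obtain h d where h: "h \<in> Mor C" "is_cokernel R (FM y h) d" "d \<in> Mor R" "Dom R d = FO y (Cod C h)"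
    "Cod R d = Dom R u" "d \<cdot>\<^bsub>R\<^esub> FM y h = Zer R (FO y (Dom C h)) (Dom R u)"
    using presentation[of "Dom R u"] u by auto
  obtain w where w: "w \<in> Mor C" "Dom C w = Cod C h" "Cod C w = Dom C k" "FM y w = u \<cdot>\<^bsub>R\<^esub> d"
    using full[of "Cod C h" "Dom C k" "u \<cdot>\<^bsub>R\<^esub> d"] u h k' by (auto simp: Hom_def)
  have "FM y (k \<cdot> w) = Zer R (FO y (Cod C h)) (FO y (Cod C k))"
    using R.Comp_eq_extend[OF u(3), of d] w k' u h by simp
  then have "k \<cdot> w = k \<cdot> Zer C (Cod C h) (Dom C k)" using eq_ZerI[of "k \<cdot> w"] w k' h by simp
  then have "w = Zer C (Cod C h) (Dom C k)"
    using C.is_kernel_mono[OF k, of w "Cod C h" "Zer C (Cod C h) (Dom C k)"] w h k'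
    by (simp add: Hom_def)
  then have "FM y w = Zer R (FO y (Cod C h)) (FO y (Dom C k))" using h k' by simp
  then have "u \<cdot>\<^bsub>R\<^esub> d = Zer R (Dom R u) (Cod R u) \<cdot>\<^bsub>R\<^esub> d" using w u h k' by simp
  then have "u = Zer R (Dom R u) (Cod R u)"
    by (rule R.is_cokernel_cancel[OF h(2), rotated -1]) (use u h k' in auto)
  then show "u = Zer R (Dom R u) (Dom R (FM y k))" using u by simp
qed

text \<open>With \<open>s\<close> lifting \<phi> to generators, the kernel is presented by two
  successive weak pullbacks in \<open>C\<close>: one finds its generators, the other the relations
  among them.\<close>

lemma has_kernel:
  assumes ker: "\<And>f. f \<in> Mor C \<Longrightarrow> \<exists>k. is_kernel C f k" and \<phi>: "\<phi> \<in> Mor R"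
  shows "\<exists>k. is_kernel R \<phi> k"
proof -
  obtain f c where f: "f \<in> Mor C" "is_cokernel R (FM y f) c" "c \<in> Mor R" "Dom R c = FO y (Cod C f)"
    "Cod R c = Dom R \<phi>" "c \<cdot>\<^bsub>R\<^esub> FM y f = Zer R (FO y (Dom C f)) (Dom R \<phi>)"
    using presentation[of "Dom R \<phi>"] \<phi> by auto
  obtain g d where g: "g \<in> Mor C" "is_cokernel R (FM y g) d" "d \<in> Mor R" "Dom R d = FO y (Cod C g)"
    "Cod R d = Cod R \<phi>" "d \<cdot>\<^bsub>R\<^esub> FM y g = Zer R (FO y (Dom C g)) (Cod R \<phi>)"
    using presentation[of "Cod R \<phi>"] \<phi> by auto
  obtain s where s: "s \<in> Mor C" "Dom C s = Cod C f" "Cod C s = Cod C g"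
    "d \<cdot>\<^bsub>R\<^esub> FM y s = \<phi> \<cdot>\<^bsub>R\<^esub> c"
    by (rule lift[OF g(1,2), of "Cod C f" "\<phi> \<cdot>\<^bsub>R\<^esub> c"]) (use \<phi> f g in auto)
  \<comment> \<open>Generators: what maps under \<open>s\<close> into the image of \<open>g\<close>
    dies in \<open>Cod R \<phi>\<close>, and conversely by \<open>factor\<close>.\<close>
  obtain u v where uv: "u \<in> Mor C" "v \<in> Mor C" "Dom C u = Dom C v" "Cod C u = Cod C f"
    "Cod C v = Dom C g" "s \<cdot> u = g \<cdot> v"
    and pb: "\<forall>a \<in> Mor C. \<forall>b \<in> Mor C. Dom C a = Dom C b \<and> Cod C a = Cod C f \<and> Cod C b = Dom C g \<and>
      s \<cdot> a = g \<cdot> b \<longrightarrow> (\<exists>w \<in> Mor C. Dom C w = Dom C a \<and> Cod C w = Dom C u \<and> u \<cdot> w = a)"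
    by (rule C.weak_pullback[OF ker s(1) g(1) s(3), unfolded s(2)])
  \<comment> \<open>Relations: the combinations of these generators that \<open>u\<close> sends into
    the image of \<open>f\<close>, hence to zero in \<open>Dom R \<phi>\<close>.\<close>
  obtain u' v' where uv': "u' \<in> Mor C" "v' \<in> Mor C" "Dom C u' = Dom C v'" "Cod C u' = Dom C u"
    "Cod C v' = Dom C f" "u \<cdot> u' = f \<cdot> v'"
    and pb': "\<forall>a \<in> Mor C. \<forall>b \<in> Mor C. Dom C a = Dom C b \<and> Cod C a = Dom C u \<and> Cod C b = Dom C f \<and>
      u \<cdot> a = f \<cdot> b \<longrightarrow> (\<exists>w \<in> Mor C. Dom C w = Dom C a \<and> Cod C w = Dom C u' \<and> u' \<cdot> w = a)"
    by (rule C.weak_pullback[OF ker uv(1) f(1) uv(4)])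
  obtain e where e: "is_cokernel R (FM y u') e" using ex_cokernel uv' by blast
  note e' = R.is_cokernelD[OF e]
  obtain \<kappa> where \<kappa>: "\<kappa> \<in> Mor R" "Dom R \<kappa> = Cod R e" "Cod R \<kappa> = Dom R \<phi>"
    "\<kappa> \<cdot>\<^bsub>R\<^esub> e = c \<cdot>\<^bsub>R\<^esub> FM y u"
  proof (rule induced[OF e, of "c \<cdot>\<^bsub>R\<^esub> FM y u"])
    have "(c \<cdot>\<^bsub>R\<^esub> FM y u) \<cdot>\<^bsub>R\<^esub> FM y u' = (c \<cdot>\<^bsub>R\<^esub> FM y f) \<cdot>\<^bsub>R\<^esub> FM y v'"
      using functor_Comp_eq[OF uv'(6)] uv' uv f(1,3-5) by simp
    also have "\<dots> = Zer R (FO y (Dom C u')) (Dom R \<phi>)" unfolding f(6) using uv' f(1,3-5) \<phi> by simp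
    finally show "(c \<cdot>\<^bsub>R\<^esub> FM y u) \<cdot>\<^bsub>R\<^esub> FM y u' = Zer R (Dom R (FM y u')) (Cod R (c \<cdot>\<^bsub>R\<^esub> FM y u))"
      using uv' uv f by simp
  qed (use f uv uv' in auto)
  \<comment> \<open>This is the injectivity of \<kappa> on maps from objects of \<open>C\<close>:
    what dies in \<open>Dom R \<phi>\<close> factors through the relations \<open>u'\<close>, so
    \<open>e\<close> already kills it.\<close>
  have sub: "e \<cdot>\<^bsub>R\<^esub> FM y a = Zer R (FO y (Dom C a)) (Cod R e)"
    if a: "a \<in> Mor C" "Cod C a = Dom C u" "c \<cdot>\<^bsub>R\<^esub> (FM y u \<cdot>\<^bsub>R\<^esub> FM y a) = Zer R (FO y (Dom C a)) (Dom R \<phi>)"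
    for a
  proof -
    obtain z where z: "z \<in> Mor C" "Dom C z = Dom C a" "Cod C z = Dom C f" "f \<cdot> z = u \<cdot> a"
      using factor[OF f(1,2), of "u \<cdot> a"] a uv f by auto
    obtain r where r: "r \<in> Mor C" "Dom C r = Dom C a" "Cod C r = Dom C u'" "u' \<cdot> r = a"
      using pb'[rule_format, of a z] z a by auto
    show ?thesis
      using R.Comp_eq_extend[OF e'(4), of "FM y r"] functor_Comp_eq[OF r(4)] r uv' e' by simp
  qed
  have "is_kernel R \<phi> \<kappa>"
  proof (rule R.is_kernelI)
    show "\<phi> \<cdot>\<^bsub>R\<^esub> \<kappa> = Zer R (Dom R \<kappa>) (Cod R \<phi>)"
    proof (rule R.is_cokernel_cancel[OF e])
      have "(\<phi> \<cdot>\<^bsub>R\<^esub> \<kappa>) \<cdot>\<^bsub>R\<^esub> e = (\<phi> \<cdot>\<^bsub>R\<^esub> c) \<cdot>\<^bsub>R\<^esub> FM y u"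
        using \<kappa> \<phi> f uv uv' e' by simp
      also have "\<dots> = (d \<cdot>\<^bsub>R\<^esub> FM y s) \<cdot>\<^bsub>R\<^esub> FM y u" using s(4) by simp
      also have "\<dots> = (d \<cdot>\<^bsub>R\<^esub> FM y g) \<cdot>\<^bsub>R\<^esub> FM y v"
        using functor_Comp_eq[OF uv(6)] s(1-3) g(1,3-5) uv by simp
      also have "\<dots> = Zer R (Dom R \<kappa>) (Cod R \<phi>) \<cdot>\<^bsub>R\<^esub> e"
        unfolding g(6) using uv g(1,3-5) \<phi> e' uv' \<kappa>(1-3) by simp
      finally show "(\<phi> \<cdot>\<^bsub>R\<^esub> \<kappa>) \<cdot>\<^bsub>R\<^esub> e = Zer R (Dom R \<kappa>) (Cod R \<phi>) \<cdot>\<^bsub>R\<^esub> e" .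
    qed (use \<kappa> \<phi> e' in auto)
  next
    fix t assume t: "t \<in> Mor R" "Cod R t = Dom R \<phi>" "\<phi> \<cdot>\<^bsub>R\<^esub> t = Zer R (Dom R t) (Cod R \<phi>)"
    obtain h b where h: "h \<in> Mor C" "is_cokernel R (FM y h) b" "b \<in> Mor R" "Dom R b = FO y (Cod C h)"
      "Cod R b = Dom R t" "b \<cdot>\<^bsub>R\<^esub> FM y h = Zer R (FO y (Dom C h)) (Dom R t)"
      using presentation[of "Dom R t"] t by auto
    obtain a where a: "a \<in> Mor C" "Dom C a = Cod C h" "Cod C a = Cod C f" "c \<cdot>\<^bsub>R\<^esub> FM y a = t \<cdot>\<^bsub>R\<^esub> b"
      by (rule lift[OF f(1,2), of "Cod C h" "t \<cdot>\<^bsub>R\<^esub> b"]) (use t h f in auto)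
    \<comment> \<open>On generators of \<open>Dom R t\<close> the composite with \<phi> vanishes, so
      \<open>s \<cdot> a\<close> factors through \<open>g\<close>, and therefore \<open>a\<close>
      through the first pullback. The map \<open>n\<close> then descends to \<open>Dom R t\<close>
      by \<open>sub\<close>.\<close>
    have "d \<cdot>\<^bsub>R\<^esub> FM y (s \<cdot> a) = (d \<cdot>\<^bsub>R\<^esub> FM y s) \<cdot>\<^bsub>R\<^esub> FM y a" using a(1-3) s(1-3) g by simp
    also have "\<dots> = \<phi> \<cdot>\<^bsub>R\<^esub> (c \<cdot>\<^bsub>R\<^esub> FM y a)" unfolding s(4) using a(1-3) \<phi> f by simp
    also have "\<dots> = Zer R (FO y (Dom C (s \<cdot> a))) (Cod R d)"
      unfolding a(4) using R.Comp_eq_extend[OF t(3), of b] t h \<phi> g a(1-3) s(1-3) by simp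
    finally obtain z where z: "z \<in> Mor C" "Dom C z = Dom C a" "Cod C z = Dom C g" "g \<cdot> z = s \<cdot> a"
      using factor[OF g(1,2), of "s \<cdot> a"] a(1-3) s(1-3) by auto
    obtain w where w: "w \<in> Mor C" "Dom C w = Dom C a" "Cod C w = Dom C u" "u \<cdot> w = a"
      using pb[rule_format, of a z] z a by auto
    have uw: "FM y u \<cdot>\<^bsub>R\<^esub> FM y w = FM y a" using functor_Comp_eq[OF w(4)] w uv by simp
    have "c \<cdot>\<^bsub>R\<^esub> (FM y u \<cdot>\<^bsub>R\<^esub> FM y (w \<cdot> h)) = (c \<cdot>\<^bsub>R\<^esub> FM y a) \<cdot>\<^bsub>R\<^esub> FM y h"
      using R.Comp_eq_extend[OF uw, of "FM y h"] w(1-3) h a(1-3) uv f by simp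
    also have "\<dots> = Zer R (FO y (Dom C (w \<cdot> h))) (Dom R \<phi>)"
      unfolding a(4) using h t a(1-3) w(1-3) by simp
    finally have "e \<cdot>\<^bsub>R\<^esub> FM y (w \<cdot> h) = Zer R (FO y (Dom C h)) (Cod R e)"
      using sub[of "w \<cdot> h"] w(1-3) a(1-3) h by simp
    then have "(e \<cdot>\<^bsub>R\<^esub> FM y w) \<cdot>\<^bsub>R\<^esub> FM y h = Zer R (FO y (Dom C h)) (Cod R e)"
      using w(1-3) a(1-3) h e' uv' by simp
    then obtain n where n: "n \<in> Mor R" "Dom R n = Dom R t" "Cod R n = Cod R e"
      "n \<cdot>\<^bsub>R\<^esub> b = e \<cdot>\<^bsub>R\<^esub> FM y w"
      using induced[OF h(2), of "e \<cdot>\<^bsub>R\<^esub> FM y w"] h w(1-3) a(1-3) e' uv' by auto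
    have "\<kappa> \<cdot>\<^bsub>R\<^esub> n = t"
    proof (rule R.is_cokernel_cancel[OF h(2)])
      have "(\<kappa> \<cdot>\<^bsub>R\<^esub> n) \<cdot>\<^bsub>R\<^esub> b = \<kappa> \<cdot>\<^bsub>R\<^esub> (e \<cdot>\<^bsub>R\<^esub> FM y w)" using n \<kappa>(1-3) h by simp
      also have "\<dots> = c \<cdot>\<^bsub>R\<^esub> (FM y u \<cdot>\<^bsub>R\<^esub> FM y w)"
        using R.Comp_eq_extend[OF \<kappa>(4), of "FM y w"] \<kappa>(1-3) w(1-3) e' uv uv' f by simp
      finally show "(\<kappa> \<cdot>\<^bsub>R\<^esub> n) \<cdot>\<^bsub>R\<^esub> b = t \<cdot>\<^bsub>R\<^esub> b" using uw a(4) by simp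
    qed (use \<kappa> n t h in auto)
    then show "\<exists>n. n \<in> Hom R (Dom R t) (Dom R \<kappa>) \<and> \<kappa> \<cdot>\<^bsub>R\<^esub> n = t"
      using n \<kappa> by (auto simp: Hom_def)
  next
    fix n assume n: "n \<in> Mor R" "Cod R n = Dom R \<kappa>" "\<kappa> \<cdot>\<^bsub>R\<^esub> n = Zer R (Dom R n) (Cod R \<kappa>)"
    obtain h b where h: "h \<in> Mor C" "is_cokernel R (FM y h) b" "b \<in> Mor R" "Dom R b = FO y (Cod C h)"
      "Cod R b = Dom R n" "b \<cdot>\<^bsub>R\<^esub> FM y h = Zer R (FO y (Dom C h)) (Dom R n)"
      using presentation[of "Dom R n"] n by auto
    obtain w where w: "w \<in> Mor C" "Dom C w = Cod C h" "Cod C w = Dom C u" "e \<cdot>\<^bsub>R\<^esub> FM y w = n \<cdot>\<^bsub>R\<^esub> b"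
      using lift[OF uv'(1) e, of "Cod C h" "n \<cdot>\<^bsub>R\<^esub> b"] n h \<kappa> uv' by auto
    have "c \<cdot>\<^bsub>R\<^esub> (FM y u \<cdot>\<^bsub>R\<^esub> FM y w) = \<kappa> \<cdot>\<^bsub>R\<^esub> (e \<cdot>\<^bsub>R\<^esub> FM y w)"
      using R.Comp_eq_extend[OF \<kappa>(4), of "FM y w"] \<kappa>(1-3) w(1-3) e' uv uv' f by simp
    also have "\<dots> = Zer R (FO y (Dom C w)) (Dom R \<phi>)"
      unfolding w(4) using R.Comp_eq_extend[OF n(3), of b] n h \<kappa>(1-3) \<phi> w(1-3) by simp
    finally have "n \<cdot>\<^bsub>R\<^esub> b = Zer R (Dom R n) (Dom R \<kappa>) \<cdot>\<^bsub>R\<^esub> b"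
      using sub[of w] w n h \<kappa>(1-3) e' by simp
    then show "n = Zer R (Dom R n) (Dom R \<kappa>)"
      by (rule R.is_cokernel_cancel[OF h(2), rotated -1]) (use n h \<kappa> e' in auto)
  qed (use \<kappa> \<phi> in auto)
  then show ?thesis by blast
qed

end

section \<open>Abelian groups and functor categories\<close>

lemma Ab_simps [simp]:
  "Ob Ab = {G. comm_group G}" "Dom Ab = ab_src" "Cod Ab = ab_tgt"
  "a \<in> Mor Ab \<longleftrightarrow> comm_group (ab_src a) \<and> comm_group (ab_tgt a) \<and>
     ab_map a \<in> hom (ab_src a) (ab_tgt a) \<and> ab_map a \<in> extensional (carrier (ab_src a))"
  "Idn Ab G = Ab_Mor G (\<lambda>x \<in> carrier G. x) G"
  "b \<cdot>\<^bsub>Ab\<^esub> a = Ab_Mor (ab_src a) (\<lambda>x \<in> carrier (ab_src a). ab_map b (ab_map a x)) (ab_tgt b)"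
  "Add Ab a b = Ab_Mor (ab_src a)
     (\<lambda>x \<in> carrier (ab_src a). ab_map a x \<otimes>\<^bsub>ab_tgt a\<^esub> ab_map b x) (ab_tgt a)"
  "Zer Ab G H = Ab_Mor G (\<lambda>x \<in> carrier G. \<one>\<^bsub>H\<^esub>) H"
  by (auto simp: Ab_def)

lemma ab_mor_eqI:
  assumes "a \<in> Mor Ab" "b \<in> Mor Ab" "ab_src a = ab_src b" "ab_tgt a = ab_tgt b"
    "\<And>x. x \<in> carrier (ab_src a) \<Longrightarrow> ab_map a x = ab_map b x"
  shows "a = b"
  using assms by (auto intro!: ab_mor.expand extensionalityI)

lemma comm_groupD: "comm_group G \<Longrightarrow> group G"
  by (simp add: comm_group_def)

lemma hom_restrictI:
  assumes "group G" "\<And>x. x \<in> carrier G \<Longrightarrow> h x \<in> carrier H"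
    "\<And>x x'. \<lbrakk>x \<in> carrier G; x' \<in> carrier G\<rbrakk> \<Longrightarrow> h (x \<otimes>\<^bsub>G\<^esub> x') = h x \<otimes>\<^bsub>H\<^esub> h x'"
  shows "(\<lambda>x \<in> carrier G. h x) \<in> hom G H"
proof -
  interpret group G by fact
  show ?thesis using assms by (auto simp: hom_def)
qed

lemma Ab_preadditive: "preadditive_category (Ab :: ('g monoid, 'g ab_mor) cat)"
proof (intro preadditive_category.intro preadditive_category_axioms.intro category.intro)
  fix X Y :: "'g monoid" and f g assume f: "f \<in> Hom Ab X Y"
  show "f \<cdot>\<^bsub>Ab\<^esub> Idn Ab X = f" "Idn Ab Y \<cdot>\<^bsub>Ab\<^esub> f = f"
    using f by (cases f; force simp: Hom_def hom_def extensional_def Pi_def)+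
  fix Z assume g: "g \<in> Hom Ab Y Z"
  have "group X" using f by (auto simp: Hom_def comm_groupD)
  then show "g \<cdot>\<^bsub>Ab\<^esub> f \<in> Hom Ab X Z"
    using f g by (auto simp: Hom_def hom_def Pi_def group.is_monoid monoid.m_closed)
  fix h W assume "h \<in> Hom Ab Z W"
  then show "h \<cdot>\<^bsub>Ab\<^esub> (g \<cdot>\<^bsub>Ab\<^esub> f) = (h \<cdot>\<^bsub>Ab\<^esub> g) \<cdot>\<^bsub>Ab\<^esub> f"
    using f g by (auto simp: Hom_def hom_def Pi_def intro!: restrict_ext)
next
  fix X :: "'g monoid" assume "X \<in> Ob Ab"
  then show "Idn Ab X \<in> Hom Ab X X"
    by (auto simp: Hom_def intro!: hom_restrictI comm_groupD)
next
  fix X Y :: "'g monoid" assume XY: "X \<in> Ob Ab" "Y \<in> Ob Ab"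
  interpret X: comm_group X using XY by simp
  interpret Y: comm_group Y using XY by simp
  show "comm_group (hom_group Ab X Y)"
  proof (rule comm_groupI; unfold hom_group_def partial_object.simps monoid.simps)
    fix x y assume x: "x \<in> Hom Ab X Y" and y: "y \<in> Hom Ab X Y"
    have m: "ab_map x a \<in> carrier Y" "ab_map y a \<in> carrier Y" if "a \<in> carrier X" for a
      using x y that by (auto simp: Hom_def hom_def)
    have src: "ab_src x = X" "ab_tgt x = Y" "ab_src y = X" "ab_tgt y = Y"
      "ab_map x \<in> hom X Y" "ab_map y \<in> hom X Y"
      using x y by (auto simp: Hom_def)
    \<comment> \<open>Commutativity of \<open>Y\<close> is what makes a pointwise product of
      homomorphisms a homomorphism.\<close>
    have "(\<lambda>a \<in> carrier X. ab_map x a \<otimes>\<^bsub>Y\<^esub> ab_map y a) \<in> hom X Y"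
      by (rule hom_restrictI) (simp_all add: m Y.m_ac X.is_group src hom_mult[OF src(5)] hom_mult[OF src(6)])
    then show "Add Ab x y \<in> Hom Ab X Y"
      using XY by (simp add: Hom_def src)
    show "Add Ab x y = Add Ab y x"
      by (auto simp: src m Y.m_comm intro!: restrict_ext)
    show "\<exists>y\<in>Hom Ab X Y. Add Ab y x = Zer Ab X Y"
    proof (rule bexI[of _ "Ab_Mor X (\<lambda>a \<in> carrier X. inv\<^bsub>Y\<^esub> ab_map x a) Y"])
      have "(\<lambda>a \<in> carrier X. inv\<^bsub>Y\<^esub> ab_map x a) \<in> hom X Y"
        by (rule hom_restrictI) (simp_all add: m Y.inv_mult X.is_group hom_mult[OF src(5)])
      then show "Ab_Mor X (\<lambda>a \<in> carrier X. inv\<^bsub>Y\<^esub> ab_map x a) Y \<in> Hom Ab X Y"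
        using XY by (simp add: Hom_def)
    qed (auto simp: src m intro!: restrict_ext)
    show "Add Ab (Zer Ab X Y) x = x"
      using x by (auto simp: src m Hom_def intro!: ab_mor.expand extensionalityI[of _ "carrier X"])
    fix z assume z: "z \<in> Hom Ab X Y"
    then have "ab_map z a \<in> carrier Y" if "a \<in> carrier X" for a
      using that by (auto simp: Hom_def hom_def)
    then show "Add Ab (Add Ab x y) z = Add Ab x (Add Ab y z)"
      by (auto simp: src m Y.m_assoc intro!: restrict_ext)
  next
    show "Zer Ab X Y \<in> Hom Ab X Y"
      by (auto simp: Hom_def intro!: hom_restrictI X.comm_group_axioms Y.comm_group_axioms)
  qed
next
  fix X Y Z :: "'g monoid" and f g h
  assume fgh: "f \<in> Hom Ab X Y" "g \<in> Hom Ab X Y" "h \<in> Hom Ab Y Z"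
  then show "h \<cdot>\<^bsub>Ab\<^esub> Add Ab f g = Add Ab (h \<cdot>\<^bsub>Ab\<^esub> f) (h \<cdot>\<^bsub>Ab\<^esub> g)"
    by (auto simp: Hom_def hom_def Pi_def intro!: restrict_ext)
next
  fix X Y Z :: "'g monoid" and f g h
  assume fgh: "h \<in> Hom Ab X Y" "f \<in> Hom Ab Y Z" "g \<in> Hom Ab Y Z"
  then show "Add Ab f g \<cdot>\<^bsub>Ab\<^esub> h = Add Ab (f \<cdot>\<^bsub>Ab\<^esub> h) (g \<cdot>\<^bsub>Ab\<^esub> h)"
    by (auto simp: Hom_def hom_def Pi_def intro!: restrict_ext)
qed auto

section \<open>Functor categories\<close>

lemma fun_cat_simps [simp]:
  "Ob (fun_cat C E) = ftor_set C E" "Dom (fun_cat C E) = ft_src" "Cod (fun_cat C E) = ft_tgt"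
  "a \<in> Mor (fun_cat C E) \<longleftrightarrow> ft_src a \<in> ftor_set C E \<and> ft_tgt a \<in> ftor_set C E \<and>
     nat_trans C E (ft_src a) (ft_tgt a) (ft_cmp a) \<and> ft_cmp a \<in> extensional (Ob C)"
  "Idn (fun_cat C E) F = Ftor_Mor F (\<lambda>X \<in> Ob C. Idn E (FO F X)) F"
  "b \<cdot>\<^bsub>fun_cat C E\<^esub> a = Ftor_Mor (ft_src a) (\<lambda>X \<in> Ob C. ft_cmp b X \<cdot>\<^bsub>E\<^esub> ft_cmp a X) (ft_tgt b)"
  "Add (fun_cat C E) a b =
     Ftor_Mor (ft_src a) (\<lambda>X \<in> Ob C. Add E (ft_cmp a X) (ft_cmp b X)) (ft_tgt a)"
  "Zer (fun_cat C E) F G = Ftor_Mor F (\<lambda>X \<in> Ob C. Zer E (FO F X) (FO G X)) G"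
  by (auto simp: fun_cat_def)

lemma ftor_mor_eqI:
  assumes "ft_src a = ft_src b" "ft_tgt a = ft_tgt b"
    "ft_cmp a \<in> extensional S" "ft_cmp b \<in> extensional S" "\<And>X. X \<in> S \<Longrightarrow> ft_cmp a X = ft_cmp b X"
  shows "a = b"
  using assms by (auto intro!: ftor_mor.expand extensionalityI)

lemma ftor_setD: "F \<in> ftor_set C E \<Longrightarrow> is_functor C E F"
  by (simp add: ftor_set_def)

lemma nat_transD:
  assumes "nat_trans C D F G t"
  shows "X \<in> Ob C \<Longrightarrow> t X \<in> Mor D" "X \<in> Ob C \<Longrightarrow> Dom D (t X) = FO F X"
    "X \<in> Ob C \<Longrightarrow> Cod D (t X) = FO G X"
    "f \<in> Mor C \<Longrightarrow> t (Cod C f) \<cdot>\<^bsub>D\<^esub> FM F f = FM G f \<cdot>\<^bsub>D\<^esub> t (Dom C f)"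
  using assms by (auto simp: nat_trans_def Hom_def)

lemma nat_transI:
  assumes "\<And>X. X \<in> Ob C \<Longrightarrow> t X \<in> Mor D \<and> Dom D (t X) = FO F X \<and> Cod D (t X) = FO G X"
    "\<And>f. f \<in> Mor C \<Longrightarrow> t (Cod C f) \<cdot>\<^bsub>D\<^esub> FM F f = FM G f \<cdot>\<^bsub>D\<^esub> t (Dom C f)"
  shows "nat_trans C D F G t"
  using assms by (auto simp: nat_trans_def Hom_def)

text \<open>All operations are pointwise, so the algebraic laws come from \<open>E\<close>; what
  needs proof is that each pointwise operation preserves naturality.\<close>

lemma fun_cat_preadditive:
  assumes "category C" "preadditive_category E"
  shows "preadditive_category (fun_cat C E)"
proof -
  interpret C: category C by fact
  interpret E: preadditive_category E by fact
  have comp: "nat_trans C E F K (\<lambda>X \<in> Ob C. t X \<cdot>\<^bsub>E\<^esub> s X)"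
    if F: "is_functor C E F" "is_functor C E G" "is_functor C E K"
      and s: "nat_trans C E F G s" and t: "nat_trans C E G K t" for F G K s t
  proof (rule nat_transI)
    fix f assume f: "f \<in> Mor C"
    note simps = is_functorD(1-4)[OF F(1)] is_functorD(1-4)[OF F(2)] is_functorD(1-4)[OF F(3)]
      nat_transD(1-3)[OF s] nat_transD(1-3)[OF t]
    have "(t (Cod C f) \<cdot>\<^bsub>E\<^esub> s (Cod C f)) \<cdot>\<^bsub>E\<^esub> FM F f = (t (Cod C f) \<cdot>\<^bsub>E\<^esub> FM G f) \<cdot>\<^bsub>E\<^esub> s (Dom C f)"
      using f nat_transD(4)[OF s f] by (simp add: simps)
    also have "\<dots> = FM K f \<cdot>\<^bsub>E\<^esub> (t (Dom C f) \<cdot>\<^bsub>E\<^esub> s (Dom C f))"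
      unfolding nat_transD(4)[OF t f] using f by (simp add: simps)
    finally show "(\<lambda>X \<in> Ob C. t X \<cdot>\<^bsub>E\<^esub> s X) (Cod C f) \<cdot>\<^bsub>E\<^esub> FM F f
        = FM K f \<cdot>\<^bsub>E\<^esub> (\<lambda>X \<in> Ob C. t X \<cdot>\<^bsub>E\<^esub> s X) (Dom C f)"
      using f by simp
  qed (use is_functorD[OF F(1)] nat_transD[OF s] nat_transD[OF t] in simp)
  have zero: "nat_trans C E F G (\<lambda>X \<in> Ob C. Zer E (FO F X) (FO G X))"
    if F: "is_functor C E F" "is_functor C E G" for F G
    by (rule nat_transI) (use is_functorD[OF F(1)] is_functorD[OF F(2)] in simp_all)
  have add: "nat_trans C E F G (\<lambda>X \<in> Ob C. Add E (s X) (t X))"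
    if F: "is_functor C E F" "is_functor C E G"
      and s: "nat_trans C E F G s" and t: "nat_trans C E F G t" for F G s t
    by (rule nat_transI)
      (use is_functorD(1-4)[OF F(1)] is_functorD(1-4)[OF F(2)] nat_transD[OF s] nat_transD[OF t]
        in simp_all)
  have neg: "nat_trans C E F G (\<lambda>X \<in> Ob C. Neg E (s X))"
    if F: "is_functor C E F" "is_functor C E G" and s: "nat_trans C E F G s" for F G s
    by (rule nat_transI)
      (use is_functorD(1-4)[OF F(1)] is_functorD(1-4)[OF F(2)] nat_transD[OF s] in simp_all)
  have idn: "nat_trans C E F F (\<lambda>X \<in> Ob C. Idn E (FO F X))" if F: "is_functor C E F" for F
    by (rule nat_transI) (use is_functorD[OF F(1)] in simp_all)
  note nt = nat_transD(1-3)
  show ?thesis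
  proof (intro preadditive_category.intro preadditive_category_axioms.intro category.intro)
    fix X Y f g assume f: "f \<in> Hom (fun_cat C E) X Y"
    then have f': "nat_trans C E X Y (ft_cmp f)" "ft_src f = X" "ft_tgt f = Y"
      "is_functor C E X" "is_functor C E Y" "ft_cmp f \<in> extensional (Ob C)"
      by (auto simp: Hom_def ftor_setD)
    show "f \<cdot>\<^bsub>fun_cat C E\<^esub> Idn (fun_cat C E) X = f" "Idn (fun_cat C E) Y \<cdot>\<^bsub>fun_cat C E\<^esub> f = f"
      by (rule ftor_mor_eqI[of _ _ "Ob C"]; use f' nt[OF f'(1)] in simp)+
    fix Z assume g: "g \<in> Hom (fun_cat C E) Y Z"
    then have g': "nat_trans C E Y Z (ft_cmp g)" "ft_src g = Y" "ft_tgt g = Z" "is_functor C E Z"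
      "ft_cmp g \<in> extensional (Ob C)"
      by (auto simp: Hom_def ftor_setD)
    show "g \<cdot>\<^bsub>fun_cat C E\<^esub> f \<in> Hom (fun_cat C E) X Z"
      using f g comp[OF _ _ _ f'(1) g'(1)] f' g' by (auto simp: Hom_def)
    fix h W assume h: "h \<in> Hom (fun_cat C E) Z W"
    then have h': "nat_trans C E Z W (ft_cmp h)" "ft_src h = Z" "ft_tgt h = W" "is_functor C E W"
      by (auto simp: Hom_def ftor_setD)
    show "h \<cdot>\<^bsub>fun_cat C E\<^esub> (g \<cdot>\<^bsub>fun_cat C E\<^esub> f) = (h \<cdot>\<^bsub>fun_cat C E\<^esub> g) \<cdot>\<^bsub>fun_cat C E\<^esub> f"
      by (rule ftor_mor_eqI[of _ _ "Ob C"])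
        (use f' g' h' nt[OF f'(1)] nt[OF g'(1)] nt[OF h'(1)] in simp_all)
  next
    fix X assume "X \<in> Ob (fun_cat C E)"
    then show "Idn (fun_cat C E) X \<in> Hom (fun_cat C E) X X"
      using idn by (auto simp: Hom_def ftor_setD)
  next
    fix X Y assume XY: "X \<in> Ob (fun_cat C E)" "Y \<in> Ob (fun_cat C E)"
    then have F: "is_functor C E X" "is_functor C E Y" by (auto simp: ftor_setD)
    show "comm_group (hom_group (fun_cat C E) X Y)"
    proof (rule comm_groupI; unfold hom_group_def partial_object.simps monoid.simps)
      show "Zer (fun_cat C E) X Y \<in> Hom (fun_cat C E) X Y" using XY zero F by (simp add: Hom_def)
    next
      fix x y assume x: "x \<in> Hom (fun_cat C E) X Y" and y: "y \<in> Hom (fun_cat C E) X Y"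
      then have xy: "nat_trans C E X Y (ft_cmp x)" "nat_trans C E X Y (ft_cmp y)"
        "ft_src x = X" "ft_tgt x = Y" "ft_src y = X" "ft_tgt y = Y"
        "ft_cmp x \<in> extensional (Ob C)" "ft_cmp y \<in> extensional (Ob C)"
        by (auto simp: Hom_def)
      note m = nt[OF xy(1)] nt[OF xy(2)]
      show "Add (fun_cat C E) x y \<in> Hom (fun_cat C E) X Y"
        using x y add[OF F xy(1,2)] xy by (auto simp: Hom_def)
      show "Add (fun_cat C E) x y = Add (fun_cat C E) y x"
        by (rule ftor_mor_eqI[of _ _ "Ob C"])
          (use m xy in \<open>auto simp: Hom_def intro!: E.Add_commute\<close>)
      show "Add (fun_cat C E) (Zer (fun_cat C E) X Y) x = x"
        by (rule ftor_mor_eqI[of _ _ "Ob C"]) (use m xy in auto)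
      show "\<exists>y\<in>Hom (fun_cat C E) X Y. Add (fun_cat C E) y x = Zer (fun_cat C E) X Y"
      proof (rule bexI[of _ "Ftor_Mor X (\<lambda>A \<in> Ob C. Neg E (ft_cmp x A)) Y"])
        show "Add (fun_cat C E) (Ftor_Mor X (\<lambda>A \<in> Ob C. Neg E (ft_cmp x A)) Y) x
            = Zer (fun_cat C E) X Y"
          by (rule ftor_mor_eqI[of _ _ "Ob C"]) (use m xy in auto)
        show "Ftor_Mor X (\<lambda>A \<in> Ob C. Neg E (ft_cmp x A)) Y \<in> Hom (fun_cat C E) X Y"
          using XY neg[OF F xy(1)] by (simp add: Hom_def)
      qed
      fix z assume z: "z \<in> Hom (fun_cat C E) X Y"
      then have z': "nat_trans C E X Y (ft_cmp z)" "ft_src z = X" "ft_tgt z = Y"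
        by (auto simp: Hom_def)
      show "Add (fun_cat C E) (Add (fun_cat C E) x y) z = Add (fun_cat C E) x (Add (fun_cat C E) y z)"
        by (rule ftor_mor_eqI[of _ _ "Ob C"])
          (use m xy z' nt[OF z'(1)] in \<open>auto simp: Hom_def intro!: E.Add_assoc\<close>)
    qed
  next
    fix X Y Z f g h
    assume fgh: "f \<in> Hom (fun_cat C E) X Y" "g \<in> Hom (fun_cat C E) X Y" "h \<in> Hom (fun_cat C E) Y Z"
    then have fgh': "nat_trans C E X Y (ft_cmp f)" "nat_trans C E X Y (ft_cmp g)"
      "nat_trans C E Y Z (ft_cmp h)"
      "ft_src f = X" "ft_tgt f = Y" "ft_src g = X" "ft_tgt g = Y" "ft_src h = Y" "ft_tgt h = Z"
      by (auto simp: Hom_def)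
    show "h \<cdot>\<^bsub>fun_cat C E\<^esub> Add (fun_cat C E) f g
        = Add (fun_cat C E) (h \<cdot>\<^bsub>fun_cat C E\<^esub> f) (h \<cdot>\<^bsub>fun_cat C E\<^esub> g)"
      by (rule ftor_mor_eqI[of _ _ "Ob C"])
        (use fgh' nt[OF fgh'(1)] nt[OF fgh'(2)] nt[OF fgh'(3)] in auto)
  next
    fix X Y Z f g h
    assume fgh: "h \<in> Hom (fun_cat C E) X Y" "f \<in> Hom (fun_cat C E) Y Z" "g \<in> Hom (fun_cat C E) Y Z"
    then have fgh': "nat_trans C E X Y (ft_cmp h)" "nat_trans C E Y Z (ft_cmp f)"
      "nat_trans C E Y Z (ft_cmp g)"
      "ft_src f = Y" "ft_tgt f = Z" "ft_src g = Y" "ft_tgt g = Z" "ft_src h = X" "ft_tgt h = Y"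
      by (auto simp: Hom_def)
    show "Add (fun_cat C E) f g \<cdot>\<^bsub>fun_cat C E\<^esub> h
        = Add (fun_cat C E) (f \<cdot>\<^bsub>fun_cat C E\<^esub> h) (g \<cdot>\<^bsub>fun_cat C E\<^esub> h)"
      by (rule ftor_mor_eqI[of _ _ "Ob C"])
        (use fgh' nt[OF fgh'(1)] nt[OF fgh'(2)] nt[OF fgh'(3)] in auto)
  qed auto
qed

section \<open>Full subcategories\<close>

lemma full_subcat_simps [simp]:
  "Ob (full_subcat C S) = Ob C \<inter> S" "Dom (full_subcat C S) = Dom C" "Cod (full_subcat C S) = Cod C"
  "Mor (full_subcat C S) = {f \<in> Mor C. Dom C f \<in> S \<and> Cod C f \<in> S}"
  "Idn (full_subcat C S) = Idn C" "g \<cdot>\<^bsub>full_subcat C S\<^esub> f = g \<cdot>\<^bsub>C\<^esub> f"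
  "Add (full_subcat C S) = Add C" "Zer (full_subcat C S) = Zer C"
  by (auto simp: full_subcat_def)

lemma Hom_full_subcat: "Hom (full_subcat C S) X Y = (if X \<in> S \<and> Y \<in> S then Hom C X Y else {})"
  by (auto simp: Hom_def)

lemma (in preadditive_category) full_subcat_preadditive: "preadditive_category (full_subcat C S)"
proof (intro preadditive_category.intro preadditive_category_axioms.intro category.intro)
  fix X Y assume "X \<in> Ob (full_subcat C S)" "Y \<in> Ob (full_subcat C S)"
  then show "comm_group (hom_group (full_subcat C S) X Y)"
    using hom_comm_group[of X Y] by (simp add: hom_group_def Hom_full_subcat)
qed (auto simp: Hom_def)

text \<open>The universal property is tested against fewer objects, with the same morphisms between
  them.\<close>

lemma is_cokernel_full_subcat:
  assumes "is_cokernel C f c" "Dom C f \<in> S" "Cod C f \<in> S" "Cod C c \<in> S"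
  shows "is_cokernel (full_subcat C S) f c"
  using assms unfolding is_cokernel_def by (simp add: Hom_full_subcat)

section \<open>Finitely presented presheaves\<close>

abbreviation psh_map :: "('o, 'm) psh_mor \<Rightarrow> 'o \<Rightarrow> 'm set \<Rightarrow> 'm set" where
  "psh_map a A \<equiv> ab_map (ft_cmp a A)"

abbreviation psh_res :: "('o, 'm) psh \<Rightarrow> 'm \<Rightarrow> 'm set \<Rightarrow> 'm set" where
  "psh_res F f \<equiv> ab_map (FM F f)"

text \<open>Wraps plain maps of sets into the extensional records that \<open>PSh C\<close> demands,
  so that being a presheaf reduces to equations between elements. The map for \<open>f\<close>
  starts at the group over \<open>Cod C f\<close>, by contravariance.\<close>

definition mk_psh ::
  "('o, 'm) cat \<Rightarrow> ('o \<Rightarrow> 'm set monoid) \<Rightarrow> ('m \<Rightarrow> 'm set \<Rightarrow> 'm set) \<Rightarrow> ('o, 'm) psh" where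
  "mk_psh C G r = \<lparr>FO = (\<lambda>A \<in> Ob C. G A),
     FM = (\<lambda>f \<in> Mor C. Ab_Mor (G (Cod C f)) (\<lambda>x \<in> carrier (G (Cod C f)). r f x) (G (Dom C f)))\<rparr>"

definition mk_psh_mor ::
  "('o, 'm) cat \<Rightarrow> ('o, 'm) psh \<Rightarrow> ('o \<Rightarrow> 'm set \<Rightarrow> 'm set) \<Rightarrow> ('o, 'm) psh \<Rightarrow> ('o, 'm) psh_mor" where
  "mk_psh_mor C F t G =
     Ftor_Mor F (\<lambda>A \<in> Ob C. Ab_Mor (FO F A) (\<lambda>x \<in> carrier (FO F A). t A x) (FO G A)) G"

context category
begin

lemma PSh_preadditive: "preadditive_category (PSh C)"
  unfolding PSh_def by (rule fun_cat_preadditive[OF category_op Ab_preadditive])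

interpretation PSh: preadditive_category "PSh C" by (rule PSh_preadditive)

lemma psh_ObD:
  assumes "F \<in> Ob (PSh C)"
  shows "A \<in> Ob C \<Longrightarrow> comm_group (FO F A)"
    and "f \<in> Mor C \<Longrightarrow> psh_res F f \<in> hom (FO F (Cod C f)) (FO F (Dom C f))"
    and "f \<in> Mor C \<Longrightarrow> ab_src (FM F f) = FO F (Cod C f)"
    and "f \<in> Mor C \<Longrightarrow> ab_tgt (FM F f) = FO F (Dom C f)"
proof -
  have F: "is_functor (op_cat C) Ab F" using assms by (simp add: PSh_def ftor_setD)
  note F' = is_functorD[OF F]
  show "A \<in> Ob C \<Longrightarrow> comm_group (FO F A)" using F'(1)[of A] by simp
  show "f \<in> Mor C \<Longrightarrow> ab_src (FM F f) = FO F (Cod C f)"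
    "f \<in> Mor C \<Longrightarrow> ab_tgt (FM F f) = FO F (Dom C f)"
    using F'(3,4)[of f] by simp_all
  then show "f \<in> Mor C \<Longrightarrow> psh_res F f \<in> hom (FO F (Cod C f)) (FO F (Dom C f))"
    using F'(2)[of f] by simp
qed

lemma psh_MorD:
  assumes "a \<in> Hom (PSh C) F G"
  shows "F \<in> Ob (PSh C)" "G \<in> Ob (PSh C)" "ft_src a = F" "ft_tgt a = G"
    and "A \<in> Ob C \<Longrightarrow> psh_map a A \<in> hom (FO F A) (FO G A)"
    and "\<lbrakk>A \<in> Ob C; x \<in> carrier (FO F A)\<rbrakk> \<Longrightarrow> psh_map a A x \<in> carrier (FO G A)"
    and "A \<in> Ob C \<Longrightarrow> ab_src (ft_cmp a A) = FO F A"
    and "A \<in> Ob C \<Longrightarrow> ab_tgt (ft_cmp a A) = FO G A"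
    and "\<lbrakk>f \<in> Mor C; x \<in> carrier (FO F (Cod C f))\<rbrakk>
      \<Longrightarrow> psh_map a (Dom C f) (psh_res F f x) = psh_res G f (psh_map a (Cod C f) x)"
proof -
  show FG: "F \<in> Ob (PSh C)" "G \<in> Ob (PSh C)" and st: "ft_src a = F" "ft_tgt a = G"
    using assms by (auto simp: PSh_def Hom_def)
  have nt: "nat_trans (op_cat C) Ab F G (ft_cmp a)" using assms by (auto simp: PSh_def Hom_def)
  note nt' = nat_transD[OF nt]
  show src: "A \<in> Ob C \<Longrightarrow> ab_src (ft_cmp a A) = FO F A"
    and tgt: "A \<in> Ob C \<Longrightarrow> ab_tgt (ft_cmp a A) = FO G A" for A
    using nt'(2,3)[of A] by simp_all
  show "A \<in> Ob C \<Longrightarrow> psh_map a A \<in> hom (FO F A) (FO G A)"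
    using nt'(1)[of A] src tgt by simp
  then show "\<lbrakk>A \<in> Ob C; x \<in> carrier (FO F A)\<rbrakk> \<Longrightarrow> psh_map a A x \<in> carrier (FO G A)"
    by (auto simp: hom_def)
  show "\<lbrakk>f \<in> Mor C; x \<in> carrier (FO F (Cod C f))\<rbrakk>
      \<Longrightarrow> psh_map a (Dom C f) (psh_res F f x) = psh_res G f (psh_map a (Cod C f) x)"
    using arg_cong[OF nt'(4)[of f], of "\<lambda>t. ab_map t x"] psh_ObD(3)[OF FG(1)] src by simp
qed

lemma psh_mor_eqI:
  assumes "a \<in> Hom (PSh C) F G" "b \<in> Hom (PSh C) F G"
    "\<And>A x. \<lbrakk>A \<in> Ob C; x \<in> carrier (FO F A)\<rbrakk> \<Longrightarrow> psh_map a A x = psh_map b A x"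
  shows "a = b"
proof (rule ftor_mor_eqI[of _ _ "Ob C"])
  note a = psh_MorD[OF assms(1)] and b = psh_MorD[OF assms(2)]
  show "ft_src a = ft_src b" "ft_tgt a = ft_tgt b" using a b by simp_all
  show "ft_cmp a \<in> extensional (Ob C)" "ft_cmp b \<in> extensional (Ob C)"
    using assms by (auto simp: PSh_def Hom_def)
  fix A assume A: "A \<in> Ob C"
  have nt: "nat_trans (op_cat C) Ab F G (ft_cmp a)" "nat_trans (op_cat C) Ab F G (ft_cmp b)"
    using assms by (auto simp: PSh_def Hom_def)
  show "ft_cmp a A = ft_cmp b A"
    by (rule ab_mor_eqI)
      (use A nat_transD(1)[OF nt(1), of A] nat_transD(1)[OF nt(2), of A] a b assms in auto)
qed

lemma psh_map_Comp [simp]: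
  assumes "a \<in> Hom (PSh C) F G" "A \<in> Ob C" "x \<in> carrier (FO F A)"
  shows "psh_map (b \<cdot>\<^bsub>PSh C\<^esub> a) A x = psh_map b A (psh_map a A x)"
  using psh_MorD[OF assms(1)] assms by (simp add: PSh_def)

lemma psh_map_Zer [simp]:
  "\<lbrakk>A \<in> Ob C; x \<in> carrier (FO F A)\<rbrakk> \<Longrightarrow> psh_map (Zer (PSh C) F G) A x = \<one>\<^bsub>FO G A\<^esub>"
  by (simp add: PSh_def)

lemma psh_map_Idn [simp]:
  "\<lbrakk>A \<in> Ob C; x \<in> carrier (FO F A)\<rbrakk> \<Longrightarrow> psh_map (Idn (PSh C) F) A x = x"
  by (simp add: PSh_def)

lemma mk_psh_simps [simp]:
  "A \<in> Ob C \<Longrightarrow> FO (mk_psh C G r) A = G A"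
  "\<lbrakk>f \<in> Mor C; x \<in> carrier (G (Cod C f))\<rbrakk> \<Longrightarrow> psh_res (mk_psh C G r) f x = r f x"
  by (simp_all add: mk_psh_def)

lemma mk_psh_Ob:
  assumes G: "\<And>A. A \<in> Ob C \<Longrightarrow> comm_group (G A)"
    and r: "\<And>f x. \<lbrakk>f \<in> Mor C; x \<in> carrier (G (Cod C f))\<rbrakk> \<Longrightarrow> r f x \<in> carrier (G (Dom C f))"
    and mult: "\<And>f x x'. \<lbrakk>f \<in> Mor C; x \<in> carrier (G (Cod C f)); x' \<in> carrier (G (Cod C f))\<rbrakk>
      \<Longrightarrow> r f (x \<otimes>\<^bsub>G (Cod C f)\<^esub> x') = r f x \<otimes>\<^bsub>G (Dom C f)\<^esub> r f x'"
    and idn: "\<And>A x. \<lbrakk>A \<in> Ob C; x \<in> carrier (G A)\<rbrakk> \<Longrightarrow> r (Idn C A) x = x"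
    and comp: "\<And>f g x. \<lbrakk>f \<in> Mor C; g \<in> Mor C; Cod C f = Dom C g; x \<in> carrier (G (Cod C g))\<rbrakk>
      \<Longrightarrow> r (g \<cdot> f) x = r f (r g x)"
  shows "mk_psh C G r \<in> Ob (PSh C)"
proof -
  have "(\<lambda>x \<in> carrier (G (Cod C f)). r f x) \<in> hom (G (Cod C f)) (G (Dom C f))" if "f \<in> Mor C" for f
    by (rule hom_restrictI) (use that comm_groupD[OF G] r mult in simp_all)
  moreover have "r f x \<in> carrier (G A)"
    if "f \<in> Mor C" "x \<in> carrier (G (Cod C f))" "Dom C f = A" for f x A
    using r that by blast
  ultimately have "is_functor (op_cat C) Ab (mk_psh C G r)"
    unfolding is_functor_def mk_psh_def
    using G idn comp by (auto simp: Hom_def intro!: restrict_ext)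
  then show ?thesis by (simp add: PSh_def ftor_set_def mk_psh_def)
qed

lemma mk_psh_mor_map [simp]:
  "\<lbrakk>A \<in> Ob C; x \<in> carrier (FO F A)\<rbrakk> \<Longrightarrow> psh_map (mk_psh_mor C F t G) A x = t A x"
  by (simp add: mk_psh_mor_def)

lemma mk_psh_mor_Hom:
  assumes FG: "F \<in> Ob (PSh C)" "G \<in> Ob (PSh C)"
    and t: "\<And>A x. \<lbrakk>A \<in> Ob C; x \<in> carrier (FO F A)\<rbrakk> \<Longrightarrow> t A x \<in> carrier (FO G A)"
    and mult: "\<And>A x x'. \<lbrakk>A \<in> Ob C; x \<in> carrier (FO F A); x' \<in> carrier (FO F A)\<rbrakk>
      \<Longrightarrow> t A (x \<otimes>\<^bsub>FO F A\<^esub> x') = t A x \<otimes>\<^bsub>FO G A\<^esub> t A x'"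
    and nat: "\<And>f x. \<lbrakk>f \<in> Mor C; x \<in> carrier (FO F (Cod C f))\<rbrakk>
      \<Longrightarrow> t (Dom C f) (psh_res F f x) = psh_res G f (t (Cod C f) x)"
  shows "mk_psh_mor C F t G \<in> Hom (PSh C) F G"
proof -
  note F = psh_ObD[OF FG(1)] and G = psh_ObD[OF FG(2)]
  have res: "psh_res F f x \<in> carrier (FO F (Dom C f))"
    if "f \<in> Mor C" "x \<in> carrier (FO F (Cod C f))" for f x
    using F(2)[of f] that by (auto simp: hom_def)
  have "(\<lambda>x \<in> carrier (FO F A). t A x) \<in> hom (FO F A) (FO G A)" if "A \<in> Ob C" for A
    by (rule hom_restrictI) (use that comm_groupD[OF F(1)] t mult in simp_all)
  then have "nat_trans (op_cat C) Ab F G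
      (\<lambda>A \<in> Ob C. Ab_Mor (FO F A) (\<lambda>x \<in> carrier (FO F A). t A x) (FO G A))"
    by (intro nat_transI) (use F G res nat in \<open>auto intro!: restrict_ext\<close>)
  then show ?thesis using FG by (simp add: PSh_def mk_psh_mor_def Hom_def)
qed

end

section \<open>Representable presheaves and the Yoneda embedding\<close>

context preadditive_category
begin

interpretation PSh: preadditive_category "PSh C" by (rule PSh_preadditive)

lemma hom_group_simps [simp]:
  "carrier (hom_group C X Y) = Hom C X Y" "f \<otimes>\<^bsub>hom_group C X Y\<^esub> g = Add C f g"
  "\<one>\<^bsub>hom_group C X Y\<^esub> = Zer C X Y"
  by (simp_all add: hom_group_def)

lemma sing_group_simps [simp]:
  "carrier (sing_group C A X) = (\<lambda>f. {f}) ` Hom C A X" "{f} \<otimes>\<^bsub>sing_group C A X\<^esub> {g} = {Add C f g}"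
  "\<one>\<^bsub>sing_group C A X\<^esub> = {Zer C A X}"
  by (simp_all add: sing_group_def)

text \<open>Transport of structure along the bijection sending \<open>f\<close> to
  \<open>{f}\<close>.\<close>

lemma sing_group_comm_group:
  assumes "A \<in> Ob C" "X \<in> Ob C"
  shows "comm_group (sing_group C A X)"
proof -
  have "(\<lambda>f. {f}) \<in> iso (hom_group C A X) (sing_group C A X)"
    by (auto simp: iso_def hom_def bij_betw_def)
  moreover have "comm_group (hom_group C A X)" using assms hom_comm_group by blast
  moreover have "monoid (sing_group C A X)"
    by (rule monoidI) (use assms Add_assoc in \<open>auto simp: Hom_def\<close>)
  ultimately show ?thesis
    using comm_group.iso_imp_comm_group Group.is_isoI by blast
qed

lemma representable_eq:
  "representable C X = mk_psh C (\<lambda>A. sing_group C A X) (\<lambda>f S. {the_elem S \<cdot> f})"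
  by (simp add: representable_def mk_psh_def)

lemma representable_Ob: "X \<in> Ob C \<Longrightarrow> representable C X \<in> Ob (PSh C)"
  unfolding representable_eq
  by (rule mk_psh_Ob) (auto simp: sing_group_comm_group Hom_def)

lemma representable_simps [simp]:
  "A \<in> Ob C \<Longrightarrow> FO (representable C X) A = sing_group C A X"
  "\<lbrakk>f \<in> Mor C; g \<in> Hom C (Cod C f) X\<rbrakk> \<Longrightarrow> psh_res (representable C X) f {g} = {g \<cdot> f}"
  unfolding representable_eq by simp_all

lemma yoneda_FM_eq:
  "FM (yoneda C) h = mk_psh_mor C (representable C (Dom C h)) (\<lambda>A S. {h \<cdot> the_elem S})
     (representable C (Cod C h))"
  by (auto simp: yoneda_def mk_psh_mor_def intro!: restrict_ext)

lemma yoneda_FO [simp]: "FO (yoneda C) X = representable C X"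
  by (simp add: yoneda_def)

lemma yoneda_Hom:
  "h \<in> Mor C \<Longrightarrow> FM (yoneda C) h \<in> Hom (PSh C) (representable C (Dom C h)) (representable C (Cod C h))"
  unfolding yoneda_FM_eq
  by (rule mk_psh_mor_Hom) (auto simp: representable_Ob Hom_def)

lemma yoneda_map [simp]:
  "\<lbrakk>A \<in> Ob C; g \<in> Hom C A (Dom C h)\<rbrakk> \<Longrightarrow> psh_map (FM (yoneda C) h) A {g} = {h \<cdot> g}"
  unfolding yoneda_FM_eq by simp

text \<open>Naturality along \<open>g\<close> makes the value at \<open>{g}\<close> the restriction
  of the value at the identity. Equations between morphisms out of representables are therefore
  tested on a single element.\<close>

lemma yoneda_inj:
  assumes "a \<in> Hom (PSh C) (representable C X) P" "b \<in> Hom (PSh C) (representable C X) P"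
    and X: "X \<in> Ob C" and eq: "psh_map a X {Idn C X} = psh_map b X {Idn C X}"
  shows "a = b"
proof (rule psh_mor_eqI[OF assms(1,2)])
  fix A x assume A: "A \<in> Ob C" and "x \<in> carrier (FO (representable C X) A)"
  then obtain g where g: "x = {g}" "g \<in> Mor C" "Dom C g = A" "Cod C g = X" by (auto simp: Hom_def)
  have "psh_map t A x = psh_res P g (psh_map t X {Idn C X})"
    if "t \<in> Hom (PSh C) (representable C X) P" for t
    using psh_MorD(9)[OF that, of g "{Idn C X}"] g X by (simp add: Hom_def)
  then show "psh_map a A x = psh_map b A x" using assms(1,2) eq by simp
qed

lemma yoneda_full:
  assumes "X \<in> Ob C" "Y \<in> Ob C" "a \<in> Hom (PSh C) (representable C X) (representable C Y)"
  shows "\<exists>f \<in> Hom C X Y. FM (yoneda C) f = a"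
proof -
  have "psh_map a X {Idn C X} \<in> carrier (FO (representable C Y) X)"
    using psh_MorD(6)[OF assms(3) assms(1), of "{Idn C X}"] assms Idn_Hom by simp
  then obtain f where f: "f \<in> Hom C X Y" "psh_map a X {Idn C X} = {f}"
    using assms by auto
  note f' = HomD[OF f(1)]
  have "FM (yoneda C) f = a"
    by (rule yoneda_inj[OF _ assms(3,1)]) (use f f' yoneda_Hom[of f] assms Idn_Hom in simp_all)
  then show ?thesis using f by blast
qed

lemma yoneda_faithful:
  assumes "f \<in> Hom C X Y" "g \<in> Hom C X Y" "FM (yoneda C) f = FM (yoneda C) g"
  shows "f = g"
proof -
  note f = HomD[OF assms(1)] and g = HomD[OF assms(2)]
  have X: "X \<in> Ob C" using f by auto
  have "{f} = psh_map (FM (yoneda C) f) X {Idn C X}" using X f Idn_Hom by simp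
  also have "\<dots> = {g}" unfolding assms(3) using X g Idn_Hom by simp
  finally show ?thesis by simp
qed

lemma yoneda_additive: "additive_functor C (PSh C) (yoneda C)"
proof -
  have "is_functor C (PSh C) (yoneda C)"
    unfolding is_functor_def
  proof (intro conjI ballI impI)
    fix X assume X: "X \<in> Ob C"
    then show "FO (yoneda C) X \<in> Ob (PSh C)" by (simp add: representable_Ob)
    have "FM (yoneda C) (Idn C X) \<in> Hom (PSh C) (representable C X) (representable C X)"
      using yoneda_Hom[of "Idn C X"] X by simp
    then show "FM (yoneda C) (Idn C X) = Idn (PSh C) (FO (yoneda C) X)"
      by (rule yoneda_inj) (use X Idn_Hom PSh.Idn_Hom[OF representable_Ob] in simp_all)
  next
    fix f g assume f: "f \<in> Mor C" and g: "g \<in> Mor C" and fg: "Cod C f = Dom C g"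
    have 1: "FM (yoneda C) f \<in> Hom (PSh C) (representable C (Dom C f)) (representable C (Dom C g))"
      using yoneda_Hom[OF f] fg by simp
    have 2: "FM (yoneda C) (g \<cdot> f)
        \<in> Hom (PSh C) (representable C (Dom C f)) (representable C (Cod C g))"
      using yoneda_Hom[of "g \<cdot> f"] f g fg by simp
    show "FM (yoneda C) (g \<cdot> f) = FM (yoneda C) g \<cdot>\<^bsub>PSh C\<^esub> FM (yoneda C) f"
      by (rule yoneda_inj[OF 2 PSh.Comp_Hom[OF 1 yoneda_Hom[OF g]]])
        (use f g fg 1 Idn_Hom in \<open>simp_all add: Hom_def\<close>)
  qed (simp add: yoneda_Hom)
  moreover have "FM (yoneda C) (Add C f g) = Add (PSh C) (FM (yoneda C) f) (FM (yoneda C) g)"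
    if fg: "f \<in> Mor C" "g \<in> Mor C" "Dom C f = Dom C g" "Cod C f = Cod C g" for f g
  proof (rule yoneda_inj)
    let ?X = "representable C (Dom C g)" and ?Y = "representable C (Cod C g)"
    note h = HomD[OF yoneda_Hom[OF fg(1)]] HomD[OF yoneda_Hom[OF fg(2)]]
    show "FM (yoneda C) (Add C f g) \<in> Hom (PSh C) ?X ?Y"
      using yoneda_Hom[of "Add C f g"] fg by simp
    show "Add (PSh C) (FM (yoneda C) f) (FM (yoneda C) g) \<in> Hom (PSh C) ?X ?Y"
      using h fg by (simp add: Hom_def)
    show "psh_map (FM (yoneda C) (Add C f g)) (Dom C g) {Idn C (Dom C g)}
        = psh_map (Add (PSh C) (FM (yoneda C) f) (FM (yoneda C) g)) (Dom C g) {Idn C (Dom C g)}"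
      using fg psh_MorD(7,8)[OF yoneda_Hom[OF fg(1)], of "Dom C g"]
        yoneda_map[of "Dom C g" "Idn C (Dom C g)" f] yoneda_map[of "Dom C g" "Idn C (Dom C g)" g]
      by (simp add: PSh_def Idn_Hom)
  qed (use fg in simp)
  ultimately show ?thesis by (simp add: additive_functor_def)
qed

end

section \<open>Explicit cokernels of morphisms between representable presheaves\<close>

definition coker_subgroup :: "('o, 'm) cat \<Rightarrow> 'm \<Rightarrow> 'o \<Rightarrow> 'm set" where
  "coker_subgroup C f A = (\<lambda>w. f \<cdot>\<^bsub>C\<^esub> w) ` Hom C A (Dom C f)"

definition coker_class :: "('o, 'm) cat \<Rightarrow> 'm \<Rightarrow> 'o \<Rightarrow> 'm \<Rightarrow> 'm set" where
  "coker_class C f A g = coker_subgroup C f A #>\<^bsub>hom_group C A (Cod C f)\<^esub> g"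

text \<open>The pointwise quotient of \<open>Hom C A (Cod C f)\<close> by the image of
  \<open>f\<close>; its cosets have type \<open>'m set\<close>, as presheaf values must. Restriction
  acts on a chosen representative, and \<open>coker_class_restrict\<close> shows that the choice is
  immaterial.\<close>

definition coker_psh :: "('o, 'm) cat \<Rightarrow> 'm \<Rightarrow> ('o, 'm) psh" where
  "coker_psh C f = mk_psh C (\<lambda>A. hom_group C A (Cod C f) Mod coker_subgroup C f A)
     (\<lambda>a S. coker_class C f (Dom C a) ((SOME g. g \<in> S) \<cdot>\<^bsub>C\<^esub> a))"

definition coker_proj :: "('o, 'm) cat \<Rightarrow> 'm \<Rightarrow> ('o, 'm) psh_mor" where
  "coker_proj C f = mk_psh_mor C (representable C (Cod C f))
     (\<lambda>A S. coker_class C f A (the_elem S)) (coker_psh C f)"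

context preadditive_category
begin

interpretation PSh: preadditive_category "PSh C" by (rule PSh_preadditive)

context
  fixes f
  assumes f: "f \<in> Mor C"
begin

lemma coker_subgroup_subgroup:
  assumes A: "A \<in> Ob C"
  shows "subgroup (coker_subgroup C f A) (hom_group C A (Cod C f))"
proof -
  interpret G: comm_group "hom_group C A (Cod C f)" using A f hom_comm_group by simp
  show ?thesis
  proof (rule G.subgroupI)
    show "coker_subgroup C f A \<subseteq> carrier (hom_group C A (Cod C f))"
      using f by (auto simp: coker_subgroup_def Hom_def)
    have "Zer C A (Dom C f) \<in> Hom C A (Dom C f)" using A f by (simp add: Hom_def)
    then show "coker_subgroup C f A \<noteq> {}" by (auto simp: coker_subgroup_def)
  next
    fix a assume "a \<in> coker_subgroup C f A"
    then obtain w where w: "a = f \<cdot> w" "w \<in> Mor C" "Dom C w = A" "Cod C w = Dom C f"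
      by (auto simp: coker_subgroup_def Hom_def)
    have "inv\<^bsub>hom_group C A (Cod C f)\<^esub> a = Neg C a" using w f by (simp add: Neg_def)
    also have "\<dots> = f \<cdot> Neg C w" using w f by simp
    finally show "inv\<^bsub>hom_group C A (Cod C f)\<^esub> a \<in> coker_subgroup C f A"
      using w by (auto simp: coker_subgroup_def Hom_def)
  next
    fix a b assume "a \<in> coker_subgroup C f A" "b \<in> coker_subgroup C f A"
    then obtain v w where w: "a = f \<cdot> w" "w \<in> Mor C" "Dom C w = A" "Cod C w = Dom C f"
      and v: "b = f \<cdot> v" "v \<in> Mor C" "Dom C v = A" "Cod C v = Dom C f"
      by (auto simp: coker_subgroup_def Hom_def)
    have "Add C a b = f \<cdot> Add C w v" using w v f by simp
    moreover have "Add C w v \<in> Hom C A (Dom C f)" using w v by (simp add: Hom_def)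
    ultimately show "a \<otimes>\<^bsub>hom_group C A (Cod C f)\<^esub> b \<in> coker_subgroup C f A"
      by (simp add: coker_subgroup_def)
  qed
qed

lemma coker_class_elem_iff:
  "x \<in> coker_class C f A g \<longleftrightarrow> (\<exists>w \<in> Hom C A (Dom C f). x = Add C (f \<cdot> w) g)"
  by (auto simp: coker_class_def coker_subgroup_def r_coset_def)

lemma coker_class_self:
  assumes "A \<in> Ob C" "g \<in> Hom C A (Cod C f)"
  shows "g \<in> coker_class C f A g"
proof -
  interpret G: comm_group "hom_group C A (Cod C f)" using assms f hom_comm_group by simp
  show ?thesis unfolding coker_class_def
    using G.rcos_self coker_subgroup_subgroup[OF assms(1)] assms by simp
qed

lemma coker_class_eqI:
  assumes "A \<in> Ob C" "g \<in> Hom C A (Cod C f)" "x \<in> coker_class C f A g"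
  shows "coker_class C f A x = coker_class C f A g"
proof -
  interpret G: comm_group "hom_group C A (Cod C f)" using assms f hom_comm_group by simp
  show ?thesis
    using G.repr_independence[OF _ _ coker_subgroup_subgroup[OF assms(1)]] assms
    by (simp add: coker_class_def)
qed

lemma coker_class_Zer:
  assumes "A \<in> Ob C" "w \<in> Hom C A (Dom C f)"
  shows "coker_class C f A (f \<cdot> w) = coker_subgroup C f A"
proof -
  interpret G: comm_group "hom_group C A (Cod C f)" using assms f hom_comm_group by simp
  show ?thesis unfolding coker_class_def
    by (rule G.coset_join2[OF _ coker_subgroup_subgroup[OF assms(1)]])
      (use assms f in \<open>auto simp: coker_subgroup_def Hom_def\<close>)
qed

lemma coker_group_simps:
  assumes A: "A \<in> Ob C"
  shows "comm_group (hom_group C A (Cod C f) Mod coker_subgroup C f A)"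
    and "carrier (hom_group C A (Cod C f) Mod coker_subgroup C f A)
      = coker_class C f A ` Hom C A (Cod C f)"
    and "\<one>\<^bsub>hom_group C A (Cod C f) Mod coker_subgroup C f A\<^esub> = coker_subgroup C f A"
    and "\<lbrakk>g \<in> Hom C A (Cod C f); h \<in> Hom C A (Cod C f)\<rbrakk> \<Longrightarrow>
      coker_class C f A g <#>\<^bsub>hom_group C A (Cod C f)\<^esub> coker_class C f A h
      = coker_class C f A (Add C g h)"
proof -
  interpret G: comm_group "hom_group C A (Cod C f)" using assms f hom_comm_group by simp
  interpret N: normal "coker_subgroup C f A" "hom_group C A (Cod C f)"
    by (rule G.subgroup_imp_normal[OF coker_subgroup_subgroup[OF A]])
  show "comm_group (hom_group C A (Cod C f) Mod coker_subgroup C f A)"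
    by (rule G.abelian_FactGroup[OF coker_subgroup_subgroup[OF A]])
  show "carrier (hom_group C A (Cod C f) Mod coker_subgroup C f A)
      = coker_class C f A ` Hom C A (Cod C f)"
    by (auto simp: FactGroup_def RCOSETS_def coker_class_def)
  show "\<one>\<^bsub>hom_group C A (Cod C f) Mod coker_subgroup C f A\<^esub> = coker_subgroup C f A"
    by (simp add: FactGroup_def)
  show "\<lbrakk>g \<in> Hom C A (Cod C f); h \<in> Hom C A (Cod C f)\<rbrakk> \<Longrightarrow>
      coker_class C f A g <#>\<^bsub>hom_group C A (Cod C f)\<^esub> coker_class C f A h
      = coker_class C f A (Add C g h)"
    using N.rcos_sum[of g h] by (simp add: FactGroup_def coker_class_def)
qed

lemma coker_class_some:
  assumes "A \<in> Ob C" "g \<in> Hom C A (Cod C f)"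
  obtains w where "w \<in> Hom C A (Dom C f)"
    "(SOME x. x \<in> coker_class C f A g) = Add C (f \<cdot> w) g"
proof -
  have "(SOME x. x \<in> coker_class C f A g) \<in> coker_class C f A g"
    using coker_class_self[OF assms] by (rule someI)
  then show thesis using that coker_class_elem_iff by blast
qed

text \<open>The chosen representative differs from \<open>g\<close> by some
  \<open>f \<cdot> w\<close>, and precomposition turns this into
  \<open>f \<cdot> (w \<cdot> a)\<close>, again in the subgroup.\<close>

lemma coker_class_restrict:
  assumes a: "a \<in> Mor C" and g: "g \<in> Hom C (Cod C a) (Cod C f)"
  shows "coker_class C f (Dom C a) ((SOME x. x \<in> coker_class C f (Cod C a) g) \<cdot> a)
    = coker_class C f (Dom C a) (g \<cdot> a)"
proof -
  obtain w where w: "w \<in> Hom C (Cod C a) (Dom C f)"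
    "(SOME x. x \<in> coker_class C f (Cod C a) g) = Add C (f \<cdot> w) g"
    using coker_class_some[OF _ g] a by auto
  note w' = HomD[OF w(1)] and g' = HomD[OF g]
  have "Add C (f \<cdot> w) g \<cdot> a = Add C (f \<cdot> (w \<cdot> a)) (g \<cdot> a)" using a f w' g' by simp
  moreover have "w \<cdot> a \<in> Hom C (Dom C a) (Dom C f)" using a w' by (simp add: Hom_def)
  ultimately show ?thesis
    unfolding w(2)
    by (intro coker_class_eqI) (use a g' in \<open>auto simp: coker_class_elem_iff Hom_def\<close>)
qed

lemma coker_psh_Ob: "coker_psh C f \<in> Ob (PSh C)"
  unfolding coker_psh_def
proof (rule mk_psh_Ob)
  fix a x assume a: "a \<in> Mor C"
    and "x \<in> carrier (hom_group C (Cod C a) (Cod C f) Mod coker_subgroup C f (Cod C a))"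
  then obtain g where g: "g \<in> Hom C (Cod C a) (Cod C f)" "x = coker_class C f (Cod C a) g"
    using coker_group_simps(2) by auto
  have ga: "g \<cdot> a \<in> Hom C (Dom C a) (Cod C f)" using a g by (auto simp: Hom_def)
  then show "coker_class C f (Dom C a) ((SOME g. g \<in> x) \<cdot> a)
      \<in> carrier (hom_group C (Dom C a) (Cod C f) Mod coker_subgroup C f (Dom C a))"
    unfolding g(2) coker_class_restrict[OF a g(1)] using a by (simp add: coker_group_simps(2))
  fix y assume "y \<in> carrier (hom_group C (Cod C a) (Cod C f) Mod coker_subgroup C f (Cod C a))"
  then obtain h where h: "h \<in> Hom C (Cod C a) (Cod C f)" "y = coker_class C f (Cod C a) h"
    using coker_group_simps(2) a by auto
  have ha: "h \<cdot> a \<in> Hom C (Dom C a) (Cod C f)" using a h by (auto simp: Hom_def)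
  have gh: "Add C g h \<in> Hom C (Cod C a) (Cod C f)" "Add C g h \<cdot> a = Add C (g \<cdot> a) (h \<cdot> a)"
    using g h a by (auto simp: Hom_def)
  show "coker_class C f (Dom C a) ((SOME g. g \<in>
        x \<otimes>\<^bsub>hom_group C (Cod C a) (Cod C f) Mod coker_subgroup C f (Cod C a)\<^esub> y) \<cdot> a)
      = coker_class C f (Dom C a) ((SOME g. g \<in> x) \<cdot> a)
        \<otimes>\<^bsub>hom_group C (Dom C a) (Cod C f) Mod coker_subgroup C f (Dom C a)\<^esub>
        coker_class C f (Dom C a) ((SOME g. g \<in> y) \<cdot> a)"
    using a g h ga ha gh by (simp add: coker_group_simps(4) coker_class_restrict)
next
  fix A x assume A: "A \<in> Ob C"
    and "x \<in> carrier (hom_group C A (Cod C f) Mod coker_subgroup C f A)"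
  then obtain g where g: "g \<in> Hom C A (Cod C f)" "x = coker_class C f A g"
    using coker_group_simps(2) by auto
  show "coker_class C f (Dom C (Idn C A)) ((SOME g. g \<in> x) \<cdot> Idn C A) = x"
    using coker_class_restrict[of "Idn C A" g] A g HomD[OF g(1)] by simp
next
  fix a b x assume ab: "a \<in> Mor C" "b \<in> Mor C" "Cod C a = Dom C b"
    and "x \<in> carrier (hom_group C (Cod C b) (Cod C f) Mod coker_subgroup C f (Cod C b))"
  then obtain g where g: "g \<in> Hom C (Cod C b) (Cod C f)" "x = coker_class C f (Cod C b) g"
    using coker_group_simps(2) by auto
  have gb: "g \<cdot> b \<in> Hom C (Cod C a) (Cod C f)" using ab g by (auto simp: Hom_def)
  have 1: "coker_class C f (Dom C a) ((SOME g. g \<in> x) \<cdot> (b \<cdot> a))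
      = coker_class C f (Dom C a) (g \<cdot> (b \<cdot> a))"
    using coker_class_restrict[of "b \<cdot> a" g] ab g by simp
  have 2: "coker_class C f (Dom C b) ((SOME g. g \<in> x) \<cdot> b) = coker_class C f (Cod C a) (g \<cdot> b)"
    using coker_class_restrict[OF ab(2) g(1)] ab g by simp
  have "(g \<cdot> b) \<cdot> a = g \<cdot> (b \<cdot> a)" using ab g by (simp add: Hom_def)
  then show "coker_class C f (Dom C (b \<cdot> a)) ((SOME g. g \<in> x) \<cdot> (b \<cdot> a))
      = coker_class C f (Dom C a)
          ((SOME g. g \<in> coker_class C f (Dom C b) ((SOME g. g \<in> x) \<cdot> b)) \<cdot> a)"
    unfolding 2 coker_class_restrict[OF ab(1) gb] using 1 ab by simp
qed (use coker_group_simps(1) in simp)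

lemma coker_psh_simps:
  "A \<in> Ob C \<Longrightarrow> FO (coker_psh C f) A = hom_group C A (Cod C f) Mod coker_subgroup C f A"
  "\<lbrakk>a \<in> Mor C; g \<in> Hom C (Cod C a) (Cod C f)\<rbrakk> \<Longrightarrow>
    psh_res (coker_psh C f) a (coker_class C f (Cod C a) g) = coker_class C f (Dom C a) (g \<cdot> a)"
  by (simp_all add: coker_psh_def coker_class_restrict coker_group_simps(2))

lemma coker_proj_Hom: "coker_proj C f \<in> Hom (PSh C) (representable C (Cod C f)) (coker_psh C f)"
  unfolding coker_proj_def
  by (rule mk_psh_mor_Hom)
    (use f in \<open>auto simp: representable_Ob coker_psh_Ob coker_psh_simps coker_group_simps Hom_def\<close>)

lemma coker_proj_map:
  "\<lbrakk>A \<in> Ob C; g \<in> Hom C A (Cod C f)\<rbrakk> \<Longrightarrow> psh_map (coker_proj C f) A {g} = coker_class C f A g"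
  by (simp add: coker_proj_def)

text \<open>Cokernels of presheaves are computed pointwise: a morphism killing the image of
  \<open>f\<close> is constant on cosets, and the projection hits every coset, which gives
  uniqueness.\<close>

lemma coker_proj_is_cokernel: "is_cokernel (PSh C) (FM (yoneda C) f) (coker_proj C f)"
proof (rule PSh.is_cokernelI)
  note y = HomD[OF yoneda_Hom[OF f]] and c = HomD[OF coker_proj_Hom]
  show "FM (yoneda C) f \<in> Mor (PSh C)" "coker_proj C f \<in> Mor (PSh C)"
    "Dom (PSh C) (coker_proj C f) = Cod (PSh C) (FM (yoneda C) f)"
    using y c by simp_all
  show "coker_proj C f \<cdot>\<^bsub>PSh C\<^esub> FM (yoneda C) f
      = Zer (PSh C) (Dom (PSh C) (FM (yoneda C) f)) (Cod (PSh C) (coker_proj C f))"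
  proof (rule psh_mor_eqI)
    show "coker_proj C f \<cdot>\<^bsub>PSh C\<^esub> FM (yoneda C) f
        \<in> Hom (PSh C) (representable C (Dom C f)) (coker_psh C f)"
      by (rule PSh.Comp_Hom[OF yoneda_Hom[OF f] coker_proj_Hom])
    show "Zer (PSh C) (Dom (PSh C) (FM (yoneda C) f)) (Cod (PSh C) (coker_proj C f))
        \<in> Hom (PSh C) (representable C (Dom C f)) (coker_psh C f)"
      using y c f by (simp add: Hom_def representable_Ob coker_psh_Ob)
    fix A x assume A: "A \<in> Ob C" and "x \<in> carrier (FO (representable C (Dom C f)) A)"
    then obtain w where w: "x = {w}" "w \<in> Hom C A (Dom C f)" by auto
    have fw: "f \<cdot> w \<in> Hom C A (Cod C f)" using w f by (auto simp: Hom_def)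
    show "psh_map (coker_proj C f \<cdot>\<^bsub>PSh C\<^esub> FM (yoneda C) f) A x
        = psh_map (Zer (PSh C) (Dom (PSh C) (FM (yoneda C) f)) (Cod (PSh C) (coker_proj C f))) A x"
      using A w fw y c
      by (simp add: psh_map_Comp[OF yoneda_Hom[OF f]] coker_proj_map coker_class_Zer
          coker_psh_simps coker_group_simps)
  qed
next
  note y = HomD[OF yoneda_Hom[OF f]] and c = HomD[OF coker_proj_Hom]
  fix t assume t0: "t \<in> Mor (PSh C)" "Dom (PSh C) t = Cod (PSh C) (FM (yoneda C) f)"
    and tz: "t \<cdot>\<^bsub>PSh C\<^esub> FM (yoneda C) f
      = Zer (PSh C) (Dom (PSh C) (FM (yoneda C) f)) (Cod (PSh C) t)"
  define T where "T = Cod (PSh C) t"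
  have t: "t \<in> Hom (PSh C) (representable C (Cod C f)) T" using t0 y by (simp add: Hom_def T_def)
  note t' = psh_MorD[OF t]
  have one: "psh_map t A {f \<cdot> w} = \<one>\<^bsub>FO T A\<^esub>" if "A \<in> Ob C" "w \<in> Hom C A (Dom C f)" for A w
    using arg_cong[OF tz, of "\<lambda>t. psh_map t A {w}"] that y
    by (simp add: psh_map_Comp[OF yoneda_Hom[OF f]] T_def)
  \<comment> \<open>The chosen representative differs from \<open>g\<close> by some
    \<open>f \<cdot> w\<close>, which \<open>t\<close> sends to the unit. So the formula for
    \<open>?u\<close> does not depend on the choice.\<close>
  have some: "psh_map t A {SOME x. x \<in> coker_class C f A g} = psh_map t A {g}"
    if A: "A \<in> Ob C" and g: "g \<in> Hom C A (Cod C f)" for A g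
  proof -
    obtain w where w: "w \<in> Hom C A (Dom C f)"
      "(SOME x. x \<in> coker_class C f A g) = Add C (f \<cdot> w) g"
      by (rule coker_class_some[OF A g])
    have fw: "f \<cdot> w \<in> Hom C A (Cod C f)" using w f by (auto simp: Hom_def)
    interpret T: comm_group "FO T A" using psh_ObD(1)[OF t'(2) A] .
    have "psh_map t A ({f \<cdot> w} \<otimes>\<^bsub>sing_group C A (Cod C f)\<^esub> {g})
        = psh_map t A {f \<cdot> w} \<otimes>\<^bsub>FO T A\<^esub> psh_map t A {g}"
      using hom_mult[OF t'(5)[OF A], of "{f \<cdot> w}" "{g}"] A fw g by simp
    then show ?thesis
      using one[OF A w(1)] t'(6)[OF A, of "{g}"] A g by (simp add: w(2))
  qed
  let ?u = "mk_psh_mor C (coker_psh C f) (\<lambda>A S. psh_map t A {SOME x. x \<in> S}) T"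
  have u: "?u \<in> Hom (PSh C) (coker_psh C f) T"
  proof (rule mk_psh_mor_Hom)
    show "coker_psh C f \<in> Ob (PSh C)" "T \<in> Ob (PSh C)" using coker_psh_Ob t' by simp_all
  next
    fix A x assume A: "A \<in> Ob C" and "x \<in> carrier (FO (coker_psh C f) A)"
    then obtain g where g: "g \<in> Hom C A (Cod C f)" "x = coker_class C f A g"
      by (auto simp: coker_psh_simps coker_group_simps)
    then show "psh_map t A {SOME x'. x' \<in> x} \<in> carrier (FO T A)"
      using A some t'(6)[OF A, of "{g}"] by simp
    fix y assume "y \<in> carrier (FO (coker_psh C f) A)"
    then obtain h where h: "h \<in> Hom C A (Cod C f)" "y = coker_class C f A h"
      using A by (auto simp: coker_psh_simps coker_group_simps)
    have gh: "Add C g h \<in> Hom C A (Cod C f)" using g h by (simp add: Hom_def)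
    show "psh_map t A {SOME x'. x' \<in> x \<otimes>\<^bsub>FO (coker_psh C f) A\<^esub> y}
        = psh_map t A {SOME x'. x' \<in> x} \<otimes>\<^bsub>FO T A\<^esub> psh_map t A {SOME x. x \<in> y}"
      using hom_mult[OF t'(5)[OF A], of "{g}" "{h}"] A g h gh
      by (simp add: coker_psh_simps coker_group_simps some)
  next
    fix a x assume a: "a \<in> Mor C" and "x \<in> carrier (FO (coker_psh C f) (Cod C a))"
    then obtain g where g: "g \<in> Hom C (Cod C a) (Cod C f)" "x = coker_class C f (Cod C a) g"
      by (auto simp: coker_psh_simps coker_group_simps)
    have ga: "g \<cdot> a \<in> Hom C (Dom C a) (Cod C f)" using g a by (simp add: Hom_def)
    show "psh_map t (Dom C a) {SOME x'. x' \<in> psh_res (coker_psh C f) a x}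
        = psh_res T a (psh_map t (Cod C a) {SOME x'. x' \<in> x})"
      using t'(9)[OF a, of "{g}"] a g ga by (simp add: coker_psh_simps some)
  qed
  have "?u \<cdot>\<^bsub>PSh C\<^esub> coker_proj C f = t"
    by (rule psh_mor_eqI[OF PSh.Comp_Hom[OF coker_proj_Hom u] t])
      (auto simp: psh_map_Comp[OF coker_proj_Hom] coker_proj_map coker_psh_simps coker_group_simps some)
  then show "\<exists>u. u \<in> Hom (PSh C) (Cod (PSh C) (coker_proj C f)) (Cod (PSh C) t) \<and>
      u \<cdot>\<^bsub>PSh C\<^esub> coker_proj C f = t"
    using u c by (auto simp: T_def)
next
  note c = HomD[OF coker_proj_Hom]
  fix u assume u0: "u \<in> Mor (PSh C)" "Dom (PSh C) u = Cod (PSh C) (coker_proj C f)"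
    and uz: "u \<cdot>\<^bsub>PSh C\<^esub> coker_proj C f = Zer (PSh C) (Dom (PSh C) (coker_proj C f)) (Cod (PSh C) u)"
  show "u = Zer (PSh C) (Cod (PSh C) (coker_proj C f)) (Cod (PSh C) u)"
  proof (rule psh_mor_eqI)
    show "u \<in> Hom (PSh C) (coker_psh C f) (Cod (PSh C) u)"
      "Zer (PSh C) (Cod (PSh C) (coker_proj C f)) (Cod (PSh C) u)
        \<in> Hom (PSh C) (coker_psh C f) (Cod (PSh C) u)"
      using u0 c by (simp_all add: Hom_def coker_psh_Ob)
    fix A x assume A: "A \<in> Ob C" and x: "x \<in> carrier (FO (coker_psh C f) A)"
    then obtain g where g: "g \<in> Hom C A (Cod C f)" "x = coker_class C f A g"
      by (auto simp: coker_psh_simps coker_group_simps)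
    then show "psh_map u A x = psh_map (Zer (PSh C) (Cod (PSh C) (coker_proj C f)) (Cod (PSh C) u)) A x"
      using arg_cong[OF uz, of "\<lambda>t. psh_map t A {g}"] A x c
      by (simp add: psh_map_Comp[OF coker_proj_Hom] coker_proj_map)
  qed
qed

end

end

text \<open>A representable presheaf is the cokernel of its own zero endomorphism.\<close>

lemma (in additive_category) representable_fin_presented:
  assumes "X \<in> Ob C"
  shows "fin_presented C (representable C X)"
proof -
  interpret PSh: preadditive_category "PSh C" by (rule PSh_preadditive)
  let ?X = "representable C X"
  have X: "?X \<in> Ob (PSh C)" using representable_Ob[OF assms] .
  have "is_cokernel (PSh C) (Zer (PSh C) ?X ?X) (Idn (PSh C) ?X)"
    by (rule PSh.is_cokernelI) (use X in \<open>auto simp: Hom_def\<close>)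
  moreover have "Zer (PSh C) ?X ?X \<in> Hom (PSh C) ?X ?X" using X by (simp add: Hom_def)
  moreover have "Cod (PSh C) (Idn (PSh C) ?X) = ?X" using X by simp
  ultimately show ?thesis unfolding fin_presented_def using assms by blast
qed

text \<open>The axioms speak of arbitrary cokernels, which are determined only up to isomorphism.
  Comparison with the explicit coset presheaf turns projectivity of representables into the choice
  of a coset representative.\<close>

lemma (in additive_category) fp_completion_Rcat: "fp_completion C (Rcat C) (yoneda C)"
proof -
  interpret PSh: preadditive_category "PSh C" by (rule PSh_preadditive)
  interpret R: preadditive_category "Rcat C"
    unfolding Rcat_def by (rule PSh.full_subcat_preadditive)
  note rfp = representable_fin_presented
  have Hom_R: "Hom (Rcat C) P Q
      = (if fin_presented C P \<and> fin_presented C Q then Hom (PSh C) P Q else {})" for P Q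
    by (simp add: Rcat_def Hom_full_subcat)
  have R_simps: "g \<cdot>\<^bsub>Rcat C\<^esub> f = g \<cdot>\<^bsub>PSh C\<^esub> f" "Zer (Rcat C) = Zer (PSh C)"
    "Dom (Rcat C) = Dom (PSh C)" "Cod (Rcat C) = Cod (PSh C)" for f g
    by (simp_all add: Rcat_def)
  have coker: "is_cokernel (Rcat C) (FM (yoneda C) f) (coker_proj C f)" if f: "f \<in> Mor C" for f
  proof -
    have "fin_presented C (coker_psh C f)"
      unfolding fin_presented_def
      using coker_proj_is_cokernel[OF f] yoneda_Hom[OF f] HomD(3)[OF coker_proj_Hom[OF f]]
        Dom_Ob[OF f] Cod_Ob[OF f] by blast
    then show ?thesis
      unfolding Rcat_def
      by (intro is_cokernel_full_subcat coker_proj_is_cokernel f)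
        (use HomD[OF yoneda_Hom[OF f]] HomD[OF coker_proj_Hom[OF f]] rfp f in simp_all)
  qed
  \<comment> \<open>Two cokernels of one morphism are isomorphic: \<open>is_cokernel_iso\<close>
    with identities on both sides of the square.\<close>
  have compare: "\<exists>v. v \<in> Hom (PSh C) (Cod (Rcat C) c) (coker_psh C f) \<and>
      v \<cdot>\<^bsub>Rcat C\<^esub> c = coker_proj C f \<and> is_iso (Rcat C) v"
    if f: "f \<in> Mor C" and c: "is_cokernel (Rcat C) (FM (yoneda C) f) c" for f c
  proof -
    note c' = R.is_cokernelD[OF c] and d' = R.is_cokernelD[OF coker[OF f]]
      and p = HomD[OF coker_proj_Hom[OF f]]
    obtain v where v: "v \<in> Mor (Rcat C)" "Dom (Rcat C) v = Cod (Rcat C) c"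
      "Cod (Rcat C) v = Cod (Rcat C) (coker_proj C f)" "v \<cdot>\<^bsub>Rcat C\<^esub> c = coker_proj C f"
      using R.is_cokernel_factor[OF c, of "coker_proj C f" "Cod (Rcat C) (coker_proj C f)"] d'
      by (auto simp: Hom_def)
    have "is_iso (Rcat C) v"
      by (rule R.is_cokernel_iso[OF c coker[OF f], where
            a = "Idn (Rcat C) (Cod (Rcat C) (FM (yoneda C) f))" and
            b = "Idn (Rcat C) (Dom (Rcat C) (FM (yoneda C) f))"])
        (use v c' d' in \<open>auto simp: Hom_def intro!: R.is_iso_Idn\<close>)
    moreover have "v \<in> Hom (PSh C) (Cod (Rcat C) c) (coker_psh C f)"
      using v p by (auto simp: Rcat_def Hom_def)
    ultimately show ?thesis using v by blast
  qed
  show ?thesis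
  proof (intro fp_completion.intro additive_functor_between.intro fp_completion_axioms.intro
      additive_functor_between_axioms.intro)
    show "additive_functor C (Rcat C) (yoneda C)"
      using yoneda_additive rfp
      unfolding additive_functor_def is_functor_def by (auto simp: Hom_R) (auto simp: Rcat_def)
  next
    fix X Y t assume "X \<in> Ob C" "Y \<in> Ob C" "t \<in> Hom (Rcat C) (FO (yoneda C) X) (FO (yoneda C) Y)"
    then show "\<exists>f\<in>Hom C X Y. FM (yoneda C) f = t"
      using yoneda_full[of X Y t] by (simp add: Hom_R split: if_splits)
  next
    fix P assume "P \<in> Ob (Rcat C)"
    then have P: "fin_presented C P" by (simp add: Rcat_def)
    then obtain X Y t c where t: "X \<in> Ob C" "Y \<in> Ob C"
      "t \<in> Hom (PSh C) (representable C X) (representable C Y)"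
      and c: "is_cokernel (PSh C) t c" "Cod (PSh C) c = P"
      unfolding fin_presented_def by blast
    obtain f where f: "f \<in> Hom C X Y" "FM (yoneda C) f = t" using yoneda_full[OF t] by blast
    have "is_cokernel (Rcat C) t c"
      unfolding Rcat_def
      by (intro is_cokernel_full_subcat c(1)) (use HomD[OF t(3)] t rfp P c in simp_all)
    then show "\<exists>f\<in>Mor C. \<exists>c. is_cokernel (Rcat C) (FM (yoneda C) f) c \<and> Cod (Rcat C) c = P"
      using f c HomD(1)[OF f(1)] by (auto simp: R_simps)
  next
    fix f c X t assume f: "f \<in> Mor C" and c: "is_cokernel (Rcat C) (FM (yoneda C) f) c"
      and X: "X \<in> Ob C" and t: "t \<in> Hom (Rcat C) (FO (yoneda C) X) (Cod (Rcat C) c)"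
    obtain v where v: "v \<in> Hom (PSh C) (Cod (Rcat C) c) (coker_psh C f)"
      "v \<cdot>\<^bsub>Rcat C\<^esub> c = coker_proj C f" "is_iso (Rcat C) v" using compare[OF f c] by blast
    have t': "t \<in> Hom (PSh C) (representable C X) (Cod (Rcat C) c)"
      using t by (simp add: Hom_R split: if_splits)
    have vt: "v \<cdot>\<^bsub>PSh C\<^esub> t \<in> Hom (PSh C) (representable C X) (coker_psh C f)"
      by (rule PSh.Comp_Hom[OF t' v(1)])
    \<comment> \<open>By Yoneda, a morphism from a representable presheaf is an element, here a
      coset; a representative \<open>g\<close> of it gives the lift.\<close>
    have "psh_map (v \<cdot>\<^bsub>PSh C\<^esub> t) X {Idn C X} \<in> coker_class C f X ` Hom C X (Cod C f)"
      using psh_MorD(6)[OF vt X, of "{Idn C X}"] X Idn_Hom f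
      by (simp add: coker_psh_simps coker_group_simps)
    then obtain g where g: "g \<in> Hom C X (Cod C f)"
      "psh_map (v \<cdot>\<^bsub>PSh C\<^esub> t) X {Idn C X} = coker_class C f X g" by blast
    note g' = HomD[OF g(1)]
    have yg: "FM (yoneda C) g \<in> Hom (PSh C) (representable C X) (representable C (Cod C f))"
      using yoneda_Hom[OF g'(1)] g' by simp
    have "coker_proj C f \<cdot>\<^bsub>PSh C\<^esub> FM (yoneda C) g = v \<cdot>\<^bsub>PSh C\<^esub> t"
    proof (rule yoneda_inj[OF PSh.Comp_Hom[OF yg coker_proj_Hom[OF f]] vt X])
      show "psh_map (coker_proj C f \<cdot>\<^bsub>PSh C\<^esub> FM (yoneda C) g) X {Idn C X}
          = psh_map (v \<cdot>\<^bsub>PSh C\<^esub> t) X {Idn C X}"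
        unfolding g(2) using X g g' f Idn_Hom
        by (simp add: psh_map_Comp[OF yg] coker_proj_map)
    qed
    moreover have ygR: "FM (yoneda C) g \<in> Hom (Rcat C) (representable C X) (representable C (Cod C f))"
      using yg rfp X f by (simp add: Hom_R)
    ultimately have eq: "v \<cdot>\<^bsub>Rcat C\<^esub> (c \<cdot>\<^bsub>Rcat C\<^esub> FM (yoneda C) g) = v \<cdot>\<^bsub>Rcat C\<^esub> t"
      using R.assoc_simp[of "FM (yoneda C) g" c v] v(2) R.is_cokernelD[OF c] HomD[OF ygR]
        R.inv_mor_simps[OF v(3)] HomD[OF v(1)] HomD[OF yoneda_Hom[OF f]]
      by (simp add: R_simps)
    have cg: "Cod (Rcat C) (FM (yoneda C) g) = Dom (Rcat C) c"
      using R.is_cokernelD[OF c] HomD[OF ygR] HomD[OF yoneda_Hom[OF f]] by (simp add: R_simps)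
    have vd: "Dom (Rcat C) v = Cod (Rcat C) c" using HomD[OF v(1)] by (simp add: R_simps)
    have "inv_mor (Rcat C) v \<cdot>\<^bsub>Rcat C\<^esub> (v \<cdot>\<^bsub>Rcat C\<^esub> (c \<cdot>\<^bsub>Rcat C\<^esub> FM (yoneda C) g))
        = inv_mor (Rcat C) v \<cdot>\<^bsub>Rcat C\<^esub> (v \<cdot>\<^bsub>Rcat C\<^esub> t)" unfolding eq ..
    then have "c \<cdot>\<^bsub>Rcat C\<^esub> FM (yoneda C) g = t"
      using R.inv_mor_cancel(1)[OF v(3)] cg vd HomD[OF t] HomD[OF ygR] R.is_cokernelD[OF c] by simp
    then show "\<exists>g\<in>Hom C X (Cod C f). c \<cdot>\<^bsub>Rcat C\<^esub> FM (yoneda C) g = t" using g by blast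
  next
    fix f c g assume f: "f \<in> Mor C" and c: "is_cokernel (Rcat C) (FM (yoneda C) f) c"
      and g: "g \<in> Mor C" "Cod C g = Cod C f"
      and z: "c \<cdot>\<^bsub>Rcat C\<^esub> FM (yoneda C) g = Zer (Rcat C) (FO (yoneda C) (Dom C g)) (Cod (Rcat C) c)"
    obtain v where v: "v \<in> Hom (PSh C) (Cod (Rcat C) c) (coker_psh C f)"
      "v \<cdot>\<^bsub>Rcat C\<^esub> c = coker_proj C f" "is_iso (Rcat C) v" using compare[OF f c] by blast
    let ?X = "Dom C g"
    have X: "?X \<in> Ob C" using g by simp
    have yg: "FM (yoneda C) g \<in> Hom (PSh C) (representable C ?X) (representable C (Cod C f))"
      using yoneda_Hom[OF g(1)] g by simp
    have c': "c \<in> Hom (PSh C) (representable C (Cod C f)) (Cod (Rcat C) c)"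
      using R.is_cokernelD[OF c] HomD[OF yoneda_Hom[OF f]] by (simp add: Rcat_def Hom_def)
    have "coker_proj C f \<cdot>\<^bsub>PSh C\<^esub> FM (yoneda C) g = (v \<cdot>\<^bsub>PSh C\<^esub> c) \<cdot>\<^bsub>PSh C\<^esub> FM (yoneda C) g"
      unfolding v(2)[unfolded R_simps] ..
    also have "\<dots> = v \<cdot>\<^bsub>PSh C\<^esub> (c \<cdot>\<^bsub>PSh C\<^esub> FM (yoneda C) g)"
      using PSh.Comp_assoc[OF yg c' v(1)] by simp
    also have "\<dots> = v \<cdot>\<^bsub>PSh C\<^esub> Zer (PSh C) (representable C ?X) (Cod (PSh C) c)"
      unfolding z[unfolded R_simps] by simp
    also have "\<dots> = Zer (PSh C) (representable C ?X) (coker_psh C f)"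
      using HomD[OF v(1)] representable_Ob[OF X] by (simp add: R_simps)
    \<comment> \<open>Evaluated at the identity, vanishing says that the coset of \<open>g\<close>
      is the subgroup itself, so \<open>g\<close> lies in the image of \<open>f\<close>.\<close>
    finally have "psh_map (coker_proj C f \<cdot>\<^bsub>PSh C\<^esub> FM (yoneda C) g) ?X {Idn C ?X}
        = coker_subgroup C f ?X"
      using X f Idn_Hom by (simp add: coker_psh_simps coker_group_simps)
    then have "coker_class C f ?X g = coker_subgroup C f ?X"
      using X f g Idn_Hom by (simp add: psh_map_Comp[OF yg] coker_proj_map Hom_def)
    then have "g \<in> coker_subgroup C f ?X"
      using coker_class_self[OF f X, of g] g by (simp add: Hom_def)
    then show "\<exists>h\<in>Hom C (Dom C g) (Dom C f). f \<cdot> h = g" by (auto simp: coker_subgroup_def)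
  qed (use coker yoneda_faithful additive_category_axioms preadditive_category_axioms
      R.preadditive_category_axioms in blast)+
qed

section \<open>The abelian hull\<close>

text \<open>Cokernels in \<open>Rcat C\<close> are kernels in its opposite. Over this base finitely
  presented presheaves have kernels and cokernels, and the last passage to the opposite exchanges
  the two.\<close>

lemma (in additive_category) abelian_hull_preabelian: "preabelian_category (abelian_hull C)"
proof -
  interpret E: fp_completion C "Rcat C" "yoneda C" by (rule fp_completion_Rcat)
  interpret E': additive_category "op_cat (Rcat C)"
    by (rule additive_category.additive_op[OF E.additive_category_R])
  interpret H: fp_completion "op_cat (Rcat C)" "Rcat (op_cat (Rcat C))" "yoneda (op_cat (Rcat C))"
    by (rule E'.fp_completion_Rcat)
  have "\<exists>k. is_kernel (op_cat (Rcat C)) f k" if "f \<in> Mor (op_cat (Rcat C))" for f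
    using E.has_cokernel that by simp
  then show ?thesis
    unfolding abelian_hull_def Lcat_def
    using additive_category.additive_op[OF H.additive_category_R] H.has_kernel H.has_cokernel
    by (intro preabelian_category.intro preabelian_category_axioms.intro) auto
qed

text \<open>Every object of the hull is a kernel of a morphism between cokernels of morphisms of \<open>C\<close>.\<close>

lemma (in additive_category) abelian_hull_nat_iso:
  assumes A: "preadditive_category A"
    and t: "nat_trans (abelian_hull C) A F G t"
    and FG: "is_functor (abelian_hull C) A F" "is_functor (abelian_hull C) A G"
    and F: "\<And>f k. is_kernel (abelian_hull C) f k \<Longrightarrow> is_kernel A (FM F f) (FM F k)"
      "\<And>f c. is_cokernel (abelian_hull C) f c \<Longrightarrow> is_cokernel A (FM F f) (FM F c)"
    and G: "\<And>f k. is_kernel (abelian_hull C) f k \<Longrightarrow> is_kernel A (FM G f) (FM G k)"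
      "\<And>f c. is_cokernel (abelian_hull C) f c \<Longrightarrow> is_cokernel A (FM G f) (FM G c)"
    and iso: "\<And>X. X \<in> Ob C \<Longrightarrow> is_iso A (t (FO (hull_embedding C) X))"
    and M: "M \<in> Ob (abelian_hull C)"
  shows "is_iso A (t M)"
proof -
  interpret A: preadditive_category A by fact
  interpret E: fp_completion C "Rcat C" "yoneda C" by (rule fp_completion_Rcat)
  interpret E': additive_category "op_cat (Rcat C)"
    by (rule additive_category.additive_op[OF E.additive_category_R])
  interpret R: fp_completion "op_cat (Rcat C)" "Rcat (op_cat (Rcat C))" "yoneda (op_cat (Rcat C))"
    by (rule E'.fp_completion_Rcat)
  interpret H: preabelian_category "abelian_hull C" by (rule abelian_hull_preabelian)
  let ?H = "abelian_hull C" and ?y = "yoneda (op_cat (Rcat C))"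
  note t' = nat_transD[OF t] and F' = is_functorD[OF FG(1)] and G' = is_functorD[OF FG(2)]
  have H_eq: "?H = op_cat (Rcat (op_cat (Rcat C)))" by (simp add: abelian_hull_def Lcat_def)
  \<comment> \<open>By naturality \<open>t (Cod ?H c)\<close> is the map induced on the cokernels of
    \<open>F f\<close> and \<open>G f\<close> by an invertible square. \<open>ker_step\<close> is
    the same for kernels.\<close>
  have coker_step: "is_iso A (t (Cod ?H c))"
    if c: "is_cokernel ?H f c" and "is_iso A (t (Dom ?H f))" "is_iso A (t (Cod ?H f))" for f c
  proof (rule A.is_cokernel_iso[OF F(2)[OF c] G(2)[OF c] that(3,2)])
    note c' = H.is_cokernelD[OF c]
    show "t (Cod ?H c) \<in> Hom A (Cod A (FM F c)) (Cod A (FM G c))"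
      using c' t' F' G' by (simp add: Hom_def)
    show "t (Cod ?H f) \<cdot>\<^bsub>A\<^esub> FM F f = FM G f \<cdot>\<^bsub>A\<^esub> t (Dom ?H f)" using t'(4) c' by simp
    show "t (Cod ?H c) \<cdot>\<^bsub>A\<^esub> FM F c = FM G c \<cdot>\<^bsub>A\<^esub> t (Cod ?H f)" using t'(4)[of c] c' by simp
  qed (use H.is_cokernelD[OF c] t' F' G' in simp_all)
  have ker_step: "is_iso A (t (Dom ?H k))"
    if k: "is_kernel ?H f k" and "is_iso A (t (Dom ?H f))" "is_iso A (t (Cod ?H f))" for f k
  proof (rule A.is_kernel_iso[OF F(1)[OF k] G(1)[OF k] that(2,3)])
    note k' = H.is_kernelD[OF k]
    show "t (Dom ?H k) \<in> Hom A (Dom A (FM F k)) (Dom A (FM G k))"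
      using k' t' F' G' by (simp add: Hom_def)
    show "t (Cod ?H f) \<cdot>\<^bsub>A\<^esub> FM F f = FM G f \<cdot>\<^bsub>A\<^esub> t (Dom ?H f)" using t'(4) k' by simp
    show "FM G k \<cdot>\<^bsub>A\<^esub> t (Dom ?H k) = t (Dom ?H f) \<cdot>\<^bsub>A\<^esub> FM F k" using t'(4)[of k] k' by simp
  qed (use H.is_kernelD[OF k] t' F' G' in simp_all)
  have fp: "is_iso A (t (FO ?y P))" if P: "P \<in> Ob (Rcat C)" for P
  proof -
    obtain f c where f: "f \<in> Mor C" "is_cokernel (Rcat C) (FM (yoneda C) f) c" "Cod (Rcat C) c = P"
      "c \<in> Mor (Rcat C)" using E.presentation[OF P] by metis
    \<comment> \<open>The Yoneda embedding of \<open>op_cat (Rcat C)\<close> preserves kernels; read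
      in opposite categories, it carries a cokernel in \<open>Rcat C\<close> to a cokernel in the
      hull.\<close>
    have "is_cokernel ?H (FM ?y (FM (yoneda C) f)) (FM ?y c)"
      using R.preserves_kernel[of "FM (yoneda C) f" c] f by (simp add: H_eq)
    moreover have "Dom ?H (FM ?y (FM (yoneda C) f)) = FO (hull_embedding C) (Dom C f)"
      "Cod ?H (FM ?y (FM (yoneda C) f)) = FO (hull_embedding C) (Cod C f)"
      "Cod ?H (FM ?y c) = FO ?y P"
      using f R.functor_simps(3,4)[of c] R.functor_simps(3,4)[of "FM (yoneda C) f"]
        E.functor_simps(2-4)[of f]
      by (simp_all add: H_eq hull_embedding_def comp_ftor_def del: yoneda_FO E.functor_simps)
    ultimately show ?thesis using coker_step iso f(1) by (metis Dom_Ob Cod_Ob)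
  qed
  have "M \<in> Ob (Rcat (op_cat (Rcat C)))" using M by (simp add: H_eq)
  \<comment> \<open>A presentation in \<open>Rcat (op_cat (Rcat C))\<close> is a cokernel there,
    hence a kernel in the hull, of a morphism between objects covered by \<open>fp\<close>.\<close>
  then obtain f c where f: "f \<in> Mor (Rcat C)"
    "is_cokernel (Rcat (op_cat (Rcat C))) (FM ?y f) c" "Cod (Rcat (op_cat (Rcat C))) c = M"
    using R.presentation[of M] by (metis op_cat_simps(2))
  then have "is_kernel ?H (FM ?y f) c" by (simp add: H_eq)
  moreover have "Dom ?H c = M" "Dom ?H (FM ?y f) = FO ?y (Dom (Rcat C) f)"
    "Cod ?H (FM ?y f) = FO ?y (Cod (Rcat C) f)"
    using f R.functor_simps(3,4)[of f] by (simp_all add: H_eq del: yoneda_FO)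
  ultimately show ?thesis
    using ker_step[of "FM ?y f" c] fp E.R.Dom_Ob E.R.Cod_Ob f(1) by simp
qed

section \<open>Units and counits of adjoint pairs\<close>

text \<open>In the compatibility square the other two sides, the inverse of the second comparison
  and the image of the first, are invertible. The equivalence is used in both directions: along
  \<beta> to reach the unit on the targets, and along \<iota> to come back to the unit on the
  factorizations.\<close>

lemma adjoint_pair_unit_iso_iff:
  assumes E: "category (rtgt R1)" "category (rtgt R2)"
    and R: "is_functor (rsrc R1) (rtgt R1) (rfun R1)"
    and \<kappa>1: "nat_iso (rsrc R1) (rtgt R2) (mG \<alpha>1 \<circ>\<^sub>F rfun R1) (rfun R2 \<circ>\<^sub>F mF \<alpha>1) (m\<kappa> \<alpha>1)"
    and \<kappa>2: "nat_iso (rsrc R2) (rtgt R1) (mG \<alpha>2 \<circ>\<^sub>F rfun R2) (rfun R1 \<circ>\<^sub>F mF \<alpha>2) (m\<kappa> \<alpha>2)"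
    and adj: "adjunction (rsrc R1) (rsrc R2) (mF \<alpha>1) (mF \<alpha>2) \<eta> \<epsilon>"
    and adj': "adjunction (rtgt R1) (rtgt R2) (mG \<alpha>1) (mG \<alpha>2) \<eta>' \<epsilon>'"
    and pair: "adjoint_pair R1 R2 \<alpha>1 \<alpha>2 \<eta> \<epsilon> \<eta>' \<epsilon>'"
    and X: "X \<in> Ob (rsrc R1)"
  shows "is_iso (rtgt R1) (FM (rfun R1) (\<eta> X)) \<longleftrightarrow> is_iso (rtgt R1) (\<eta>' (FO (rfun R1) X))"
proof -
  interpret E1: category "rtgt R1" by fact
  have FX: "FO (mF \<alpha>1) X \<in> Ob (rsrc R2)"
    using adj X by (auto simp: adjunction_def is_functor_def)
  have G2: "is_functor (rtgt R2) (rtgt R1) (mG \<alpha>2)" using adj' by (simp add: adjunction_def)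
  have nt: "nat_trans (rsrc R1) (rsrc R1) id_ftor (mF \<alpha>2 \<circ>\<^sub>F mF \<alpha>1) \<eta>"
    and nt': "nat_trans (rtgt R1) (rtgt R1) id_ftor (mG \<alpha>2 \<circ>\<^sub>F mG \<alpha>1) \<eta>'"
    using adj adj' by (auto simp: adjunction_def)
  note RX = is_functorD(1)[OF R X] and \<eta> = nat_transD(1-3)[OF nt X]
  note \<eta>' = nat_transD(1-3)[OF nt' RX]
  have k1: "is_iso (rtgt R2) (m\<kappa> \<alpha>1 X)" "m\<kappa> \<alpha>1 X \<in> Mor (rtgt R2)"
    "Dom (rtgt R2) (m\<kappa> \<alpha>1 X) = FO (mG \<alpha>1) (FO (rfun R1) X)"
    using \<kappa>1 X by (auto simp: nat_iso_def nat_trans_def Hom_def comp_ftor_def)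
  have k2: "is_iso (rtgt R1) (m\<kappa> \<alpha>2 (FO (mF \<alpha>1) X))"
    "Cod (rtgt R1) (m\<kappa> \<alpha>2 (FO (mF \<alpha>1) X)) = FO (rfun R1) (FO (mF \<alpha>2) (FO (mF \<alpha>1) X))"
    using \<kappa>2 FX by (auto simp: nat_iso_def nat_trans_def Hom_def comp_ftor_def)
  note i2 = E1.inv_mor_simps[OF k2(1)] and g1 = is_functorD(2-4)[OF G2 k1(2)]
  have eq: "inv_mor (rtgt R1) (m\<kappa> \<alpha>2 (FO (mF \<alpha>1) X)) \<cdot>\<^bsub>rtgt R1\<^esub> FM (rfun R1) (\<eta> X)
      = FM (mG \<alpha>2) (m\<kappa> \<alpha>1 X) \<cdot>\<^bsub>rtgt R1\<^esub> \<eta>' (FO (rfun R1) X)"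
    using pair X by (simp add: adjoint_pair_def Let_def)
  have l: "FM (rfun R1) (\<eta> X) \<in> Mor (rtgt R1)"
    "Cod (rtgt R1) (FM (rfun R1) (\<eta> X))
      = Dom (rtgt R1) (inv_mor (rtgt R1) (m\<kappa> \<alpha>2 (FO (mF \<alpha>1) X)))"
    using is_functorD(2,4)[OF R \<eta>(1)] \<eta> i2 k2 by (simp_all add: comp_ftor_def)
  have r: "\<eta>' (FO (rfun R1) X) \<in> Mor (rtgt R1)"
    "Cod (rtgt R1) (\<eta>' (FO (rfun R1) X)) = Dom (rtgt R1) (FM (mG \<alpha>2) (m\<kappa> \<alpha>1 X))"
    using \<eta>' g1 k1 by (simp_all add: comp_ftor_def)
  note iso1 = E1.is_iso_inv_mor[OF k2(1)] and iso2 = is_functor_is_iso[OF G2 k1(1) E(2)]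
  show ?thesis
    using E1.is_iso_Comp[OF _ iso1 l(2)] E1.is_iso_cancel_left[OF _ iso1 l]
      E1.is_iso_Comp[OF _ iso2 r(2)] E1.is_iso_cancel_left[OF _ iso2 r] unfolding eq by blast
qed

text \<open>For counits the comparison isomorphisms stand on the source side of the square, so they
  are cancelled from the right.\<close>

lemma adjoint_pair_counit_iso_iff:
  assumes E: "category (rtgt R1)" "category (rtgt R2)"
    and R: "is_functor (rsrc R2) (rtgt R2) (rfun R2)"
    and \<kappa>1: "nat_iso (rsrc R1) (rtgt R2) (mG \<alpha>1 \<circ>\<^sub>F rfun R1) (rfun R2 \<circ>\<^sub>F mF \<alpha>1) (m\<kappa> \<alpha>1)"
    and \<kappa>2: "nat_iso (rsrc R2) (rtgt R1) (mG \<alpha>2 \<circ>\<^sub>F rfun R2) (rfun R1 \<circ>\<^sub>F mF \<alpha>2) (m\<kappa> \<alpha>2)"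
    and adj: "adjunction (rsrc R1) (rsrc R2) (mF \<alpha>1) (mF \<alpha>2) \<eta> \<epsilon>"
    and adj': "adjunction (rtgt R1) (rtgt R2) (mG \<alpha>1) (mG \<alpha>2) \<eta>' \<epsilon>'"
    and pair: "adjoint_pair R1 R2 \<alpha>1 \<alpha>2 \<eta> \<epsilon> \<eta>' \<epsilon>'"
    and Y: "Y \<in> Ob (rsrc R2)"
  shows "is_iso (rtgt R2) (FM (rfun R2) (\<epsilon> Y)) \<longleftrightarrow> is_iso (rtgt R2) (\<epsilon>' (FO (rfun R2) Y))"
proof -
  interpret E1: category "rtgt R1" by fact
  interpret E2: category "rtgt R2" by fact
  have FY: "FO (mF \<alpha>2) Y \<in> Ob (rsrc R1)"
    using adj Y by (auto simp: adjunction_def is_functor_def)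
  have G1: "is_functor (rtgt R1) (rtgt R2) (mG \<alpha>1)" using adj' by (simp add: adjunction_def)
  have nt: "nat_trans (rsrc R2) (rsrc R2) (mF \<alpha>1 \<circ>\<^sub>F mF \<alpha>2) id_ftor \<epsilon>"
    and nt': "nat_trans (rtgt R2) (rtgt R2) (mG \<alpha>1 \<circ>\<^sub>F mG \<alpha>2) id_ftor \<epsilon>'"
    using adj adj' by (auto simp: adjunction_def)
  note RY = is_functorD(1)[OF R Y] and \<epsilon> = nat_transD(1-3)[OF nt Y]
  note \<epsilon>' = nat_transD(1-3)[OF nt' RY]
  have k1: "is_iso (rtgt R2) (m\<kappa> \<alpha>1 (FO (mF \<alpha>2) Y))"
    "Cod (rtgt R2) (m\<kappa> \<alpha>1 (FO (mF \<alpha>2) Y)) = FO (rfun R2) (FO (mF \<alpha>1) (FO (mF \<alpha>2) Y))"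
    using \<kappa>1 FY by (auto simp: nat_iso_def nat_trans_def Hom_def comp_ftor_def)
  have k2: "is_iso (rtgt R1) (m\<kappa> \<alpha>2 Y)"
    "Dom (rtgt R1) (m\<kappa> \<alpha>2 Y) = FO (mG \<alpha>2) (FO (rfun R2) Y)"
    using \<kappa>2 Y by (auto simp: nat_iso_def nat_trans_def Hom_def comp_ftor_def)
  note i2 = E1.inv_mor_simps[OF k2(1)]
  note g1 = is_functorD(2-4)[OF G1 i2(2)]
  have eq: "FM (rfun R2) (\<epsilon> Y) \<cdot>\<^bsub>rtgt R2\<^esub> m\<kappa> \<alpha>1 (FO (mF \<alpha>2) Y)
      = \<epsilon>' (FO (rfun R2) Y) \<cdot>\<^bsub>rtgt R2\<^esub> FM (mG \<alpha>1) (inv_mor (rtgt R1) (m\<kappa> \<alpha>2 Y))"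
    using pair Y by (simp add: adjoint_pair_def Let_def)
  have l: "FM (rfun R2) (\<epsilon> Y) \<in> Mor (rtgt R2)"
    "Cod (rtgt R2) (m\<kappa> \<alpha>1 (FO (mF \<alpha>2) Y)) = Dom (rtgt R2) (FM (rfun R2) (\<epsilon> Y))"
    using is_functorD(2,3)[OF R \<epsilon>(1)] \<epsilon> k1 by (simp_all add: comp_ftor_def)
  have r: "\<epsilon>' (FO (rfun R2) Y) \<in> Mor (rtgt R2)"
    "Cod (rtgt R2) (FM (mG \<alpha>1) (inv_mor (rtgt R1) (m\<kappa> \<alpha>2 Y))) = Dom (rtgt R2) (\<epsilon>' (FO (rfun R2) Y))"
    using \<epsilon>' g1 i2 k2 by (simp_all add: comp_ftor_def)
  note iso2 = is_functor_is_iso[OF G1 E1.is_iso_inv_mor[OF k2(1)] E(1)]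
  show ?thesis
    using E2.is_iso_Comp[OF k1(1) _ l(2)] E2.is_iso_cancel_right[OF _ k1(1) l]
      E2.is_iso_Comp[OF iso2 _ r(2)] E2.is_iso_cancel_right[OF _ iso2 r] unfolding eq by blast
qed

section \<open>The universal abelian factorization\<close>

lemma rep_exact_to_abelian:
  assumes "abelian_rep R" "hull_extension R B"
  shows "exact_to_abelian (abelian_hull (rsrc R)) (rtgt R) B"
  using assms additive_category.abelian_hull_preabelian
  by (auto simp: abelian_rep_def hull_extension_def intro: exact_to_abelian.intro
      exact_to_abelian_axioms.intro)

lemma univ_fact_iso:
  assumes "abelian_rep R" "hull_extension R B" "fact_iota R B \<iota>" "P \<in> Mor (univ_fact R B)"
    "is_iso (rtgt R) (FM \<iota> P)"
  shows "is_iso (univ_fact R B) P"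
proof -
  interpret exact_to_abelian "abelian_hull (rsrc R)" "rtgt R" B
    using assms by (intro rep_exact_to_abelian)
  show ?thesis
    using induced_functor_reflects_iso[of \<iota> P] assms
    by (simp add: fact_iota_def univ_fact_def fact_quot_def hull_ker_def exact_functor_def
        additive_functor_def)
qed

text \<open>The quotient functor is the identity on objects, so \<iota> and \<open>B\<close> agree
  there. This lets results about values of \<open>B\<close> on the hull be used for \<iota>.\<close>

lemma fact_iota_FO:
  assumes "fact_iota R B \<iota>" "X \<in> Ob (abelian_hull (rsrc R))"
  shows "FO \<iota> X = FO B X"
  using assms
  by (simp add: fact_iota_def ftor_eq_def comp_ftor_def fact_quot_def quotient_functor_def)

lemma univ_fact_Ob [simp]: "Ob (univ_fact R B) = Ob (abelian_hull (rsrc R))"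
  by (simp add: univ_fact_def serre_quotient_def)

lemma is_functor_comp:
  assumes "is_functor C D F" "is_functor D E G"
  shows "is_functor C E (G \<circ>\<^sub>F F)"
  unfolding is_functor_def comp_ftor_def
  using is_functorD[OF assms(1)] is_functorD[OF assms(2)] by (auto intro!: HomI)

text \<open>Precomposing \<open>t\<close> with \<open>B\<close> gives a transformation between exact
  functors on the hull; on embedded objects it is \<open>t\<close> at the values of
  \<open>rfun R\<close>, because \<open>B\<close> extends \<open>rfun R\<close>.\<close>

lemma hull_extension_nat_iso:
  assumes R: "abelian_rep R" and B: "hull_extension R B"
    and t: "nat_trans (rtgt R) (rtgt R) F G t"
    and F: "exact_functor (rtgt R) (rtgt R) F" and G: "exact_functor (rtgt R) (rtgt R) G"
    and iso: "\<And>X. X \<in> Ob (rsrc R) \<Longrightarrow> is_iso (rtgt R) (t (FO (rfun R) X))"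
    and M: "M \<in> Ob (abelian_hull (rsrc R))"
  shows "is_iso (rtgt R) (t (FO B M))"
proof -
  interpret exact_to_abelian "abelian_hull (rsrc R)" "rtgt R" B
    using assms by (intro rep_exact_to_abelian)
  interpret D: additive_category "rsrc R" using R by (simp add: abelian_rep_def)
  have FG: "is_functor (rtgt R) (rtgt R) F" "is_functor (rtgt R) (rtgt R) G"
    using F G by (auto simp: exact_functor_def additive_functor_def)
  note FGB = is_functor_comp[OF is_functor FG(1)] is_functor_comp[OF is_functor FG(2)]
  note t' = nat_transD[OF t]
  show ?thesis
  proof (rule D.abelian_hull_nat_iso[where F = "F \<circ>\<^sub>F B" and G = "G \<circ>\<^sub>F B" and t = "\<lambda>M. t (FO B M)",
        OF A.preadditive_category_axioms _ FGB])
    show "nat_trans (abelian_hull (rsrc R)) (rtgt R) (F \<circ>\<^sub>F B) (G \<circ>\<^sub>F B) (\<lambda>M. t (FO B M))"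
    proof (rule nat_transI)
      fix f assume f: "f \<in> Mor (abelian_hull (rsrc R))"
      then show "t (FO B (Cod (abelian_hull (rsrc R)) f)) \<cdot>\<^bsub>rtgt R\<^esub> FM (F \<circ>\<^sub>F B) f
          = FM (G \<circ>\<^sub>F B) f \<cdot>\<^bsub>rtgt R\<^esub> t (FO B (Dom (abelian_hull (rsrc R)) f))"
        using t'(4)[of "FM B f"] by (simp add: comp_ftor_def)
    qed (use t' in \<open>simp add: comp_ftor_def\<close>)
  next
    fix X assume X: "X \<in> Ob (rsrc R)"
    then have "FO B (FO (hull_embedding (rsrc R)) X) = FO (rfun R) X"
      using B by (simp add: hull_extension_def ftor_eq_def comp_ftor_def)
    then show "is_iso (rtgt R) (t (FO B (FO (hull_embedding (rsrc R)) X)))" using iso X by simp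
  qed (use F G M functor_kernel functor_cokernel in \<open>auto simp: exact_functor_def comp_ftor_def\<close>)
qed

lemma exact_functor_comp:
  assumes "exact_functor C D F" "exact_functor D E G"
  shows "exact_functor C E (G \<circ>\<^sub>F F)"
proof -
  have F: "additive_functor C D F" and G: "additive_functor D E G"
    using assms by (auto simp: exact_functor_def)
  note f = additive_functorD[OF F] and g = additive_functorD[OF G]
  have "additive_functor C E (G \<circ>\<^sub>F F)"
    unfolding additive_functor_def
    using is_functor_comp[OF f(1) g(1)] f(2) g(2) is_functorD[OF f(1)] by (simp add: comp_ftor_def)
  then show ?thesis using assms by (simp add: exact_functor_def comp_ftor_def)
qed

lemma exact_functor_id: "exact_functor C C id_ftor"
  by (auto simp: exact_functor_def additive_functor_def is_functor_def id_ftor_def Hom_def)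

theorem corollary3p9:
  fixes R1 :: "('o1, 'm1, 'p1, 'n1) rep" and R2 :: "('o2, 'm2, 'p2, 'n2) rep"
    and B1 :: "(('o1, 'm1) hull_ob, ('o1, 'm1) hull_mor, 'p1, 'n1) ftor"
    and B2 :: "(('o2, 'm2) hull_ob, ('o2, 'm2) hull_mor, 'p2, 'n2) ftor"
    and \<iota>1 :: "(('o1, 'm1) hull_ob, ('o1, 'm1) fact_mor, 'p1, 'n1) ftor"
    and \<iota>2 :: "(('o2, 'm2) hull_ob, ('o2, 'm2) fact_mor, 'p2, 'n2) ftor"
    and \<alpha>1 :: "('o1, 'm1, 'p1, 'n1, 'o2, 'm2, 'p2, 'n2) one_mor"
    and \<alpha>2 :: "('o2, 'm2, 'p2, 'n2, 'o1, 'm1, 'p1, 'n1) one_mor"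
    and \<psi>1 :: "(('o1, 'm1) hull_ob, ('o1, 'm1) fact_mor,
                ('o2, 'm2) hull_ob, ('o2, 'm2) fact_mor) ftor"
    and \<psi>2 :: "(('o2, 'm2) hull_ob, ('o2, 'm2) fact_mor,
                ('o1, 'm1) hull_ob, ('o1, 'm1) fact_mor) ftor"
    and \<kappa>1' :: "('o1, 'm1) hull_ob \<Rightarrow> 'n2" and \<kappa>2' :: "('o2, 'm2) hull_ob \<Rightarrow> 'n1"
    and \<eta> :: "'o1 \<Rightarrow> 'm1" and \<epsilon> :: "'o2 \<Rightarrow> 'm2"
    and \<eta>A :: "'p1 \<Rightarrow> 'n1" and \<epsilon>A :: "'p2 \<Rightarrow> 'n2"
    and \<eta>' :: "('o1, 'm1) hull_ob \<Rightarrow> ('o1, 'm1) fact_mor"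
    and \<epsilon>' :: "('o2, 'm2) hull_ob \<Rightarrow> ('o2, 'm2) fact_mor"
  assumes "abelian_rep R1" and "abelian_rep R2"
    \<comment> \<open>the universal abelian factorizations\<close>
    and "hull_extension R1 B1" and "hull_extension R2 B2"
    and "fact_iota R1 B1 \<iota>1" and "fact_iota R2 B2 \<iota>2"
    \<comment> \<open>the adjoint pair of exact morphisms\<close>
    and "exact_one_morphism R1 R2 \<alpha>1" and "exact_one_morphism R2 R1 \<alpha>2"
    and "adjunction (rsrc R1) (rsrc R2) (mF \<alpha>1) (mF \<alpha>2) \<eta> \<epsilon>"
    and "adjunction (rtgt R1) (rtgt R2) (mG \<alpha>1) (mG \<alpha>2) \<eta>A \<epsilon>A"
    and "adjoint_pair R1 R2 \<alpha>1 \<alpha>2 \<eta> \<epsilon> \<eta>A \<epsilon>A"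
    \<comment> \<open>the lifts\<close>
    and "lift_functor R1 B1 R2 B2 \<alpha>1 \<psi>1" and "lift_functor R2 B2 R1 B1 \<alpha>2 \<psi>2"
    and "lift_iso R1 B1 \<iota>1 R2 \<iota>2 \<alpha>1 \<psi>1 \<kappa>1'" and "lift_iso R2 B2 \<iota>2 R1 \<iota>1 \<alpha>2 \<psi>2 \<kappa>2'"
    \<comment> \<open>the induced adjunction\<close>
    and "adjunction (univ_fact R1 B1) (univ_fact R2 B2) \<psi>1 \<psi>2 \<eta>' \<epsilon>'"
    and "adjoint_pair (pi_rep R1 B1) (pi_rep R2 B2)
           (hat_mor R2 B2 \<alpha>1 \<psi>1) (hat_mor R1 B1 \<alpha>2 \<psi>2) \<eta> \<epsilon> \<eta>' \<epsilon>'"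
    and "adjoint_pair (iota_rep R1 B1 \<iota>1) (iota_rep R2 B2 \<iota>2)
           (tilde_mor \<alpha>1 \<psi>1 \<kappa>1') (tilde_mor \<alpha>2 \<psi>2 \<kappa>2') \<eta>' \<epsilon>' \<eta>A \<epsilon>A"
    \<comment> \<open>the additional hypothesis\<close>
    and "adjoint_equivalence (rsrc R1) (rsrc R2) (mF \<alpha>1) (mF \<alpha>2) \<eta> \<epsilon>"
  shows "adjoint_equivalence (univ_fact R1 B1) (univ_fact R2 B2) \<psi>1 \<psi>2 \<eta>' \<epsilon>'"
proof -
  interpret A1: abelian_category "rtgt R1" using assms(1) by (simp add: abelian_rep_def)
  interpret A2: abelian_category "rtgt R2" using assms(2) by (simp add: abelian_rep_def)
  have G: "exact_functor (rtgt R1) (rtgt R2) (mG \<alpha>1)" "exact_functor (rtgt R2) (rtgt R1) (mG \<alpha>2)"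
    and \<kappa>: "nat_iso (rsrc R1) (rtgt R2) (mG \<alpha>1 \<circ>\<^sub>F rfun R1) (rfun R2 \<circ>\<^sub>F mF \<alpha>1) (m\<kappa> \<alpha>1)"
      "nat_iso (rsrc R2) (rtgt R1) (mG \<alpha>2 \<circ>\<^sub>F rfun R2) (rfun R1 \<circ>\<^sub>F mF \<alpha>2) (m\<kappa> \<alpha>2)"
    using assms(7,8) by (auto simp: exact_one_morphism_def one_morphism_def)
  have R: "is_functor (rsrc R1) (rtgt R1) (rfun R1)" "is_functor (rsrc R2) (rtgt R2) (rfun R2)"
    using assms(1,2) by (auto simp: abelian_rep_def additive_functor_def)
  have \<iota>: "is_functor (univ_fact R1 B1) (rtgt R1) \<iota>1" "is_functor (univ_fact R2 B2) (rtgt R2) \<iota>2"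
    using assms(5,6) by (auto simp: fact_iota_def exact_functor_def additive_functor_def)
  have D: "category (rsrc R1)" "category (rsrc R2)"
    using assms(1,2) by (auto simp: abelian_rep_def additive_category_def preadditive_category_def)
  have nt: "nat_trans (rtgt R1) (rtgt R1) id_ftor (mG \<alpha>2 \<circ>\<^sub>F mG \<alpha>1) \<eta>A"
    "nat_trans (rtgt R2) (rtgt R2) (mG \<alpha>1 \<circ>\<^sub>F mG \<alpha>2) id_ftor \<epsilon>A"
    "nat_trans (univ_fact R1 B1) (univ_fact R1 B1) id_ftor (\<psi>2 \<circ>\<^sub>F \<psi>1) \<eta>'"
    "nat_trans (univ_fact R2 B2) (univ_fact R2 B2) (\<psi>1 \<circ>\<^sub>F \<psi>2) id_ftor \<epsilon>'"
    using assms(10,16) by (auto simp: adjunction_def)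
  note cats = A1.category_axioms A2.category_axioms
  note unit = adjoint_pair_unit_iso_iff[OF cats R(1) \<kappa> assms(9-11)]
    and counit = adjoint_pair_counit_iso_iff[OF cats R(2) \<kappa> assms(9-11)]
  have \<eta>A: "is_iso (rtgt R1) (\<eta>A (FO B1 X))" if "X \<in> Ob (univ_fact R1 B1)" for X
  proof (rule hull_extension_nat_iso[OF assms(1,3) nt(1) exact_functor_id exact_functor_comp[OF G]])
    fix X assume X: "X \<in> Ob (rsrc R1)"
    then have "is_iso (rsrc R1) (\<eta> X)" using assms(19) by (simp add: adjoint_equivalence_def)
    then show "is_iso (rtgt R1) (\<eta>A (FO (rfun R1) X))"
      using unit[OF X] is_functor_is_iso[OF R(1) _ D(1)] by blast
  qed (use that in simp)
  have \<epsilon>A: "is_iso (rtgt R2) (\<epsilon>A (FO B2 Y))" if "Y \<in> Ob (univ_fact R2 B2)" for Y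
  proof (rule hull_extension_nat_iso[OF assms(2,4) nt(2) exact_functor_comp[OF G(2,1)] exact_functor_id])
    fix Y assume Y: "Y \<in> Ob (rsrc R2)"
    then have "is_iso (rsrc R2) (\<epsilon> Y)" using assms(19) by (simp add: adjoint_equivalence_def)
    then show "is_iso (rtgt R2) (\<epsilon>A (FO (rfun R2) Y))"
      using counit[OF Y] is_functor_is_iso[OF R(2) _ D(2)] by blast
  qed (use that in simp)
  let ?R1 = "iota_rep R1 B1 \<iota>1" and ?R2 = "iota_rep R2 B2 \<iota>2"
  let ?\<alpha>1 = "tilde_mor \<alpha>1 \<psi>1 \<kappa>1'" and ?\<alpha>2 = "tilde_mor \<alpha>2 \<psi>2 \<kappa>2'"
  \<comment> \<open>Here the unit criterion is read backwards, for the representations \<iota>: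
    invertibility of \<open>\<eta>A\<close> at \<open>FO \<iota>1 X = FO B1 X\<close> passes to the
    image of \<open>\<eta>'\<close> under \<iota>.\<close>
  have "is_iso (rtgt R1) (FM \<iota>1 (\<eta>' X))" if X: "X \<in> Ob (univ_fact R1 B1)" for X
    using adjoint_pair_unit_iso_iff[of ?R1 ?R2 ?\<alpha>1 ?\<alpha>2 \<eta>' \<epsilon>' \<eta>A \<epsilon>A X] cats \<iota> assms(10,14-16,18)
      X \<eta>A[OF X] fact_iota_FO[OF assms(5), of X]
    by (simp add: iota_rep_def tilde_mor_def lift_iso_def)
  moreover have "is_iso (rtgt R2) (FM \<iota>2 (\<epsilon>' Y))" if Y: "Y \<in> Ob (univ_fact R2 B2)" for Y
    using adjoint_pair_counit_iso_iff[of ?R1 ?R2 ?\<alpha>1 ?\<alpha>2 \<eta>' \<epsilon>' \<eta>A \<epsilon>A Y] cats \<iota> assms(10,14-16,18)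
      Y \<epsilon>A[OF Y] fact_iota_FO[OF assms(6), of Y]
    by (simp add: iota_rep_def tilde_mor_def lift_iso_def)
  ultimately show ?thesis
    unfolding adjoint_equivalence_def
    using assms(16) univ_fact_iso[OF assms(1,3,5) nat_transD(1)[OF nt(3)]]
      univ_fact_iso[OF assms(2,4,6) nat_transD(1)[OF nt(4)]] by blast
qed

end
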